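(* There exist absolute constants $C>1$ and $c>0$ such that the following holds. Consider the SSBM in the context with $\eta\in[0,1/2)$, $k\ge2$, $n\ge10$, suppose $\sqrt\rho>1-\frac{1}{4k(2+\sqrt k)}$, and let $\delta\in(0,\frac12)$, $r\ge1$ with $$p>\left(\frac{2kC_4}{\delta(1-2\eta)}\right)^8\frac2n,\qquad C_4=128Cr^2+1.$$ If the regularization parameters $\gamma^+,\gamma^-\ge0$ satisfy $\gamma:=\gamma^++\gamma^-=\bar d^{7/8}$, then with probability at least $1-7e^{-2r}-\frac2n-ne^{-np/c}$ there exists an orthogonal matrix $O\in\mathbb R^{(k-1)\times(k-1)}$ with $$\|V_{k-1}(L_\gamma)-\Theta R_{k-1}O\|\le2\delta.$$
   Context: SSBM: integers $n\ge2,k\ge2$, $p\in(0,1]$, $\eta\in[0,1/2)$, partition of $[n]$ into nonempty clusters $C_1,\dots,C_k$, $|C_i|=n_i$. Independently for each unordered pair $j\ne j'$ an edge is present w.p. $p$, signed $+1$ if $j,j'$ in the same cluster and $-1$ otherwise, then the sign flipped independently w.p. $\eta$. $A$ symmetric signed adjacency (zero diagonal), $A^\pm=\max(\pm A,0)$, $\bar D=\mathrm{diag}((A^++A^-)\mathbf1)$, $\bar d=p(n-1)$. $s=\min n_i/n$, $l=\max n_i/n$, $\rho=s/l$. $\Theta_{ji}=1/\sqrt{n_i}$ if $j\in C_i$ else 0. Regularized Laplacian: $A_\gamma=A+\frac{\gamma^+-\gamma^-}{n}\mathbf1\mathbf1^\top$, $\bar D_\gamma=\bar D+\gamma I$, $L_\gamma=I-\bar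 D_\gamma^{-1/2}A_\gamma\bar D_\gamma^{-1/2}$. $V_{k-1}(M)$: $n\times(k-1)$ matrix of orthonormal eigenvectors for the $k-1$ smallest eigenvalues. With $\bar\alpha=1+\frac p{\bar d}(1-2\eta)$, $\bar C=\bar\alpha I_k-\bar B$, $\bar B_{ii}=\frac{n_ip}{\bar d}(1-2\eta)$, $\bar B_{ii'}=-\frac{\sqrt{n_in_{i'}}p}{\bar d}(1-2\eta)$ ($i\ne i'$); $R_{k-1}\in\mathbb R^{k\times(k-1)}$ has as columns orthonormal eigenvectors of the $k-1$ smallest eigenvalues of $\bar C$. *)

theory Defs
  imports "HOL-Probability.Probability" "Jordan_Normal_Form.Char_Poly"
begin

text \<open>Signed stochastic block model (SSBM).  Vertices are 0..n-1, clusters are 0..k-1,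
  the partition is given by a labelling cl (vertex j lies in cluster cl j).\<close>

definition is_partition :: "nat \<Rightarrow> nat \<Rightarrow> (nat \<Rightarrow> nat) \<Rightarrow> bool" where
  "is_partition n k cl \<longleftrightarrow> (\<forall>j<n. cl j < k) \<and> (\<forall>i<k. \<exists>j<n. cl j = i)"

definition csize :: "nat \<Rightarrow> (nat \<Rightarrow> nat) \<Rightarrow> nat \<Rightarrow> nat" where
  "csize n cl i = card {j. j < n \<and> cl j = i}"

definition pairs :: "nat \<Rightarrow> (nat \<times> nat) set" where
  "pairs n = {(j, j'). j < j' \<and> j' < n}"

definition entry_pmf :: "real \<Rightarrow> real \<Rightarrow> bool \<Rightarrow> real pmf" where
  "entry_pmf p \<eta> same =
     map_pmf (\<lambda>(e, f). if e then (if same then 1 else -1) * (if f then -1 else 1) else 0)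
       (pair_pmf (bernoulli_pmf p) (bernoulli_pmf \<eta>))"

definition sym_adj :: "nat \<Rightarrow> (nat \<times> nat \<Rightarrow> real) \<Rightarrow> real mat" where
  "sym_adj n X = mat n n (\<lambda>(i, j). if i < j then X (i, j) else if j < i then X (j, i) else 0)"

definition ssbm :: "nat \<Rightarrow> (nat \<Rightarrow> nat) \<Rightarrow> real \<Rightarrow> real \<Rightarrow> real mat pmf" where
  "ssbm n cl p \<eta> =
     map_pmf (sym_adj n)
       (Pi_pmf (pairs n) 0 (\<lambda>(j, j'). entry_pmf p \<eta> (cl j = cl j')))"

text \<open>Degree matrix D = diag((A^+ + A^-) 1), i.e. row sums of absolute values.\<close>
definition degree :: "real mat \<Rightarrow> nat \<Rightarrow> real" where
  "degree A i = (\<Sum>j<dim_col A. \<bar>A $$ (i, j)\<bar>)"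

definition reg_laplacian :: "real mat \<Rightarrow> real \<Rightarrow> real \<Rightarrow> real mat" where
  "reg_laplacian A gp gm =
     (let n = dim_row A;
          A\<gamma> = A + ((gp - gm) / real n) \<cdot>\<^sub>m mat n n (\<lambda>_. 1);
          Dh = mat_diag n (\<lambda>i. 1 / sqrt (degree A i + (gp + gm)))
      in 1\<^sub>m n - Dh * A\<gamma> * Dh)"

definition Theta :: "nat \<Rightarrow> nat \<Rightarrow> (nat \<Rightarrow> nat) \<Rightarrow> real mat" where
  "Theta n k cl = mat n k (\<lambda>(j, i). if cl j = i then 1 / sqrt (real (csize n cl i)) else 0)"

definition Cbar :: "nat \<Rightarrow> nat \<Rightarrow> (nat \<Rightarrow> nat) \<Rightarrow> real \<Rightarrow> real \<Rightarrow> real mat" where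
  "Cbar n k cl p \<eta> =
     (let d = p * (real n - 1);
          \<alpha> = 1 + p / d * (1 - 2 * \<eta>);
          B = mat k k (\<lambda>(i, i'). if i = i' then real (csize n cl i) * p / d * (1 - 2 * \<eta>)
                 else - sqrt (real (csize n cl i) * real (csize n cl i')) * p / d * (1 - 2 * \<eta>))
      in \<alpha> \<cdot>\<^sub>m 1\<^sub>m k - B)"

text \<open>V is a (dim M) x m matrix whose columns are orthonormal eigenvectors of the (symmetric)
  matrix M for its m smallest eigenvalues (counted with multiplicity): the columns are
  orthonormal eigenvectors with eigenvalues lam 0, ..., lam (m-1), and every eigenvalue
  of M having an eigenvector orthogonal to all columns of V is at least each lam i.\<close>
definition bottom_eigvecs :: "real mat \<Rightarrow> nat \<Rightarrow> real mat \<Rightarrow> bool" where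
  "bottom_eigvecs M m V \<longleftrightarrow>
     V \<in> carrier_mat (dim_row M) m \<and> transpose_mat V * V = 1\<^sub>m m \<and>
     (\<exists>lam. M * V = V * mat_diag m lam \<and>
        (\<forall>\<mu> v. eigenvector M v \<mu> \<and> (\<forall>i<m. col V i \<bullet> v = 0) \<longrightarrow> (\<forall>i<m. lam i \<le> \<mu>)))"

definition orth_mat :: "nat \<Rightarrow> real mat \<Rightarrow> bool" where
  "orth_mat m Q \<longleftrightarrow> Q \<in> carrier_mat m m \<and> transpose_mat Q * Q = 1\<^sub>m m"

definition op_norm :: "real mat \<Rightarrow> real" where
  "op_norm M = Sup {sqrt ((M *\<^sub>v v) \<bullet> (M *\<^sub>v v)) | v. v \<in> carrier_vec (dim_col M) \<and> v \<bullet> v \<le> 1}"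

end

theory Submission
  imports Defs
begin

text \<open>
  Put \<open>d = p (n - 1)\<close> and \<open>q = d powr (1/8)\<close>, so that \<open>\<gamma> = q^7\<close>. The term \<open>n exp (- n p / c)\<close> of the
  failure probability pays for all degrees lying within \<open>d / 2\<close> of \<open>d\<close>, so the regularised Laplacian
  differs from its population version by \<open>O(1 / q)\<close> in operator norm as soon as the centred signed
  and unsigned adjacency matrices have norm \<open>O(q^7)\<close>. This is far weaker than the optimal \<open>O(q^4)\<close> and
  has a short proof in the style of Kahn and Szemeredi: pairs with \<open>\<bar>x i * y j\<bar> \<le> q^7 / n\<close> are treated by
  an exponential moment bound and a union bound over a grid; for the other pairs either one
  coordinate dominates the other by a factor \<open>q\<close> and the degree bound suffices, or both vertices lie
  in a set of at most \<open>2 n / q^6\<close> vertices, and small induced subgraphs are sparse, hence degenerate.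
  The hypothesis on \<open>p\<close> makes \<open>1 / q\<close> a small multiple of \<open>\<delta>\<close> times the population eigengap, which
  is of order \<open>(1 - 2 * \<eta>) / k\<close>, and the Davis-Kahan theorem in operator norm together with the polar
  decomposition of \<open>transpose U * V\<close> finishes the proof.
\<close>

text \<open>Degrees known only up to \<open>d / 2\<close> leave each normalising factor uncertain by
  a constant, so the degree event alone cannot give an error \<open>O(1 / q)\<close>. The bound for
  the unsigned centred matrix fills this gap: applied to the all-ones vector, it controls the vector
  of degree errors in Euclidean norm by \<open>O(q^7 * sqrt n)\<close>. This suffices because the
  entries of the population matrix all have the same modulus, of order at most \<open>1 / n\<close>,
  so by Cauchy-Schwarz only the mean square of the errors of the normalising factors enters; the
  uniform degree bound keeps these factors of order at most \<open>1 / q^4\<close>. The exponent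
  \<open>7/8\<close> fits this scheme: the noise norm, the regularisation and the root-mean-square
  degree error are all of order \<open>q^7\<close>, a factor \<open>q\<close> below
  \<open>d = q^8\<close>. Population eigenvalues may coincide or nearly do so, hence only the span
  of the embedding is stable and an orthogonal factor has to be found. Everything after the
  probabilistic event is deterministic and holds for all admissible eigenvector matrices at
  once.\<close>

unbundle no inner_syntax

section \<open>Exponential moments\<close>

text \<open>For negative \<open>u = - v\<close> the claim amounts to
  \<open>1 \<le> (1 - v + v^2) * exp v\<close>, and the quadratic Taylor minorant of
  \<open>exp v\<close> already yields it.\<close>

lemma exp_le_quadratic:
  fixes u :: real
  assumes "\<bar>u\<bar> \<le> 1"
  shows "exp u \<le> 1 + u + u\<^sup>2"
proof (cases "u \<ge> 0")
  case True
  then show ?thesis using assms exp_bound[of u] by simp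
next
  case False
  define v where "v = - u"
  have v: "0 \<le> v" "v \<le> 1" using False assms by (auto simp: v_def)
  have "1 + v + v\<^sup>2 / 2 \<le> exp v" using exp_lower_Taylor_quadratic[OF v(1)] by simp
  moreover have "1 \<le> (1 - v + v\<^sup>2) * (1 + v + v\<^sup>2 / 2)"
  proof -
    have "(1 - v + v\<^sup>2) * (1 + v + v\<^sup>2 / 2) = 1 + v^2/2 + v^3/2 + v^4/2"
      by (simp add: field_simps power2_eq_square power3_eq_cube power4_eq_xxxx)
    then show ?thesis using v by simp
  qed
  moreover have "0 \<le> 1 - v + v\<^sup>2" using v by (simp add: add_nonneg_nonneg)
  ultimately have "1 \<le> (1 - v + v\<^sup>2) * exp v"
    by (meson mult_left_mono order_trans)
  then have "exp (-v) \<le> 1 - v + v\<^sup>2"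
    by (simp add: exp_minus field_simps)
  then show ?thesis by (simp add: v_def)
qed

text \<open>Markov's inequality for the exponential of the sum; independence turns the expectation
  into a product. The Chernoff parameter is absorbed into \<open>\<phi>\<close>, so that weights may
  differ from pair to pair, and finite supports supply integrability.\<close>

lemma Pi_pmf_chernoff:
  fixes \<phi> :: "'e \<Rightarrow> 'v \<Rightarrow> real"
  assumes A: "finite A" and fin: "\<And>e. e \<in> A \<Longrightarrow> finite (set_pmf (P e))"
    and mgf: "\<And>e. e \<in> A \<Longrightarrow> measure_pmf.expectation (P e) (\<lambda>v. exp (\<phi> e v)) \<le> exp (c e)"
  shows "measure_pmf.prob (Pi_pmf A dflt P) {X. t \<le> (\<Sum>e\<in>A. \<phi> e (X e))} \<le> exp (sum c A - t)"
proof -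
  let ?P = "Pi_pmf A dflt P"
  let ?u = "\<lambda>X. \<Prod>e\<in>A. exp (\<phi> e (X e))"
  have finP: "finite (set_pmf ?P)"
    using set_Pi_pmf_subset'[OF A, of dflt P] fin A
    by (metis comp_apply finite_PiE_dflt finite_subset)
  have "{X. t \<le> (\<Sum>e\<in>A. \<phi> e (X e))} = {X \<in> space (measure_pmf ?P). exp t \<le> ?u X}"
    by (simp add: exp_sum[OF A, symmetric])
  then have "measure_pmf.prob ?P {X. t \<le> (\<Sum>e\<in>A. \<phi> e (X e))}
      \<le> measure_pmf.expectation ?P ?u / exp t"
    using integral_Markov_inequality_measure[of "measure_pmf ?P" ?u UNIV "exp t"]
      integrable_measure_pmf_finite[OF finP, of ?u] by (simp add: prod_nonneg)
  also have "measure_pmf.expectation ?P ?u = (\<Prod>e\<in>A. measure_pmf.expectation (P e) (\<lambda>v. exp (\<phi> e v)))"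
    by (rule expectation_prod_Pi_pmf) (auto intro: A integrable_measure_pmf_finite fin)
  also have "\<dots> \<le> (\<Prod>e\<in>A. exp (c e))"
    by (rule prod_mono) (auto intro: mgf)
  also have "\<dots> = exp (sum c A)" by (simp add: exp_sum[OF A])
  finally show ?thesis by (simp add: exp_diff divide_right_mono)
qed

section \<open>Moment bounds for a single entry of the adjacency matrix\<close>

lemma finite_set_entry_pmf: "finite (set_pmf (entry_pmf p \<eta> b))"
  unfolding entry_pmf_def by simp

lemma expectation_entry_pmf:
  fixes f :: "real \<Rightarrow> real"
  assumes "0 \<le> p" "p \<le> 1" "0 \<le> \<eta>" "\<eta> \<le> 1"
  defines "s \<equiv> (\<lambda>b. if b then 1 else - 1 :: real)"
  shows "measure_pmf.expectation (entry_pmf p \<eta> b) f =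
    (1 - p) * f 0 + p * ((1 - \<eta>) * f (s b) + \<eta> * f (- s b))"
proof -
  have "measure_pmf.expectation (entry_pmf p \<eta> b) f = measure_pmf.expectation (pair_pmf (bernoulli_pmf p) (bernoulli_pmf \<eta>))
     (\<lambda>(e, g). f (if e then s b * (if g then -1 else 1) else 0))"
    unfolding entry_pmf_def s_def by (simp add: case_prod_unfold)
  also have "\<dots> = (\<Sum>x\<in>UNIV. pmf (pair_pmf (bernoulli_pmf p) (bernoulli_pmf \<eta>)) x *
       (case x of (e, g) \<Rightarrow> f (if e then s b * (if g then -1 else 1) else 0)))"
    by (subst integral_measure_pmf[of UNIV]) auto
  also have "\<dots> = (1 - p) * f 0 + p * ((1 - \<eta>) * f (s b) + \<eta> * f (- s b))"
    using assms by (simp add: UNIV_Times_UNIV[symmetric] sum.cartesian_product[symmetric] UNIV_bool pmf_pair field_simps del: UNIV_Times_UNIV)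
  finally show ?thesis .
qed

definition emean :: "real \<Rightarrow> real \<Rightarrow> bool \<Rightarrow> real" where
  "emean p \<eta> b = p * (1 - 2 * \<eta>) * (if b then 1 else - 1)"

text \<open>The linear term of \<open>exp_le_quadratic\<close> vanishes in expectation. The variance
  proxy is \<open>p\<close> and not a constant, which is what makes the later bounds strong enough
  for sparse graphs.\<close>

lemma mgf_centered:
  assumes fin: "finite (set_pmf P)" and "measure_pmf.expectation P \<xi> = 0"
    and "measure_pmf.expectation P (\<lambda>v. (\<xi> v)\<^sup>2) \<le> (p::real)"
    and b: "\<And>v. v \<in> set_pmf P \<Longrightarrow> \<bar>a * \<xi> v\<bar> \<le> 1"
  shows "measure_pmf.expectation P (\<lambda>v. exp (a * \<xi> v)) \<le> exp (a\<^sup>2 * p)"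
proof -
  note I = integrable_measure_pmf_finite[OF fin]
  have "measure_pmf.expectation P (\<lambda>v. exp (a * \<xi> v)) \<le> measure_pmf.expectation P (\<lambda>v. 1 + a * \<xi> v + a\<^sup>2 * (\<xi> v)\<^sup>2)"
    by (intro integral_mono_AE I) (auto simp: AE_measure_pmf_iff power_mult_distrib dest!: b exp_le_quadratic)
  also have "\<dots> = 1 + a * measure_pmf.expectation P \<xi> + a\<^sup>2 * measure_pmf.expectation P (\<lambda>v. (\<xi> v)\<^sup>2)"
    using I[of \<xi>] I[of "\<lambda>v. (\<xi> v)\<^sup>2"] by simp
  also have "\<dots> \<le> 1 + a\<^sup>2 * p" using assms by (simp add: mult_left_mono)
  also have "\<dots> \<le> exp (a\<^sup>2 * p)" by (rule exp_ge_add_one_self)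
  finally show ?thesis .
qed

lemma set_entry_pmf: "set_pmf (entry_pmf p \<eta> b) \<subseteq> {-1, 0, 1}"
  by (cases b) (auto simp: entry_pmf_def split: if_splits)

text \<open>The tilt \<open>a\<close> is limited to 1/2 because a centred entry is bounded by 2, and
  \<open>mgf_centered\<close> wants exponents of modulus at most 1.\<close>

lemma mgf_entry_signed:
  assumes p: "0 \<le> p" "p \<le> 1" and \<eta>: "0 \<le> \<eta>" "\<eta> \<le> 1" and a: "\<bar>a\<bar> \<le> 1/2"
  shows "measure_pmf.expectation (entry_pmf p \<eta> b) (\<lambda>v. exp (a * (v - emean p \<eta> b))) \<le> exp (a\<^sup>2 * p)"
proof (rule mgf_centered[OF finite_set_entry_pmf])
  show "measure_pmf.expectation (entry_pmf p \<eta> b) (\<lambda>v. v - emean p \<eta> b) = 0"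
    by (subst expectation_entry_pmf[OF p \<eta>]) (auto simp: emean_def algebra_simps)
  have "measure_pmf.expectation (entry_pmf p \<eta> b) (\<lambda>v. (v - emean p \<eta> b)\<^sup>2) = p - (emean p \<eta> b)\<^sup>2"
    by (subst expectation_entry_pmf[OF p \<eta>]) (auto simp: emean_def algebra_simps power2_eq_square)
  then show "measure_pmf.expectation (entry_pmf p \<eta> b) (\<lambda>v. (v - emean p \<eta> b)\<^sup>2) \<le> p"
    by simp
next
  fix v assume "v \<in> set_pmf (entry_pmf p \<eta> b)"
  then have v: "\<bar>v\<bar> \<le> 1" using set_entry_pmf[of p \<eta> b] by auto
  have "\<bar>emean p \<eta> b\<bar> = p * \<bar>1 - 2 * \<eta>\<bar>" using p by (simp add: emean_def abs_mult)
  also have "\<dots> \<le> 1 * 1" using p \<eta> by (intro mult_mono) auto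
  finally have "\<bar>v - emean p \<eta> b\<bar> \<le> 2" using v by linarith
  then have "\<bar>a\<bar> * \<bar>v - emean p \<eta> b\<bar> \<le> 1/2 * 2" using a by (intro mult_mono) auto
  then show "\<bar>a * (v - emean p \<eta> b)\<bar> \<le> 1" by (simp add: abs_mult)
qed

lemma mgf_entry_unsigned:
  assumes p: "0 \<le> p" "p \<le> 1" and \<eta>: "0 \<le> \<eta>" "\<eta> \<le> 1" and a: "\<bar>a\<bar> \<le> 1/2"
  shows "measure_pmf.expectation (entry_pmf p \<eta> b) (\<lambda>v. exp (a * (\<bar>v\<bar> - p))) \<le> exp (a\<^sup>2 * p)"
proof (rule mgf_centered[OF finite_set_entry_pmf])
  show "measure_pmf.expectation (entry_pmf p \<eta> b) (\<lambda>v. \<bar>v\<bar> - p) = 0"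
    by (subst expectation_entry_pmf[OF p \<eta>]) (auto simp: algebra_simps)
  have "measure_pmf.expectation (entry_pmf p \<eta> b) (\<lambda>v. (\<bar>v\<bar> - p)\<^sup>2) = p - p\<^sup>2"
    by (subst expectation_entry_pmf[OF p \<eta>]) (auto simp: algebra_simps power2_eq_square)
  then show "measure_pmf.expectation (entry_pmf p \<eta> b) (\<lambda>v. (\<bar>v\<bar> - p)\<^sup>2) \<le> p"
    by simp
next
  fix v assume "v \<in> set_pmf (entry_pmf p \<eta> b)"
  then have v: "\<bar>v\<bar> \<le> 1" using set_entry_pmf[of p \<eta> b] by auto
  have "\<bar>\<bar>v\<bar> - p\<bar> \<le> 2" using v p by linarith
  then have "\<bar>a\<bar> * \<bar>\<bar>v\<bar> - p\<bar> \<le> 1/2 * 2" using a by (intro mult_mono) auto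
  then show "\<bar>a * (\<bar>v\<bar> - p)\<bar> \<le> 1" by (simp add: abs_mult)
qed

text \<open>Valid for every \<open>a\<close>, in contrast to the centred bounds: counting edges in
  small vertex sets needs a tilt that grows with the logarithm of \<open>n / card U\<close>.\<close>

lemma mgf_entry_count:
  assumes p: "0 \<le> p" "p \<le> 1" and \<eta>: "0 \<le> \<eta>" "\<eta> \<le> 1"
  shows "measure_pmf.expectation (entry_pmf p \<eta> b) (\<lambda>v. exp (a * \<bar>v\<bar>)) \<le> exp (p * exp a)"
proof -
  have "measure_pmf.expectation (entry_pmf p \<eta> b) (\<lambda>v. exp (a * \<bar>v\<bar>)) = 1 - p + p * exp a"
    by (subst expectation_entry_pmf[OF p \<eta>]) (auto simp: algebra_simps)
  also have "\<dots> \<le> 1 + p * exp a" using p by simp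
  also have "\<dots> \<le> exp (p * exp a)" by (rule exp_ge_add_one_self)
  finally show ?thesis .
qed

section \<open>Heavy pairs\<close>

text \<open>Vectors are plain functions here, of which only the coordinates below \<open>n\<close>
  matter; this keeps the probabilistic part free of dimension side conditions.\<close>

definition nsq :: "nat \<Rightarrow> (nat \<Rightarrow> real) \<Rightarrow> real" where
  "nsq n x = (\<Sum>i<n. (x i)\<^sup>2)"

definition bil :: "nat \<Rightarrow> (nat \<Rightarrow> nat \<Rightarrow> real) \<Rightarrow> (nat \<Rightarrow> real) \<Rightarrow> (nat \<Rightarrow> real) \<Rightarrow> real" where
  "bil n w x y = (\<Sum>i<n. \<Sum>j<n. w i j * x i * y j)"

lemma nsq_nonneg: "0 \<le> nsq n x"
  by (simp add: nsq_def sum_nonneg)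

lemma bil_add_left: "bil n w (\<lambda>i. x i + x' i) y = bil n w x y + bil n w x' y"
  by (simp add: bil_def sum.distrib[symmetric] algebra_simps)

lemma bil_add_right: "bil n w x (\<lambda>i. y i + y' i) = bil n w x y + bil n w x y'"
  by (simp add: bil_def sum.distrib[symmetric] algebra_simps)

lemma bil_scale_left: "bil n w (\<lambda>i. c * x i) y = c * bil n w x y"
  by (simp add: bil_def sum_distrib_left mult_ac)

lemma bil_scale_right: "bil n w x (\<lambda>i. c * y i) = c * bil n w x y"
  by (simp add: bil_def sum_distrib_left mult_ac)

lemma nsq_scale: "nsq n (\<lambda>i. c * x i) = c\<^sup>2 * nsq n x"
  by (simp add: nsq_def sum_distrib_left power_mult_distrib)

text \<open>Every nonempty \<open>U'\<close> contains a vertex of induced degree at most \<open>D\<close>; the induction removes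
  it and splits its terms by the weighted inequality of the means.\<close>

lemma degenerate_bilinear_le:
  fixes G :: "'a \<Rightarrow> 'a \<Rightarrow> real"
  assumes U: "finite U" and G: "\<And>i j. 0 \<le> G i j" "\<And>i j. G i j = G j i" "\<And>i. G i i = 0"
    and w: "w > 0" and a: "\<And>i. 0 \<le> a i" and b: "\<And>i. 0 \<le> b i"
    and D: "\<And>U'. U' \<subseteq> U \<Longrightarrow> U' \<noteq> {} \<Longrightarrow> (\<Sum>i\<in>U'. \<Sum>j\<in>U'. G i j) \<le> D * real (card U')"
  shows "(\<Sum>i\<in>U. \<Sum>j\<in>U. G i j * a i * b j)
      \<le> (\<Sum>i\<in>U. (w * D + (\<Sum>j\<in>U. G i j) / w) * (((a i)\<^sup>2 + (b i)\<^sup>2) / 2))"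
  using U D
proof (induction U rule: finite_psubset_induct)
  case (psubset U)
  show ?case
  proof (cases "U = {}")
    case False
    have "\<exists>v\<in>U. (\<Sum>j\<in>U. G v j) \<le> D"
    proof (rule ccontr)
      assume "\<not> ?thesis"
      then have "(\<Sum>i\<in>U. D) < (\<Sum>i\<in>U. \<Sum>j\<in>U. G i j)"
        using psubset.hyps False by (intro sum_strict_mono) auto
      then show False using psubset.prems[of U] False by (simp add: mult.commute)
    qed
    then obtain v where v: "v \<in> U" "(\<Sum>j\<in>U. G v j) \<le> D" by blast
    define T where "T = U - {v}"
    have UT: "U = insert v T" "v \<notin> T" "finite T" using v psubset.hyps by (auto simp: T_def)
    have IH: "(\<Sum>i\<in>T. \<Sum>j\<in>T. G i j * a i * b j)
      \<le> (\<Sum>i\<in>T. (w * D + (\<Sum>j\<in>T. G i j) / w) * (((a i)\<^sup>2 + (b i)\<^sup>2) / 2))"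
      by (rule psubset.IH) (use psubset.prems UT in auto)
    have amgm: "s * t \<le> w * (s\<^sup>2 / 2) + t\<^sup>2 / 2 / w" for s t :: real
    proof -
      have "0 \<le> (w * s - t)\<^sup>2" by simp
      then have "2 * w * (s * t) \<le> w\<^sup>2 * s\<^sup>2 + t\<^sup>2" by (simp add: power2_eq_square algebra_simps)
      then show ?thesis using w by (simp add: field_simps power2_eq_square)
    qed
    \<comment> \<open>The pair is charged with weight \<open>w\<close> to the removed vertex
      \<open>v\<close>, whose induced degree is at most \<open>D\<close>, and with weight
      \<open>1 / w\<close> to the remaining vertex, which over the whole removal is charged at most
      its full degree in \<open>U\<close>.\<close>
    have cross: "G v j * a v * b j + G j v * a j * b v
        \<le> G v j * (w * (((a v)\<^sup>2 + (b v)\<^sup>2) / 2)) + G v j / w * (((a j)\<^sup>2 + (b j)\<^sup>2) / 2)" for j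
    proof -
      have "a v * b j + b v * a j \<le> w * (((a v)\<^sup>2 + (b v)\<^sup>2) / 2) + ((a j)\<^sup>2 + (b j)\<^sup>2) / 2 / w"
        using amgm[of "a v" "b j"] amgm[of "b v" "a j"] by (simp add: algebra_simps add_divide_distrib)
      then have "G v j * (a v * b j + b v * a j) \<le> G v j * (w * (((a v)\<^sup>2 + (b v)\<^sup>2) / 2) + ((a j)\<^sup>2 + (b j)\<^sup>2) / 2 / w)"
        using G(1) by (rule mult_left_mono)
      then show ?thesis using w by (simp add: G(2)[of j v] field_simps)
    qed
    have "(\<Sum>i\<in>U. \<Sum>j\<in>U. G i j * a i * b j)
        = (\<Sum>j\<in>T. G v j * a v * b j + G j v * a j * b v) + (\<Sum>i\<in>T. \<Sum>j\<in>T. G i j * a i * b j)"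
      using UT by (simp add: G(3) sum.distrib)
    also have "\<dots> \<le> (\<Sum>j\<in>T. G v j * (w * (((a v)\<^sup>2 + (b v)\<^sup>2) / 2)) + G v j / w * (((a j)\<^sup>2 + (b j)\<^sup>2) / 2))
        + (\<Sum>i\<in>T. (w * D + (\<Sum>j\<in>T. G i j) / w) * (((a i)\<^sup>2 + (b i)\<^sup>2) / 2))"
      by (intro add_mono sum_mono cross IH)
    also have "\<dots> = (\<Sum>j\<in>T. G v j) * (w * (((a v)\<^sup>2 + (b v)\<^sup>2) / 2))
        + (\<Sum>i\<in>T. (w * D + (\<Sum>j\<in>U. G i j) / w) * (((a i)\<^sup>2 + (b i)\<^sup>2) / 2))"
      using UT by (simp add: sum.distrib sum_distrib_right G(2)[of _ v] add_divide_distrib distrib_right)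
    also have "(\<Sum>j\<in>T. G v j) * (w * (((a v)\<^sup>2 + (b v)\<^sup>2) / 2))
        \<le> (w * D + (\<Sum>j\<in>U. G v j) / w) * (((a v)\<^sup>2 + (b v)\<^sup>2) / 2)"
    proof -
      have "(\<Sum>j\<in>T. G v j) \<le> D" using v UT by (simp add: G(3))
      then have "(\<Sum>j\<in>T. G v j) * w \<le> D * w" using w by simp
      moreover have "0 \<le> (\<Sum>j\<in>U. G v j) / w" using w by (simp add: G(1) sum_nonneg)
      ultimately have "(\<Sum>j\<in>T. G v j) * w \<le> w * D + (\<Sum>j\<in>U. G v j) / w" by (simp add: mult.commute)
      then have "(\<Sum>j\<in>T. G v j) * w * (((a v)\<^sup>2 + (b v)\<^sup>2) / 2) \<le> (w * D + (\<Sum>j\<in>U. G v j) / w) * (((a v)\<^sup>2 + (b v)\<^sup>2) / 2)"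
        by (rule mult_right_mono) simp
      then show ?thesis by (simp add: mult.assoc)
    qed
    finally show ?thesis using UT by simp
  qed simp
qed

text \<open>Each of the two regimes where one coordinate dominates contributes \<open>3/2\<close>,
  and the pairs inside the sparse set \<open>U\<close> contribute \<open>51/2 = 24 + 3/2\<close>;
  the total 28.5 is rounded up.\<close>

lemma heavy_pairs_le:
  fixes G :: "nat \<Rightarrow> nat \<Rightarrow> real"
  assumes G: "\<And>i j. 0 \<le> G i j" "\<And>i j. G i j = G j i" "\<And>i. G i i = 0"
    and q: "q \<ge> 1" and n: "n > 0" and x: "nsq n x \<le> 1" and y: "nsq n y \<le> 1"
    and deg: "\<And>i. i < n \<Longrightarrow> (\<Sum>j<n. G i j) \<le> 3/2 * q^8"
    and sparse: "\<And>U. U \<subseteq> {..<n} \<Longrightarrow> U \<noteq> {} \<Longrightarrow> real (card U) * q^6 \<le> 2 * real n \<Longrightarrow>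
       (\<Sum>i\<in>U. \<Sum>j\<in>U. G i j) \<le> 24 * q^6 * real (card U)"
  shows "(\<Sum>i<n. \<Sum>j<n. if \<bar>x i * y j\<bar> > q^7 / real n then G i j * \<bar>x i\<bar> * \<bar>y j\<bar> else 0) \<le> 29 * q^7"
proof -
  \<comment> \<open>By Markov at most \<open>n / q^6\<close> coordinates of a unit vector exceed
    this threshold. It is chosen so that a heavy pair with comparable coordinates has both ends
    above it: \<open>q^7 / n < \<bar>x i * y j\<bar>\<close> and
    \<open>\<bar>y j\<bar> < q * \<bar>x i\<bar>\<close> give
    \<open>q^6 < n * (x i)^2\<close>.\<close>
  define S where "S = (\<lambda>x::nat\<Rightarrow>real. {i. i < n \<and> q^6 < real n * (x i)\<^sup>2})"
  define U where "U = S x \<union> S y"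
  have finS: "finite (S z)" for z by (simp add: S_def)
  have cardS: "real (card (S z)) * q^6 \<le> real n" if "nsq n z \<le> 1" for z
  proof -
    have "real (card (S z)) * q^6 = (\<Sum>i\<in>S z. q^6)" by simp
    also have "\<dots> \<le> (\<Sum>i\<in>S z. real n * (z i)\<^sup>2)" by (intro sum_mono) (auto simp: S_def)
    also have "\<dots> \<le> (\<Sum>i<n. real n * (z i)\<^sup>2)" by (intro sum_mono2) (auto simp: S_def)
    also have "\<dots> = real n * nsq n z" by (simp add: nsq_def sum_distrib_left)
    also have "\<dots> \<le> real n" using that by (simp add: mult_left_le)
    finally show ?thesis .
  qed
  have Un: "U \<subseteq> {..<n}" by (auto simp: U_def S_def)
  have finU: "finite U" using Un finite_subset by blast
  have "real (card U) \<le> real (card (S x)) + real (card (S y))"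
    unfolding U_def using card_Un_le[of "S x" "S y"] by linarith
  then have "real (card U) * q^6 \<le> (real (card (S x)) + real (card (S y))) * q^6"
    using q by (intro mult_right_mono) auto
  then have cU: "real (card U) * q^6 \<le> 2 * real n"
    using cardS[OF x] cardS[OF y] by (simp add: distrib_right)
  have deg': "(\<Sum>j\<in>U. G i j) \<le> 3/2 * q^8" if "i < n" for i
  proof -
    have "(\<Sum>j\<in>U. G i j) \<le> (\<Sum>j<n. G i j)" using Un by (intro sum_mono2) (auto simp: G)
    with deg[OF that] show ?thesis by linarith
  qed
  have pt: "(if \<bar>x i * y j\<bar> > q^7 / real n then G i j * \<bar>x i\<bar> * \<bar>y j\<bar> else 0)
      \<le> G i j * ((x i)\<^sup>2 / q) + G i j * ((y j)\<^sup>2 / q) + (if i \<in> U \<and> j \<in> U then G i j * \<bar>x i\<bar> * \<bar>y j\<bar> else 0)"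
    if ij: "i < n" "j < n" for i j
  proof (cases "\<bar>x i * y j\<bar> > q^7 / real n")
    case False
    then show ?thesis using q G(1)[of i j] by (auto intro!: add_nonneg_nonneg mult_nonneg_nonneg)
  next
    case heavy: True
    have nn: "0 \<le> G i j * ((x i)\<^sup>2 / q)" "0 \<le> G i j * ((y j)\<^sup>2 / q)"
       "0 \<le> (if i \<in> U \<and> j \<in> U then G i j * \<bar>x i\<bar> * \<bar>y j\<bar> else 0)"
      using q G(1)[of i j] by auto
    consider (a) "q * \<bar>y j\<bar> \<le> \<bar>x i\<bar>" | (b) "q * \<bar>x i\<bar> \<le> \<bar>y j\<bar>"
      | (c) "\<bar>x i\<bar> < q * \<bar>y j\<bar>" "\<bar>y j\<bar> < q * \<bar>x i\<bar>" by linarith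
    then show ?thesis
    proof cases
      case a
      then have "\<bar>x i\<bar> * (q * \<bar>y j\<bar>) \<le> \<bar>x i\<bar> * \<bar>x i\<bar>" by (intro mult_left_mono) auto
      then have "\<bar>x i\<bar> * \<bar>y j\<bar> \<le> (x i)\<^sup>2 / q" using q by (simp add: field_simps power2_eq_square)
      then have "G i j * (\<bar>x i\<bar> * \<bar>y j\<bar>) \<le> G i j * ((x i)\<^sup>2 / q)" using G(1) by (rule mult_left_mono)
      then show ?thesis using nn heavy by (simp add: mult.assoc)
    next
      case b
      then have "(q * \<bar>x i\<bar>) * \<bar>y j\<bar> \<le> \<bar>y j\<bar> * \<bar>y j\<bar>" by (intro mult_right_mono) auto
      then have "\<bar>x i\<bar> * \<bar>y j\<bar> \<le> (y j)\<^sup>2 / q" using q by (simp add: field_simps power2_eq_square)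
      then have "G i j * (\<bar>x i\<bar> * \<bar>y j\<bar>) \<le> G i j * ((y j)\<^sup>2 / q)" using G(1) by (rule mult_left_mono)
      then show ?thesis using nn heavy by (simp add: mult.assoc)
    next
      case c
      have q7: "q^7 < real n * (\<bar>x i\<bar> * \<bar>y j\<bar>)" using heavy n by (simp add: field_simps abs_mult)
      have "\<bar>x i\<bar> * \<bar>y j\<bar> \<le> \<bar>x i\<bar> * (q * \<bar>x i\<bar>)" using c by (intro mult_left_mono) auto
      then have "real n * (\<bar>x i\<bar> * \<bar>y j\<bar>) \<le> real n * (q * (x i)\<^sup>2)"
        by (intro mult_left_mono) (auto simp: power2_eq_square mult_ac)
      with q7 have "q * q^6 < q * (real n * (x i)\<^sup>2)" by (simp add: power_Suc[symmetric] mult_ac del: power_Suc)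
      then have "i \<in> U" using q ij by (simp add: U_def S_def)
      have "\<bar>x i\<bar> * \<bar>y j\<bar> \<le> (q * \<bar>y j\<bar>) * \<bar>y j\<bar>" using c by (intro mult_right_mono) auto
      then have "real n * (\<bar>x i\<bar> * \<bar>y j\<bar>) \<le> real n * (q * (y j)\<^sup>2)"
        by (intro mult_left_mono) (auto simp: power2_eq_square mult_ac)
      with q7 have "q * q^6 < q * (real n * (y j)\<^sup>2)" by (simp add: power_Suc[symmetric] mult_ac del: power_Suc)
      then have "j \<in> U" using q ij by (simp add: U_def S_def)
      with \<open>i \<in> U\<close> show ?thesis using nn heavy by simp
    qed
  qed
  have q87: "q^8 / q = q^7" using q by (simp add: power_eq_if)
  have sx: "(\<Sum>i<n. \<Sum>j<n. G i j * ((z i)\<^sup>2 / q)) \<le> 3/2 * q^7" if z: "nsq n z \<le> 1" for z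
  proof -
    have "(\<Sum>i<n. \<Sum>j<n. G i j * ((z i)\<^sup>2 / q)) = (\<Sum>i<n. (\<Sum>j<n. G i j) * ((z i)\<^sup>2 / q))"
      by (simp only: sum_distrib_right)
    also have "\<dots> \<le> (\<Sum>i<n. 3/2 * q^8 * ((z i)\<^sup>2 / q))"
      using q by (intro sum_mono mult_right_mono deg) auto
    also have "\<dots> = 3/2 * q^7 * nsq n z"
      by (simp add: nsq_def sum_distrib_left q87[symmetric])
    also have "\<dots> \<le> 3/2 * q^7" using z q by (intro mult_left_le) auto
    finally show ?thesis .
  qed
  have sy: "(\<Sum>i<n. \<Sum>j<n. G i j * ((y j)\<^sup>2 / q)) \<le> 3/2 * q^7"
    using sx[OF y] by (subst sum.swap) (simp add: G(2))
  have "(\<Sum>i<n. \<Sum>j<n. if i \<in> U \<and> j \<in> U then G i j * \<bar>x i\<bar> * \<bar>y j\<bar> else 0)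
      = (\<Sum>i\<in>U. \<Sum>j\<in>U. G i j * \<bar>x i\<bar> * \<bar>y j\<bar>)"
  proof -
    have "(\<Sum>i<n. \<Sum>j<n. if i \<in> U \<and> j \<in> U then G i j * \<bar>x i\<bar> * \<bar>y j\<bar> else 0)
      = (\<Sum>i<n. if i \<in> U then (\<Sum>j<n. if j \<in> U then G i j * \<bar>x i\<bar> * \<bar>y j\<bar> else 0) else 0)"
      by (intro sum.cong) auto
    also have "\<dots> = (\<Sum>i\<in>U. \<Sum>j\<in>U. G i j * \<bar>x i\<bar> * \<bar>y j\<bar>)"
      using Un by (simp add: sum.inter_restrict[symmetric] Int_absorb1)
    finally show ?thesis .
  qed
  \<comment> \<open>The weight \<open>q\<close> brings both charges to order \<open>q^7\<close>:
    degeneracy gives \<open>q * (24 * q^6)\<close> and the full degrees give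
    \<open>(3/2 * q^8) / q\<close>.\<close>
  also have "\<dots> \<le> (\<Sum>i\<in>U. (q * (24 * q^6) + (\<Sum>j\<in>U. G i j) / q) * ((\<bar>x i\<bar>\<^sup>2 + \<bar>y i\<bar>\<^sup>2) / 2))"
  proof (rule degenerate_bilinear_le[OF finU G])
    fix U' assume U': "U' \<subseteq> U" "U' \<noteq> {}"
    have "real (card U') \<le> real (card U)" using U' finU by (simp add: card_mono)
    then have "real (card U') * q^6 \<le> real (card U) * q^6" using q by (intro mult_right_mono) auto
    then show "(\<Sum>i\<in>U'. \<Sum>j\<in>U'. G i j) \<le> 24 * q^6 * real (card U')"
      using U' Un cU by (intro sparse) auto
  qed (use q in auto)
  also have "\<dots> \<le> (\<Sum>i\<in>U. (q * (24 * q^6) + (3/2 * q^8) / q) * ((\<bar>x i\<bar>\<^sup>2 + \<bar>y i\<bar>\<^sup>2) / 2))"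
    using q Un by (intro sum_mono mult_right_mono add_left_mono divide_right_mono deg') auto
  also have "\<dots> \<le> (\<Sum>i<n. (q * (24 * q^6) + (3/2 * q^8) / q) * ((\<bar>x i\<bar>\<^sup>2 + \<bar>y i\<bar>\<^sup>2) / 2))"
    using q Un by (intro sum_mono2) auto
  also have "\<dots> = (q * (24 * q^6) + (3/2 * q^8) / q) * ((nsq n x + nsq n y) / 2)"
    unfolding sum_distrib_left[symmetric] by (simp add: nsq_def sum.distrib sum_divide_distrib[symmetric])
  also have "(q * (24 * q^6) + (3/2 * q^8) / q) = (51/2) * q^7"
    using q by (simp add: power_eq_if)
  also have "(51/2) * q^7 * ((nsq n x + nsq n y) / 2) \<le> (51/2) * q^7"
    using x y q by (intro mult_left_le) auto
  finally have sU: "(\<Sum>i<n. \<Sum>j<n. if i \<in> U \<and> j \<in> U then G i j * \<bar>x i\<bar> * \<bar>y j\<bar> else 0) \<le> (51/2) * q^7" .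
  have "(\<Sum>i<n. \<Sum>j<n. if \<bar>x i * y j\<bar> > q^7 / real n then G i j * \<bar>x i\<bar> * \<bar>y j\<bar> else 0)
     \<le> (\<Sum>i<n. \<Sum>j<n. G i j * ((x i)\<^sup>2 / q) + G i j * ((y j)\<^sup>2 / q) + (if i \<in> U \<and> j \<in> U then G i j * \<bar>x i\<bar> * \<bar>y j\<bar> else 0))"
    by (intro sum_mono pt) auto
  also have "\<dots> \<le> 3/2 * q^7 + 3/2 * q^7 + (51/2) * q^7"
    using sx[OF x] sy sU by (simp only: sum.distrib)
  also have "\<dots> \<le> 29 * q^7" using q by simp
  finally show ?thesis .
qed

definition light_sum :: "nat \<Rightarrow> real \<Rightarrow> (nat \<Rightarrow> nat \<Rightarrow> real) \<Rightarrow> (nat \<Rightarrow> real) \<Rightarrow> (nat \<Rightarrow> real) \<Rightarrow> real" where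
  "light_sum n \<beta> w x y = (\<Sum>i<n. \<Sum>j<n. if \<bar>x i * y j\<bar> \<le> \<beta> / real n then w i j * x i * y j else 0)"

text \<open>On heavy pairs \<open>w\<close> is split into its graph part, bounded by
  \<open>29 * q^7\<close> through \<open>heavy_pairs_le\<close>, and its mean part \<open>p\<close>,
  which costs another \<open>2 * q^7\<close>.\<close>

lemma bil_le_light:
  fixes G w :: "nat \<Rightarrow> nat \<Rightarrow> real"
  assumes G: "\<And>i j. 0 \<le> G i j" "\<And>i j. G i j = G j i" "\<And>i. G i i = 0"
    and q: "q \<ge> 1" and n: "n > 0" and x: "nsq n x \<le> 1" and y: "nsq n y \<le> 1"
    and deg: "\<And>i. i < n \<Longrightarrow> (\<Sum>j<n. G i j) \<le> 3/2 * q^8"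
    and sparse: "\<And>U. U \<subseteq> {..<n} \<Longrightarrow> U \<noteq> {} \<Longrightarrow> real (card U) * q^6 \<le> 2 * real n \<Longrightarrow>
       (\<Sum>i\<in>U. \<Sum>j\<in>U. G i j) \<le> 24 * q^6 * real (card U)"
    and w: "\<And>i j. \<bar>w i j\<bar> \<le> G i j + p" and p: "0 \<le> p" "real n * p \<le> 2 * q^8"
  shows "bil n w x y \<le> light_sum n (q^7) w x y + 31 * q^7"
proof -
  let ?h = "\<lambda>i j. \<bar>x i * y j\<bar> > q^7 / real n"
  have q7: "0 < q^7" using q by simp
  have pt: "w i j * x i * y j \<le> (if \<bar>x i * y j\<bar> \<le> q^7 / real n then w i j * x i * y j else 0)
     + (if ?h i j then G i j * \<bar>x i\<bar> * \<bar>y j\<bar> else 0) + p * (real n / q^7) * ((x i)\<^sup>2 * (y j)\<^sup>2)" for i j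
  proof (cases "?h i j")
    case False
    then show ?thesis using p q by (auto simp: not_less)
  next
    case True
    have "w i j * x i * y j \<le> \<bar>w i j\<bar> * (\<bar>x i\<bar> * \<bar>y j\<bar>)"
      by (metis abs_ge_self abs_mult mult.assoc)
    also have "\<dots> \<le> (G i j + p) * (\<bar>x i\<bar> * \<bar>y j\<bar>)" by (intro mult_right_mono w) auto
    also have "\<dots> = G i j * \<bar>x i\<bar> * \<bar>y j\<bar> + p * \<bar>x i * y j\<bar>" by (simp add: algebra_simps abs_mult)
    \<comment> \<open>On a heavy pair \<open>real n / q^7 * \<bar>x i * y j\<bar>\<close> exceeds 1
      and may be inserted as a factor. The resulting squares sum to at most 1 over all pairs, so the
      mean costs at most \<open>n * p / q^7\<close>.\<close>
    also have "p * \<bar>x i * y j\<bar> \<le> p * (real n / q^7 * \<bar>x i * y j\<bar>\<^sup>2)"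
    proof (rule mult_left_mono[OF _ p(1)])
      have "1 \<le> real n / q^7 * \<bar>x i * y j\<bar>" using True n q7 by (simp add: field_simps)
      then have "1 * \<bar>x i * y j\<bar> \<le> real n / q^7 * \<bar>x i * y j\<bar> * \<bar>x i * y j\<bar>" by (rule mult_right_mono) simp
      then show "\<bar>x i * y j\<bar> \<le> real n / q^7 * \<bar>x i * y j\<bar>\<^sup>2" by (simp add: power2_eq_square mult.assoc)
    qed
    finally show ?thesis using True by (simp add: power_mult_distrib mult.assoc)
  qed
  have "bil n w x y \<le> light_sum n (q^7) w x y
     + (\<Sum>i<n. \<Sum>j<n. if ?h i j then G i j * \<bar>x i\<bar> * \<bar>y j\<bar> else 0)
     + (\<Sum>i<n. \<Sum>j<n. p * (real n / q^7) * ((x i)\<^sup>2 * (y j)\<^sup>2))"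
    unfolding bil_def light_sum_def sum.distrib[symmetric] by (intro sum_mono pt)
  moreover have "(\<Sum>i<n. \<Sum>j<n. p * (real n / q^7) * ((x i)\<^sup>2 * (y j)\<^sup>2)) \<le> 2 * q^7"
  proof -
    have "(\<Sum>i<n. \<Sum>j<n. p * (real n / q^7) * ((x i)\<^sup>2 * (y j)\<^sup>2)) = p * (real n / q^7) * (nsq n x * nsq n y)"
      unfolding nsq_def sum_product by (simp only: sum_distrib_left)
    also have "\<dots> \<le> p * (real n / q^7)"
      using x y nsq_nonneg[of n x] nsq_nonneg[of n y] p q by (intro mult_left_le) (auto intro: mult_le_one)
    also have "\<dots> \<le> 2 * q^8 / q^7" using p q by (simp add: divide_right_mono mult.commute)
    also have "\<dots> = 2 * q" using q by (simp add: power_eq_if)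
    also have "\<dots> \<le> 2 * q^7" using q self_le_power[of q 7] by simp
    finally show ?thesis .
  qed
  ultimately show ?thesis using heavy_pairs_le[OF G q n x y deg sparse] by linarith
qed

section \<open>Light pairs and degrees\<close>

text \<open>A lattice of mesh \<open>1 / (4 * sqrt n)\<close>, given by integer coordinates. The
  bound on the sum of moduli replaces a Euclidean ball: integers satisfy
  \<open>\<bar>z\<bar> \<le> z^2\<close>, so roundings of unit vectors are covered, and it is
  additive over coordinates, which makes counting easy. Extensional functions keep the set
  finite.\<close>

definition grid :: "nat \<Rightarrow> (nat \<Rightarrow> real) set" where
  "grid n = (\<lambda>z i. real_of_int (z i) / (4 * sqrt (real n))) `
     {z \<in> {..<n} \<rightarrow>\<^sub>E {- int (16 * n)..int (16 * n)}. (\<Sum>i<n. \<bar>z i\<bar>) \<le> 16 * int n}"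

lemma sum_half_powers:
  "(\<Sum>z\<in>{- int m..int m}. (1/2::real) ^ nat \<bar>z\<bar>) = 3 - 2 * (1/2) ^ m"
proof (induction m)
  case (Suc m)
  have "{- int (Suc m)..int (Suc m)} = insert (int (Suc m)) (insert (- int (Suc m)) {- int m..int m})"
    by auto
  moreover have "nat \<bar>- int (Suc m)\<bar> = Suc m" "nat \<bar>int (Suc m)\<bar> = Suc m" by auto
  ultimately have "(\<Sum>z\<in>{- int (Suc m)..int (Suc m)}. (1/2::real) ^ nat \<bar>z\<bar>)
      = (1/2) ^ Suc m + ((1/2) ^ Suc m + (\<Sum>z\<in>{- int m..int m}. (1/2::real) ^ nat \<bar>z\<bar>))"
    by (simp del: power_Suc)
  then show ?case using Suc by simp
qed simp

lemma finite_grid: "finite (grid n)"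
  unfolding grid_def
  by (rule finite_imageI, rule finite_subset[of _ "{..<n} \<rightarrow>\<^sub>E {- int (16 * n)..int (16 * n)}"])
     (auto intro: finite_PiE)

text \<open>Counting by a generating function: every admissible integer point has weight at least 1
  under \<open>2 ^ (16 * n)\<close> times the product of the
  \<open>(1/2) ^ nat \<bar>z i\<bar>\<close>, and the sum of this weight over the whole box
  factorises, each factor being at most 3.\<close>

lemma card_grid_le: "real (card (grid n)) \<le> exp (14 * real n)"
proof -
  let ?E = "{..<n} \<rightarrow>\<^sub>E {- int (16 * n)..int (16 * n)}"
  let ?Z = "{z \<in> ?E. (\<Sum>i<n. \<bar>z i\<bar>) \<le> 16 * int n}"
  have fE: "finite ?E" by (intro finite_PiE) auto
  have "real (card (grid n)) \<le> real (card ?Z)"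
    unfolding grid_def using fE by (simp add: card_image_le)
  also have "\<dots> = (\<Sum>z\<in>?Z. 1)" by simp
  also have "\<dots> \<le> (\<Sum>z\<in>?Z. 2 ^ (16 * n) * (\<Prod>i<n. (1/2) ^ nat \<bar>z i\<bar>))"
  proof (rule sum_mono)
    fix z assume "z \<in> ?Z"
    then have "int (\<Sum>i<n. nat \<bar>z i\<bar>) \<le> int (16 * n)" by simp
    then have le: "(\<Sum>i<n. nat \<bar>z i\<bar>) \<le> 16 * n" by (simp only: of_nat_le_iff)
    have "(1::real) = 2 ^ (16 * n) * (1/2) ^ (16 * n)" by (simp add: power_divide)
    also have "\<dots> \<le> 2 ^ (16 * n) * (1/2) ^ (\<Sum>i<n. nat \<bar>z i\<bar>)"
      using power_decreasing[OF le, of "1/2::real"] by simp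
    finally show "1 \<le> 2 ^ (16 * n) * (\<Prod>i<n. (1/2::real) ^ nat \<bar>z i\<bar>)" by (simp add: power_sum)
  qed
  also have "\<dots> \<le> (\<Sum>z\<in>?E. 2 ^ (16 * n) * (\<Prod>i<n. (1/2) ^ nat \<bar>z i\<bar>))"
    using fE by (intro sum_mono2) (auto simp: prod_nonneg)
  also have "\<dots> = 2 ^ (16 * n) * (\<Prod>i<n. \<Sum>y\<in>{- int (16 * n)..int (16 * n)}. (1/2) ^ nat \<bar>y\<bar>)"
    by (subst prod_sum_PiE) (auto simp: sum_distrib_left)
  also have "\<dots> \<le> 2 ^ (16 * n) * (\<Prod>i<n. 3)"
  proof (intro mult_left_mono prod_mono conjI)
    have "(1/2::real) ^ (16 * n) \<le> 1" by (rule power_le_one) auto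
    then show "0 \<le> (\<Sum>y\<in>{- int (16 * n)..int (16 * n)}. (1/2::real) ^ nat \<bar>y\<bar>)"
      unfolding sum_half_powers by linarith
    show "(\<Sum>y\<in>{- int (16 * n)..int (16 * n)}. (1/2::real) ^ nat \<bar>y\<bar>) \<le> 3"
      unfolding sum_half_powers by simp
  qed simp
  also have "\<dots> = (2 ^ 16) ^ n * 3 ^ n" by (simp add: power_mult)
  also have "\<dots> = (2 ^ 16 * 3) ^ n" by (rule power_mult_distrib[symmetric])
  \<comment> \<open>The Taylor bound gives \<open>exp 1 \<ge> 5/2\<close>, and
    \<open>(5/2) ^ 14\<close> exceeds \<open>2 ^ 16 * 3\<close>.\<close>
  also have "\<dots> \<le> (exp 1 ^ 14) ^ n"
  proof (rule power_mono)
    have "(5/2::real) ^ 14 \<le> exp 1 ^ 14"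
      using exp_lower_Taylor_quadratic[of 1] by (intro power_mono) auto
    then show "2 ^ 16 * 3 \<le> exp (1::real) ^ 14" by (rule order_trans[rotated]) (simp add: power_divide)
  qed simp
  also have "\<dots> = exp (14 * real n)" using exp_of_nat_mult[of "14 * n" "1::real"] by (simp add: power_mult)
  finally show ?thesis .
qed

text \<open>Rounding towards zero: the norm cannot grow, so the grid point stays in the unit ball,
  and each coordinate moves by at most one mesh width, in total squared error
  \<open>n / (16 * n)\<close>.\<close>

lemma grid_approx:
  assumes x: "nsq n x \<le> 1" and n: "n > 0"
  obtains x' where "x' \<in> grid n" "nsq n x' \<le> 1" "nsq n (\<lambda>i. x i - x' i) \<le> 1/16"
proof -
  define s where "s = 4 * sqrt (real n)"
  have s: "s > 0" "s\<^sup>2 = 16 * real n" using n by (auto simp: s_def power_mult_distrib)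
  define z where "z = (\<lambda>i. if i < n then (if x i \<ge> 0 then \<lfloor>s * x i\<rfloor> else \<lceil>s * x i\<rceil>) else undefined)"
  define x' where "x' = (\<lambda>i. real_of_int (z i) / s)"
  have z1: "\<bar>real_of_int (z i)\<bar> \<le> \<bar>s * x i\<bar>" "\<bar>s * x i - z i\<bar> \<le> 1" if i: "i < n" for i
  proof -
    have "\<bar>real_of_int (z i)\<bar> \<le> \<bar>s * x i\<bar> \<and> \<bar>s * x i - z i\<bar> \<le> 1"
    proof (cases "x i \<ge> 0")
      case True
      then have "0 \<le> s * x i" using s by simp
      then have "0 \<le> real_of_int (z i)" "real_of_int (z i) \<le> s * x i" "s * x i < real_of_int (z i) + 1"
        using True i by (simp_all add: z_def)
      then show ?thesis by linarith
    next
      case False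
      then have "s * x i \<le> 0" using s by (simp add: mult_nonneg_nonpos)
      then have "real_of_int (z i) \<le> 0" "s * x i \<le> real_of_int (z i)" "real_of_int (z i) < s * x i + 1"
        using False i by (simp_all add: z_def, linarith)
      then show ?thesis by linarith
    qed
    then show "\<bar>real_of_int (z i)\<bar> \<le> \<bar>s * x i\<bar>" "\<bar>s * x i - z i\<bar> \<le> 1" by auto
  qed
  have "real_of_int (\<Sum>i<n. (z i)\<^sup>2) \<le> (\<Sum>i<n. (s * x i)\<^sup>2)"
    unfolding of_int_sum of_int_power by (intro sum_mono) (use z1 in \<open>auto simp: abs_le_square_iff[symmetric]\<close>)
  also have "\<dots> = 16 * real n * nsq n x" by (simp add: nsq_def power_mult_distrib s sum_distrib_left)
  also have "\<dots> \<le> 16 * real n" using x by (intro mult_left_le) auto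
  finally have zsq: "(\<Sum>i<n. (z i)\<^sup>2) \<le> 16 * int n" by linarith
  have abs_sq: "\<bar>t\<bar> \<le> t\<^sup>2" for t :: int
  proof (cases "t = 0")
    case False
    then have "\<bar>t\<bar> * 1 \<le> \<bar>t\<bar> * \<bar>t\<bar>" by (intro mult_left_mono) auto
    then show ?thesis by (simp add: power2_eq_square)
  qed simp
  have "(\<Sum>i<n. \<bar>z i\<bar>) \<le> (\<Sum>i<n. (z i)\<^sup>2)" by (intro sum_mono abs_sq)
  with zsq have za: "(\<Sum>i<n. \<bar>z i\<bar>) \<le> 16 * int n" by linarith
  have zi: "\<bar>z i\<bar> \<le> 16 * int n" if "i < n" for i
    using member_le_sum[of i "{..<n}" "\<lambda>i. \<bar>z i\<bar>"] that za by auto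
  have "z \<in> {z \<in> {..<n} \<rightarrow>\<^sub>E {- int (16 * n)..int (16 * n)}. (\<Sum>i<n. \<bar>z i\<bar>) \<le> 16 * int n}"
  proof (intro CollectI conjI PiE_I za)
    fix i assume "i \<in> {..<n}"
    then show "z i \<in> {- int (16 * n)..int (16 * n)}" using zi[of i] by auto
  qed (simp add: z_def)
  then have "x' \<in> grid n" unfolding grid_def x'_def s_def by blast
  moreover have "nsq n x' \<le> nsq n x" unfolding nsq_def
  proof (rule sum_mono)
    fix i assume "i \<in> {..<n}"
    then have "\<bar>x' i\<bar> \<le> \<bar>x i\<bar>" using z1(1)[of i] s by (simp add: x'_def abs_mult field_simps)
    then show "(x' i)\<^sup>2 \<le> (x i)\<^sup>2" by (simp add: abs_le_square_iff)
  qed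
  moreover have "nsq n (\<lambda>i. x i - x' i) \<le> (\<Sum>i<n. 1 / s\<^sup>2)" unfolding nsq_def
  proof (rule sum_mono)
    fix i assume "i \<in> {..<n}"
    then have "\<bar>s * x i - z i\<bar> \<le> 1" using z1(2) by simp
    moreover have "x i - x' i = (s * x i - z i) / s" using s by (simp add: x'_def field_simps)
    ultimately have "\<bar>x i - x' i\<bar> \<le> \<bar>1 / s\<bar>" using s by (simp add: divide_right_mono)
    then have "(x i - x' i)\<^sup>2 \<le> (1 / s)\<^sup>2" by (subst abs_le_square_iff[symmetric])
    then show "(x i - x' i)\<^sup>2 \<le> 1 / s\<^sup>2" by (simp add: power_divide)
  qed
  moreover have "(\<Sum>i<n. 1 / s\<^sup>2) = 1/16" using n s by simp
  ultimately show ?thesis using x by (intro that[of x']) (assumption | linarith)+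
qed

text \<open>A self-bounding argument: the supremum over the unit ball is finite, and replacing
  \<open>x\<close> and then \<open>y\<close> by grid points costs a quarter of this same supremum
  each, since the rounding errors have norm at most 1/4. So the supremum is at most \<open>B\<close>
  plus half of itself.\<close>

lemma bil_le_of_grid:
  assumes n: "n > 0"
    and B: "\<And>x y. x \<in> grid n \<Longrightarrow> y \<in> grid n \<Longrightarrow> nsq n x \<le> 1 \<Longrightarrow> nsq n y \<le> 1 \<Longrightarrow> bil n w x y \<le> B"
    and x: "nsq n x \<le> 1" and y: "nsq n y \<le> 1"
  shows "bil n w x y \<le> 2 * B"
proof -
  define S where "S = {bil n w x y | x y. nsq n x \<le> 1 \<and> nsq n y \<le> 1}"
  have le1: "\<bar>x i\<bar> \<le> 1" if "nsq n x \<le> 1" "i < n" for x i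
  proof -
    have "(x i)\<^sup>2 \<le> nsq n x" unfolding nsq_def using that by (intro member_le_sum) auto
    with that have "(x i)\<^sup>2 \<le> 1" by linarith
    then show ?thesis by (simp add: abs_square_le_1)
  qed
  have bdd: "bdd_above S"
  proof (rule bdd_aboveI)
    fix v assume "v \<in> S"
    then obtain x y where v: "v = bil n w x y" "nsq n x \<le> 1" "nsq n y \<le> 1" by (auto simp: S_def)
    show "v \<le> (\<Sum>i<n. \<Sum>j<n. \<bar>w i j\<bar>)" unfolding v bil_def
    proof (intro sum_mono)
      fix i j assume "i \<in> {..<n}" "j \<in> {..<n}"
      then have "\<bar>x i\<bar> * \<bar>y j\<bar> \<le> 1" using le1 v by (intro mult_le_one) auto
      then have "\<bar>w i j\<bar> * (\<bar>x i\<bar> * \<bar>y j\<bar>) \<le> \<bar>w i j\<bar>" by (intro mult_left_le) auto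
      moreover have "w i j * x i * y j \<le> \<bar>w i j\<bar> * (\<bar>x i\<bar> * \<bar>y j\<bar>)"
        by (metis abs_ge_self abs_mult mult.assoc)
      ultimately show "w i j * x i * y j \<le> \<bar>w i j\<bar>" by linarith
    qed
  qed
  have ne: "S \<noteq> {}" using x y by (auto simp: S_def)
  have leS: "bil n w x y \<le> Sup S" if "nsq n x \<le> 1" "nsq n y \<le> 1" for x y
    using that bdd by (intro cSup_upper) (auto simp: S_def)
  have "Sup S \<le> B + Sup S / 2"
  proof (rule cSup_least[OF ne])
    fix v assume "v \<in> S"
    then obtain x y where v: "v = bil n w x y" "nsq n x \<le> 1" "nsq n y \<le> 1" by (auto simp: S_def)
    obtain x' where x': "x' \<in> grid n" "nsq n x' \<le> 1" "nsq n (\<lambda>i. x i - x' i) \<le> 1/16"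
      using grid_approx[OF v(2) n] by blast
    obtain y' where y': "y' \<in> grid n" "nsq n y' \<le> 1" "nsq n (\<lambda>i. y i - y' i) \<le> 1/16"
      using grid_approx[OF v(3) n] by blast
    have e1: "bil n w (\<lambda>i. 4 * (x i - x' i)) y \<le> Sup S"
      using x' v by (intro leS) (simp_all only: nsq_scale, simp_all)
    have e2: "bil n w x' (\<lambda>i. 4 * (y i - y' i)) \<le> Sup S"
      using x' y' v by (intro leS) (simp_all only: nsq_scale, simp_all)
    have "v = bil n w (\<lambda>i. x' i + (x i - x' i)) y" by (simp add: v)
    also have "\<dots> = bil n w x' (\<lambda>i. y' i + (y i - y' i)) + bil n w (\<lambda>i. x i - x' i) y"
      by (simp only: bil_add_left) simp
    also have "\<dots> = bil n w x' y' + bil n w x' (\<lambda>i. y i - y' i) + bil n w (\<lambda>i. x i - x' i) y"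
      by (simp only: bil_add_right)
    also have "\<dots> \<le> B + Sup S / 4 + Sup S / 4"
      using e1 e2 B[OF x'(1) y'(1) x'(2) y'(2)] unfolding bil_scale_left bil_scale_right by linarith
    finally show "v \<le> B + Sup S / 2" by simp
  qed
  then show ?thesis using leS[OF x y] by linarith
qed

section \<open>Sums over unordered pairs of vertices\<close>

definition symm :: "(nat \<times> nat \<Rightarrow> real) \<Rightarrow> nat \<Rightarrow> nat \<Rightarrow> real" where
  "symm Y i j = (if i < j then Y (i, j) else if j < i then Y (j, i) else 0)"

abbreviation abs_adj :: "(nat \<times> nat \<Rightarrow> real) \<Rightarrow> nat \<Rightarrow> nat \<Rightarrow> real" where
  "abs_adj X \<equiv> symm (\<lambda>e. \<bar>X e\<bar>)"

lemma symm_commute: "symm Y i j = symm Y j i"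
  by (auto simp: symm_def)

lemma finite_pairs: "finite (pairs n)"
  by (rule finite_subset[of _ "{..<n} \<times> {..<n}"]) (auto simp: pairs_def)

text \<open>The bridge from double sums over vertices to the independent variables, which are
  indexed by \<open>pairs n\<close>: upper triangle, mirror image and diagonal.\<close>

lemma sum_over_pairs:
  fixes h :: "nat \<Rightarrow> nat \<Rightarrow> real"
  assumes "\<And>i. h i i = 0"
  shows "(\<Sum>i<n. \<Sum>j<n. h i j) = (\<Sum>e\<in>pairs n. h (fst e) (snd e) + h (snd e) (fst e))"
proof -
  let ?D = "(\<lambda>i. (i, i)) ` {..<n}" and ?Q = "prod.swap ` pairs n"
  have "{..<n} \<times> {..<n} = pairs n \<union> (?Q \<union> ?D)"
    by (auto simp: pairs_def image_iff)
  then have "(\<Sum>i<n. \<Sum>j<n. h i j) = (\<Sum>e\<in>pairs n \<union> (?Q \<union> ?D). h (fst e) (snd e))"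
    by (simp add: sum.cartesian_product case_prod_unfold)
  also have "\<dots> = (\<Sum>e\<in>pairs n. h (fst e) (snd e)) + ((\<Sum>e\<in>?Q. h (fst e) (snd e)) + (\<Sum>e\<in>?D. h (fst e) (snd e)))"
  proof -
    have "pairs n \<inter> (?Q \<union> ?D) = {}" "?Q \<inter> ?D = {}" by (auto simp: pairs_def)
    then show ?thesis by (simp add: sum.union_disjoint finite_pairs)
  qed
  also have "(\<Sum>e\<in>?D. h (fst e) (snd e)) = 0" by (intro sum.neutral) (auto simp: assms)
  also have "(\<Sum>e\<in>?Q. h (fst e) (snd e)) = (\<Sum>e\<in>pairs n. h (snd e) (fst e))"
    by (subst sum.reindex) (auto simp: inj_on_def)
  finally show ?thesis by (simp add: sum.distrib)
qed

lemma light_sum_symm: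
  "light_sum n \<beta> (symm Y) x y = (\<Sum>e\<in>pairs n.
     ((if \<bar>x (fst e) * y (snd e)\<bar> \<le> \<beta> / real n then x (fst e) * y (snd e) else 0)
      + (if \<bar>x (snd e) * y (fst e)\<bar> \<le> \<beta> / real n then x (snd e) * y (fst e) else 0)) * Y e)"
  unfolding light_sum_def
  by (subst sum_over_pairs) (auto simp: symm_def pairs_def algebra_simps intro!: sum.cong)

text \<open>An entry enters with coefficient \<open>a e\<close> of modulus at most
  \<open>2 * \<beta> / n\<close>, and the tilt \<open>l = n / (4 * \<beta>)\<close> is the largest
  for which this guarantees \<open>\<bar>l * a e\<bar> \<le> 1/2\<close>. The variance term is then
  at most \<open>n\<close>, while the deviation \<open>128 * \<beta>\<close> becomes
  \<open>32 * n\<close>. The remaining rate \<open>31 * n\<close> has to beat the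
  \<open>28 * n\<close> of a union bound over pairs of grid points.\<close>

lemma prob_light_sum_ge:
  fixes \<xi> :: "nat \<times> nat \<Rightarrow> real \<Rightarrow> real"
  assumes fin: "\<And>e. e \<in> pairs n \<Longrightarrow> finite (set_pmf (P e))"
    and mgf: "\<And>e a. e \<in> pairs n \<Longrightarrow> \<bar>a\<bar> \<le> 1/2 \<Longrightarrow>
      measure_pmf.expectation (P e) (\<lambda>v. exp (a * \<xi> e v)) \<le> exp (a\<^sup>2 * p)"
    and n: "n > 0" and \<beta>: "\<beta> > 0" and p: "0 \<le> p" "real n * p \<le> 8 * \<beta>\<^sup>2"
    and x: "nsq n x \<le> 1" and y: "nsq n y \<le> 1"
  shows "measure_pmf.prob (Pi_pmf (pairs n) dflt P)
      {X. 128 * \<beta> \<le> light_sum n \<beta> (symm (\<lambda>e. \<xi> e (X e))) x y} \<le> exp (- 31 * real n)"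
proof -
  define u where "u = (\<lambda>i j. if \<bar>x i * y j\<bar> \<le> \<beta> / real n then x i * y j else 0)"
  define a where "a = (\<lambda>e::nat\<times>nat. u (fst e) (snd e) + u (snd e) (fst e))"
  define l where "l = real n / (4 * \<beta>)"
  have l: "0 \<le> l" using \<beta> by (simp add: l_def)
  have u: "\<bar>u i j\<bar> \<le> \<beta> / real n" for i j using \<beta> by (simp add: u_def)
  have la: "\<bar>l * a e\<bar> \<le> 1/2" for e
  proof -
    have "\<bar>a e\<bar> \<le> 2 * \<beta> / real n"
      using u[of "fst e" "snd e"] u[of "snd e" "fst e"] unfolding a_def by linarith
    then have "l * \<bar>a e\<bar> \<le> l * (2 * \<beta> / real n)" using l by (rule mult_left_mono)
    also have "\<dots> = 1/2" using \<beta> n by (simp add: l_def)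
    finally show ?thesis using l by (simp add: abs_mult)
  qed
  have "measure_pmf.prob (Pi_pmf (pairs n) dflt P) {X. 32 * real n \<le> (\<Sum>e\<in>pairs n. (l * a e) * \<xi> e (X e))}
      \<le> exp ((\<Sum>e\<in>pairs n. (l * a e)\<^sup>2 * p) - 32 * real n)"
    by (rule Pi_pmf_chernoff[OF finite_pairs fin]) (auto intro: mgf la)
  also have "{X. 32 * real n \<le> (\<Sum>e\<in>pairs n. (l * a e) * \<xi> e (X e))}
      = {X. 128 * \<beta> \<le> light_sum n \<beta> (symm (\<lambda>e. \<xi> e (X e))) x y}"
  proof -
    have "(\<Sum>e\<in>pairs n. (l * a e) * \<xi> e (X e)) = l * light_sum n \<beta> (symm (\<lambda>e. \<xi> e (X e))) x y" for X
      unfolding light_sum_symm a_def u_def sum_distrib_left by (intro sum.cong) (auto simp: mult_ac)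
    moreover have "32 * real n \<le> l * t \<longleftrightarrow> 128 * \<beta> \<le> t" for t
      using \<beta> n by (simp add: l_def field_simps)
    ultimately show ?thesis by simp
  qed
  also have "(\<Sum>e\<in>pairs n. (l * a e)\<^sup>2 * p) \<le> real n"
  proof -
    have "(\<Sum>e\<in>pairs n. (a e)\<^sup>2) \<le> (\<Sum>e\<in>pairs n. 2 * ((u (fst e) (snd e))\<^sup>2 + (u (snd e) (fst e))\<^sup>2))"
    proof (rule sum_mono)
      fix e
      show "(a e)\<^sup>2 \<le> 2 * ((u (fst e) (snd e))\<^sup>2 + (u (snd e) (fst e))\<^sup>2)"
        using sum_squares_bound[of "u (fst e) (snd e)" "u (snd e) (fst e)"]
        unfolding a_def by (simp add: power2_sum)
    qed
    also have "\<dots> \<le> (\<Sum>e\<in>pairs n. 2 * ((x (fst e) * y (snd e))\<^sup>2 + (x (snd e) * y (fst e))\<^sup>2))"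
      by (intro sum_mono) (auto simp: u_def)
    also have "\<dots> = 2 * (\<Sum>e\<in>pairs n. (if fst e = snd e then 0 else (x (fst e) * y (snd e))\<^sup>2)
          + (if snd e = fst e then 0 else (x (snd e) * y (fst e))\<^sup>2))"
      unfolding sum_distrib_left by (intro sum.cong) (auto simp: pairs_def)
    also have "\<dots> = 2 * (\<Sum>i<n. \<Sum>j<n. if i = j then 0 else (x i * y j)\<^sup>2)"
      by (subst sum_over_pairs) auto
    also have "\<dots> \<le> 2 * (\<Sum>i<n. \<Sum>j<n. (x i)\<^sup>2 * (y j)\<^sup>2)"
      by (intro mult_left_mono sum_mono) (auto simp: power_mult_distrib)
    also have "\<dots> = 2 * (nsq n x * nsq n y)" by (simp add: nsq_def sum_product)
    also have "\<dots> \<le> 2" using x y nsq_nonneg[of n x] nsq_nonneg[of n y] by (simp add: mult_le_one)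
    finally have "l\<^sup>2 * p * (\<Sum>e\<in>pairs n. (a e)\<^sup>2) \<le> l\<^sup>2 * p * 2" using p by (intro mult_left_mono) auto
    also have "l\<^sup>2 * p * 2 \<le> real n"
    proof -
      have "l\<^sup>2 * p * 2 = real n * (real n * p) / (8 * \<beta>\<^sup>2)"
        by (simp add: l_def power_divide power_mult_distrib power2_eq_square)
      also have "\<dots> \<le> real n * (8 * \<beta>\<^sup>2) / (8 * \<beta>\<^sup>2)"
        using p \<beta> by (intro divide_right_mono mult_left_mono) auto
      also have "\<dots> = real n" using \<beta> by simp
      finally show ?thesis .
    qed
    finally show ?thesis by (simp add: sum_distrib_left power_mult_distrib mult_ac)
  qed
  finally show ?thesis by simp
qed

lemma prob_light_sum_grid:
  fixes \<xi> :: "nat \<times> nat \<Rightarrow> real \<Rightarrow> real"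
  assumes fin: "\<And>e. e \<in> pairs n \<Longrightarrow> finite (set_pmf (P e))"
    and mgf: "\<And>e a. e \<in> pairs n \<Longrightarrow> \<bar>a\<bar> \<le> 1/2 \<Longrightarrow>
      measure_pmf.expectation (P e) (\<lambda>v. exp (a * \<xi> e v)) \<le> exp (a\<^sup>2 * p)"
    and n: "n > 0" and \<beta>: "\<beta> > 0" and p: "0 \<le> p" "real n * p \<le> 8 * \<beta>\<^sup>2"
  shows "measure_pmf.prob (Pi_pmf (pairs n) dflt P)
      {X. \<exists>x\<in>grid n. \<exists>y\<in>grid n. nsq n x \<le> 1 \<and> nsq n y \<le> 1 \<and>
         128 * \<beta> \<le> light_sum n \<beta> (symm (\<lambda>e. \<xi> e (X e))) x y} \<le> exp (- 3 * real n)"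
proof -
  let ?P = "Pi_pmf (pairs n) dflt P"
  let ?N = "{x \<in> grid n. nsq n x \<le> 1}"
  have fN: "finite (?N \<times> ?N)" using finite_grid[of n] by simp
  have "real (card ?N) \<le> exp (14 * real n)"
    using card_mono[OF finite_grid, of ?N n] card_grid_le[of n] by (simp add: Collect_conj_eq)
  then have "real (card ?N) * real (card ?N) \<le> exp (14 * real n) * exp (14 * real n)"
    by (intro mult_mono) auto
  then have cN: "real (card (?N \<times> ?N)) \<le> exp (28 * real n)"
    by (simp add: card_cartesian_product exp_add[symmetric])
  have "measure_pmf.prob ?P {X. \<exists>x\<in>grid n. \<exists>y\<in>grid n. nsq n x \<le> 1 \<and> nsq n y \<le> 1 \<and>
         128 * \<beta> \<le> light_sum n \<beta> (symm (\<lambda>e. \<xi> e (X e))) x y}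
      = measure_pmf.prob ?P (\<Union>z\<in>?N \<times> ?N. {X. 128 * \<beta> \<le> light_sum n \<beta> (symm (\<lambda>e. \<xi> e (X e))) (fst z) (snd z)})"
    by (rule arg_cong[where f = "measure_pmf.prob ?P"]) fastforce
  also have "\<dots> \<le> (\<Sum>z\<in>?N \<times> ?N. measure_pmf.prob ?P {X. 128 * \<beta> \<le> light_sum n \<beta> (symm (\<lambda>e. \<xi> e (X e))) (fst z) (snd z)})"
    using fN by (intro measure_pmf.finite_measure_subadditive_finite) auto
  also have "\<dots> \<le> (\<Sum>z\<in>?N \<times> ?N. exp (- 31 * real n))"
    by (intro sum_mono prob_light_sum_ge[OF fin mgf n \<beta> p]) auto
  also have "\<dots> = real (card (?N \<times> ?N)) * exp (- 31 * real n)" by simp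
  also have "\<dots> \<le> exp (28 * real n) * exp (- 31 * real n)" using cN by (rule mult_right_mono) simp
  also have "\<dots> = exp (- 3 * real n)" by (simp add: exp_add[symmetric])
  finally show ?thesis .
qed

lemma row_sum_symm:
  assumes "i < n"
  shows "(\<Sum>j<n. symm Y i j) = (\<Sum>e\<in>pairs n. if fst e = i \<or> snd e = i then Y e else 0)"
proof -
  have "(\<Sum>j<n. symm Y i j) = (\<Sum>i'<n. \<Sum>j<n. if i' = i then symm Y i' j else 0)"
  proof -
    have "(\<Sum>i'<n. \<Sum>j<n. if i' = i then symm Y i' j else 0) = (\<Sum>i'<n. if i' = i then \<Sum>j<n. symm Y i' j else 0)"
      by (intro sum.cong) auto
    then show ?thesis using assms by simp
  qed
  also have "\<dots> = (\<Sum>e\<in>pairs n. if fst e = i \<or> snd e = i then Y e else 0)"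
    by (subst sum_over_pairs) (auto simp: symm_def pairs_def intro!: sum.cong)
  finally show ?thesis .
qed

lemma card_incident_pairs:
  assumes "i < n"
  shows "(\<Sum>e\<in>pairs n. if fst e = i \<or> snd e = i then c else 0) = c * (real n - 1)"
proof -
  have "(\<Sum>j<n. symm (\<lambda>_. c) i j) = (\<Sum>j\<in>{..<n} - {i}. c)"
    by (rule sum.mono_neutral_cong_right) (auto simp: symm_def)
  then show ?thesis using assms row_sum_symm[OF assms, of "\<lambda>_. c"] by (simp add: of_nat_diff)
qed

text \<open>Chernoff with tilt \<open>1/4\<close> in either direction: the variance term
  \<open>d / 16\<close> against the deviation \<open>d / 8\<close> leaves \<open>- d / 16\<close>.
  The union over vertices and signs gives the factor \<open>2 * n\<close>.\<close>

lemma prob_degree_deviation: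
  assumes fin: "\<And>e. e \<in> pairs n \<Longrightarrow> finite (set_pmf (P e))"
    and mgf: "\<And>e a. e \<in> pairs n \<Longrightarrow> \<bar>a\<bar> \<le> 1/2 \<Longrightarrow>
      measure_pmf.expectation (P e) (\<lambda>v. exp (a * (\<bar>v\<bar> - p))) \<le> exp (a\<^sup>2 * p)"
    and d: "d = p * (real n - 1)"
  shows "measure_pmf.prob (Pi_pmf (pairs n) dflt P)
      {X. \<exists>i<n. d / 2 \<le> \<bar>(\<Sum>j<n. abs_adj X i j) - d\<bar>} \<le> 2 * real n * exp (- d / 16)"
proof -
  let ?P = "Pi_pmf (pairs n) dflt P"
  let ?I = "\<lambda>i e. fst e = i \<or> snd e = (i::nat)"
  define S where "S = (\<lambda>X i. (\<Sum>j<n. abs_adj X i j) - d)"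
  have S: "S X i = (\<Sum>e\<in>pairs n. if ?I i e then \<bar>X e\<bar> - p else 0)" if "i < n" for X i
  proof -
    have "(\<Sum>e\<in>pairs n. if ?I i e then \<bar>X e\<bar> - p else 0)
        = (\<Sum>e\<in>pairs n. (if ?I i e then \<bar>X e\<bar> else 0) - (if ?I i e then p else 0))"
      by (intro sum.cong) auto
    then show ?thesis unfolding S_def row_sum_symm[OF that] sum_subtractf card_incident_pairs[OF that] d by simp
  qed
  have one: "measure_pmf.prob ?P {X. d / 8 \<le> (s / 4) * S X i} \<le> exp (- d / 16)"
    if i: "i < n" and s: "s\<^sup>2 = 1" for i s
  proof -
    have s1: "\<bar>s\<bar> = 1" using s by (auto simp: power2_eq_1_iff)
    have "measure_pmf.prob ?P {X. d / 8 \<le> (\<Sum>e\<in>pairs n. (if ?I i e then s / 4 else 0) * (\<bar>X e\<bar> - p))}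
      \<le> exp ((\<Sum>e\<in>pairs n. (if ?I i e then s / 4 else 0)\<^sup>2 * p) - d / 8)"
      using s1 by (intro Pi_pmf_chernoff[OF finite_pairs fin] mgf) auto
    also have "(\<Sum>e\<in>pairs n. (if ?I i e then s / 4 else 0)\<^sup>2 * p) = (\<Sum>e\<in>pairs n. if ?I i e then p / 16 else 0)"
      using s by (intro sum.cong) (auto simp: power_divide)
    also have "\<dots> = d / 16" unfolding card_incident_pairs[OF i] by (simp add: d)
    also have "(\<lambda>X. \<Sum>e\<in>pairs n. (if ?I i e then s / 4 else 0) * (\<bar>X e\<bar> - p)) = (\<lambda>X. (s / 4) * S X i)"
      unfolding S[OF i] sum_distrib_left by (intro ext sum.cong) auto
    finally show ?thesis by (simp add: fun_eq_iff)
  qed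
  have "{X. \<exists>i<n. d / 2 \<le> \<bar>S X i\<bar>} \<subseteq> (\<Union>i\<in>{..<n}. {X. d / 8 \<le> (1 / 4) * S X i} \<union> {X. d / 8 \<le> (- 1 / 4) * S X i})"
    by (auto simp: abs_if split: if_splits)
  then have "measure_pmf.prob ?P {X. \<exists>i<n. d / 2 \<le> \<bar>S X i\<bar>} \<le>
      measure_pmf.prob ?P (\<Union>i\<in>{..<n}. {X. d / 8 \<le> (1 / 4) * S X i} \<union> {X. d / 8 \<le> (- 1 / 4) * S X i})"
    by (intro measure_pmf.finite_measure_mono) auto
  also have "\<dots> \<le> (\<Sum>i<n. measure_pmf.prob ?P ({X. d / 8 \<le> (1 / 4) * S X i} \<union> {X. d / 8 \<le> (- 1 / 4) * S X i}))"
    by (intro measure_pmf.finite_measure_subadditive_finite) auto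
  also have "\<dots> \<le> (\<Sum>i<n. 2 * exp (- d / 16))"
  proof (rule sum_mono)
    fix i assume "i \<in> {..<n}"
    then have i: "i < n" by simp
    have "measure_pmf.prob ?P ({X. d / 8 \<le> (1 / 4) * S X i} \<union> {X. d / 8 \<le> (- 1 / 4) * S X i})
      \<le> measure_pmf.prob ?P {X. d / 8 \<le> (1 / 4) * S X i} + measure_pmf.prob ?P {X. d / 8 \<le> (- 1 / 4) * S X i}"
      by (intro measure_Un_le) auto
    then show "measure_pmf.prob ?P ({X. d / 8 \<le> (1 / 4) * S X i} \<union> {X. d / 8 \<le> (- 1 / 4) * S X i}) \<le> 2 * exp (- d / 16)"
      using one[OF i, of 1] one[OF i, of "-1"] by simp
  qed
  finally show ?thesis by (simp add: S_def)
qed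

section \<open>Sparsity of small induced subgraphs\<close>

text \<open>A single term of the expansion of \<open>(1 + \<theta>) ^ n\<close> at
  \<open>\<theta> = u / n\<close>; the bound is the familiar \<open>(e * n / u) ^ u\<close>.\<close>

lemma binomial_le_exp:
  assumes "1 \<le> u" "u \<le> n"
  shows "real (n choose u) \<le> exp (real u + real u * ln (real n / real u))"
proof -
  define \<theta> where "\<theta> = real u / real n"
  have \<theta>: "0 < \<theta>" using assms by (simp add: \<theta>_def)
  have "real (n choose u) * \<theta> ^ u \<le> (\<Sum>k\<le>n. real (n choose k) * \<theta> ^ k)"
    using assms \<theta> by (intro member_le_sum[of u "{..n}" "\<lambda>k. real (n choose k) * \<theta> ^ k"]) auto
  also have "\<dots> = (\<theta> + 1) ^ n" by (simp add: binomial_ring)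
  also have "\<dots> \<le> exp \<theta> ^ n" using \<theta> exp_ge_add_one_self[of \<theta>] by (intro power_mono) (auto simp: add.commute)
  also have "\<dots> = exp (real u)" using assms by (simp add: exp_of_nat_mult[symmetric] \<theta>_def)
  finally have "real (n choose u) \<le> exp (real u) / \<theta> ^ u" using \<theta> by (simp add: field_simps)
  also have "\<dots> = exp (real u) * (real n / real u) ^ u" by (simp add: \<theta>_def power_divide)
  also have "(real n / real u) ^ u = exp (real u * ln (real n / real u))"
    using assms by (simp add: exp_of_nat_mult)
  finally show ?thesis by (simp add: exp_add)
qed

text \<open>The tilt is proportional to \<open>L\<close>: with
  \<open>exp l = (n / u) powr (2/3)\<close> the moment term is at most
  \<open>u * (n * p) * (u / n) powr (1/3)\<close>, and the size hypothesis makes the last factor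
  \<open>O(1 / q^2)\<close>. So this term is at most \<open>2 * q^6 * u\<close>, whereas the
  deviation contributes \<open>8 * L * q^6 * u\<close>. The rate must carry the factor
  \<open>L\<close>, because there are up to about \<open>exp (u + u * L)\<close> sets of size
  \<open>u\<close>.\<close>

lemma prob_dense_subset:
  assumes fin: "\<And>e. e \<in> pairs n \<Longrightarrow> finite (set_pmf (P e))"
    and mgf: "\<And>e a. e \<in> pairs n \<Longrightarrow>
      measure_pmf.expectation (P e) (\<lambda>v. exp (a * \<bar>v\<bar>)) \<le> exp (p * exp a)"
    and q: "2 \<le> q" and p: "0 \<le> p" "real n * p \<le> 10/9 * q^8"
    and U: "U \<subseteq> {..<n}" "U \<noteq> {}" and cU: "real (card U) * q^6 \<le> 2 * real n"
  defines "L \<equiv> ln (real n / real (card U))"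
  shows "1 \<le> L" "measure_pmf.prob (Pi_pmf (pairs n) dflt P)
      {X. 24 * q^6 * real (card U) < (\<Sum>i\<in>U. \<Sum>j\<in>U. abs_adj X i j)} \<le> exp (- 6 * real (card U) * L)"
proof -
  let ?P = "Pi_pmf (pairs n) dflt P"
  define u where "u = real (card U)"
  have finU: "finite U" using U finite_subset by blast
  have u: "1 \<le> u" using U finU by (simp add: u_def Suc_le_eq card_gt_0_iff)
  have n: "0 < n" using U by auto
  have q6: "64 \<le> q^6" using power_mono[OF q, of 6] by simp
  have "3 \<le> real n / u"
  proof -
    have "u * 64 \<le> u * q^6" using u q6 by simp
    then have "u * 3 \<le> real n" using cU u unfolding u_def[symmetric] by linarith
    then show ?thesis using u by (simp add: field_simps)
  qed
  then have "exp 1 \<le> real n / u" using exp_le by linarith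
  then show L1: "1 \<le> L" unfolding L_def u_def[symmetric] using u n by (simp add: ln_ge_iff)
  have eL: "exp L = real n / u" unfolding L_def u_def[symmetric] using u n by simp
  \<comment> \<open>\<open>g\<close> is the cube root of \<open>u / n\<close>; the size hypothesis
    gives \<open>g ^ 3 \<le> 2 / q^6\<close>, and \<open>2 < (4/3) ^ 3\<close>.\<close>
  define g where "g = exp (- L / 3)"
  have g: "g > 0" "g ^ 3 = u / real n"
    using exp_of_nat_mult[of 3 "- L / 3"] by (simp_all add: g_def exp_minus eL)
  have gq: "g \<le> 4/3 / q\<^sup>2"
  proof (rule ccontr)
    assume "\<not> ?thesis"
    then have "(4/3 / q\<^sup>2) ^ 3 < g ^ 3" using q by (intro power_strict_mono) auto
    also have "g ^ 3 \<le> 2 / q^6" using cU n q by (simp add: g u_def[symmetric] field_simps)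
    finally show False using q by (simp add: power_divide power_mult[symmetric] field_simps)
  qed
  let ?I = "\<lambda>e. fst e \<in> U \<and> snd e \<in> U"
  define l where "l = 2/3 * L"
  \<comment> \<open>The threshold is 12 instead of 24 because \<open>pairs n\<close> counts an edge
    once, while the double sum over \<open>U\<close> counts it twice.\<close>
  have "measure_pmf.prob ?P {X. l * (12 * q^6 * u) \<le> (\<Sum>e\<in>pairs n. (if ?I e then l else 0) * \<bar>X e\<bar>)}
      \<le> exp ((\<Sum>e\<in>pairs n. if ?I e then p * exp l else 0) - l * (12 * q^6 * u))"
    by (rule Pi_pmf_chernoff[OF finite_pairs fin]) (auto intro: mgf)
  also have "(\<Sum>e\<in>pairs n. if ?I e then p * exp l else 0) \<le> 2 * q^6 * u"
  proof -
    have "(\<Sum>e\<in>pairs n. if ?I e then p * exp l else 0) = (\<Sum>e\<in>{e \<in> pairs n. ?I e}. p * exp l)"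
      by (rule sum.inter_filter[symmetric]) (rule finite_pairs)
    also have "\<dots> \<le> (\<Sum>e\<in>U \<times> U. p * exp l)"
      using p finU by (intro sum_mono2) auto
    also have "\<dots> = u * (p * (u * exp l))" by (simp add: u_def card_cartesian_product)
    also have "u * exp l = real n * g"
    proof -
      have "exp l = exp L * g" by (simp add: l_def g_def exp_add[symmetric])
      then show ?thesis using u by (simp add: eL)
    qed
    also have "u * (p * (real n * g)) = u * ((real n * p) * g)" by simp
    also have "\<dots> \<le> u * ((10/9 * q^8) * (4/3 / q\<^sup>2))"
      using u g q by (intro mult_left_mono mult_mono[OF p(2) gq]) auto
    also have "\<dots> = 40/27 * q^6 * u" using q by (simp add: power_eq_if)
    also have "\<dots> \<le> 2 * q^6 * u" using u q by simp
    finally show ?thesis .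
  qed
  also have "2 * q^6 * u - l * (12 * q^6 * u) = q^6 * u * (2 - 8 * L)"
    by (simp add: l_def algebra_simps)
  also have "\<dots> \<le> q^6 * u * (- 6 * L)" using L1 u q by (intro mult_left_mono) auto
  also have "\<dots> \<le> 1 * u * (- 6 * L)"
    using L1 u q6 by (intro mult_right_mono_neg mult_right_mono) auto
  finally have *: "measure_pmf.prob ?P {X. l * (12 * q^6 * u) \<le> (\<Sum>e\<in>pairs n. (if ?I e then l else 0) * \<bar>X e\<bar>)}
      \<le> exp (- 6 * u * L)" by (simp add: mult_ac)
  have "{X. 24 * q^6 * u < (\<Sum>i\<in>U. \<Sum>j\<in>U. abs_adj X i j)}
      \<subseteq> {X. l * (12 * q^6 * u) \<le> (\<Sum>e\<in>pairs n. (if ?I e then l else 0) * \<bar>X e\<bar>)}"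
  proof safe
    fix X :: "nat \<times> nat \<Rightarrow> real"
    assume a: "24 * q^6 * u < (\<Sum>i\<in>U. \<Sum>j\<in>U. abs_adj X i j)"
    have "(\<Sum>i\<in>U. \<Sum>j\<in>U. abs_adj X i j)
        = (\<Sum>i<n. if i \<in> U then (\<Sum>j<n. if j \<in> U then abs_adj X i j else 0) else 0)"
      using U by (simp add: sum.inter_restrict[symmetric] Int_absorb1)
    also have "\<dots> = (\<Sum>i<n. \<Sum>j<n. if i \<in> U \<and> j \<in> U then abs_adj X i j else 0)"
      by (intro sum.cong) auto
    also have "\<dots> = (\<Sum>e\<in>pairs n. 2 * (if ?I e then \<bar>X e\<bar> else 0))"
      by (subst sum_over_pairs) (auto simp: symm_def pairs_def intro!: sum.cong)
    finally have "12 * q^6 * u \<le> (\<Sum>e\<in>pairs n. if ?I e then \<bar>X e\<bar> else 0)"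
      using a unfolding sum_distrib_left[symmetric] by linarith
    then have "l * (12 * q^6 * u) \<le> l * (\<Sum>e\<in>pairs n. if ?I e then \<bar>X e\<bar> else 0)"
      using L1 by (intro mult_left_mono) (auto simp: l_def)
    also have "\<dots> = (\<Sum>e\<in>pairs n. (if ?I e then l else 0) * \<bar>X e\<bar>)"
      unfolding sum_distrib_left by (intro sum.cong) auto
    finally show "l * (12 * q^6 * u) \<le> (\<Sum>e\<in>pairs n. (if ?I e then l else 0) * \<bar>X e\<bar>)" .
  qed
  then have "measure_pmf.prob ?P {X. 24 * q^6 * u < (\<Sum>i\<in>U. \<Sum>j\<in>U. abs_adj X i j)}
      \<le> measure_pmf.prob ?P {X. l * (12 * q^6 * u) \<le> (\<Sum>e\<in>pairs n. (if ?I e then l else 0) * \<bar>X e\<bar>)}"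
    by (intro measure_pmf.finite_measure_mono) auto
  with * show "measure_pmf.prob ?P {X. 24 * q^6 * real (card U) < (\<Sum>i\<in>U. \<Sum>j\<in>U. abs_adj X i j)}
      \<le> exp (- 6 * real (card U) * L)"
    unfolding u_def[symmetric] by (rule order_trans[rotated])
qed

text \<open>Union bound by size: \<open>binomial_le_exp\<close> gives at most
  \<open>exp (u + u * L)\<close> sets of size \<open>u\<close>, each bad with probability at most
  \<open>exp (- 6 * u * L)\<close>. As shown below each size contributes at most
  \<open>1 / n^2\<close>, and at most \<open>n\<close> sizes occur.\<close>

lemma prob_exists_dense_subset:
  assumes fin: "\<And>e. e \<in> pairs n \<Longrightarrow> finite (set_pmf (P e))"
    and mgf: "\<And>e a. e \<in> pairs n \<Longrightarrow>
      measure_pmf.expectation (P e) (\<lambda>v. exp (a * \<bar>v\<bar>)) \<le> exp (p * exp a)"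
    and q: "2 \<le> q" and p: "0 \<le> p" "real n * p \<le> 10/9 * q^8" and n: "n > 0"
  shows "measure_pmf.prob (Pi_pmf (pairs n) dflt P)
      {X. \<exists>U. U \<subseteq> {..<n} \<and> U \<noteq> {} \<and> real (card U) * q^6 \<le> 2 * real n \<and>
         24 * q^6 * real (card U) < (\<Sum>i\<in>U. \<Sum>j\<in>U. abs_adj X i j)} \<le> 1 / real n" (is "measure_pmf.prob _ ?Bad \<le> _")
proof -
  let ?P = "Pi_pmf (pairs n) dflt P"
  let ?B = "\<lambda>U. {X. 24 * q^6 * real (card U) < (\<Sum>i\<in>U. \<Sum>j\<in>U. abs_adj X i j)}"
  define I where "I = {u. 1 \<le> u \<and> u \<le> n \<and> real u * q^6 \<le> 2 * real n}"
  define F where "F = (\<lambda>u. {U. U \<subseteq> {..<n} \<and> card U = u})"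
  have fF: "finite (F u)" for u unfolding F_def by (rule finite_subset[of _ "Pow {..<n}"]) auto
  have fI: "finite I" unfolding I_def by (rule finite_subset[of _ "{..n}"]) auto
  have one: "(\<Sum>U\<in>F u. measure_pmf.prob ?P (?B U)) \<le> 1 / (real n)\<^sup>2" if uI: "u \<in> I" for u
  proof -
    define L where "L = ln (real n / real u)"
    have u: "1 \<le> u" "u \<le> n" using uI by (auto simp: I_def)
    have UF: "U \<subseteq> {..<n}" "U \<noteq> {}" "real (card U) * q^6 \<le> 2 * real n" "card U = u" if "U \<in> F u" for U
      using that uI by (auto simp: F_def I_def)
    obtain U0 where U0: "U0 \<in> F u"
      unfolding F_def using obtain_subset_with_card_n[of u "{..<n}"] u by auto
    have L1: "1 \<le> L" using prob_dense_subset(1)[OF fin mgf q p UF(1-3)[OF U0]] UF(4)[OF U0] by (simp add: L_def)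
    have "(\<Sum>U\<in>F u. measure_pmf.prob ?P (?B U)) \<le> (\<Sum>U\<in>F u. exp (- 6 * real u * L))"
    proof (rule sum_mono)
      fix U assume U: "U \<in> F u"
      show "measure_pmf.prob ?P (?B U) \<le> exp (- 6 * real u * L)"
        using prob_dense_subset(2)[OF fin mgf q p UF(1-3)[OF U]] UF(4)[OF U] by (simp add: L_def)
    qed
    also have "\<dots> = real (n choose u) * exp (- 6 * real u * L)"
      by (simp add: F_def n_subsets)
    also have "\<dots> \<le> exp (real u + real u * L) * exp (- 6 * real u * L)"
      unfolding L_def by (intro mult_right_mono binomial_le_exp u) auto
    also have "\<dots> = exp (real u - 5 * (real u * L))" by (simp add: exp_add[symmetric])
    also have "\<dots> \<le> exp (- 2 * ln (real n))"
    proof -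
      have uL: "real u * 1 \<le> real u * L" using L1 by (intro mult_left_mono) auto
      have "2 * ln (real n) \<le> 4 * (real u * L)"
      \<comment> \<open>For small \<open>u\<close> the logarithm \<open>L\<close> is at least
        \<open>ln n / 2\<close>; for large \<open>u\<close> already \<open>u\<close> is at least
        \<open>ln n / 2\<close>.\<close>
      proof (cases "u * u \<le> n")
        case True
        then have "real u * real u \<le> real n" by (metis of_nat_le_iff of_nat_mult)
        then have "real n * (real u)\<^sup>2 \<le> real n * real n" by (intro mult_left_mono) (auto simp: power2_eq_square)
        then have "real n \<le> (real n / real u)\<^sup>2"
          using u by (simp add: power_divide field_simps power2_eq_square)
        then have "ln (real n) \<le> ln ((real n / real u)\<^sup>2)" using n u by (subst ln_le_cancel_iff) auto
        also have "\<dots> = 2 * L" using n u by (simp add: ln_realpow L_def)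
        finally have "ln (real n) \<le> 2 * L" .
        moreover have "1 * L \<le> real u * L" using L1 u by (intro mult_right_mono) auto
        ultimately show ?thesis by linarith
      next
        case False
        then have "real n \<le> (real u)\<^sup>2" unfolding power2_eq_square by (metis nat_le_linear of_nat_le_iff of_nat_mult)
        then have "ln (real n) \<le> ln ((real u)\<^sup>2)" using n u by (subst ln_le_cancel_iff) auto
        also have "\<dots> = 2 * ln (real u)" using u by (simp add: ln_realpow)
        also have "ln (real u) \<le> real u" using ln_le_minus_one[of "real u"] u by linarith
        finally show ?thesis using uL by linarith
      qed
      then show ?thesis unfolding exp_le_cancel_iff using uL by linarith
    qed
    also have "\<dots> = 1 / (real n)\<^sup>2"
    proof -
      have "exp (2 * ln (real n)) = (real n)\<^sup>2" using n exp_of_nat_mult[of 2 "ln (real n)"] by simp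
      then show ?thesis by (simp add: exp_minus inverse_eq_divide)
    qed
    finally show ?thesis .
  qed
  have "?Bad \<subseteq> (\<Union>u\<in>I. \<Union>U\<in>F u. ?B U)"
  proof
    fix X :: "nat \<times> nat \<Rightarrow> real"
    assume "X \<in> ?Bad"
    then obtain U where U: "U \<subseteq> {..<n}" "real (card U) * q^6 \<le> 2 * real n" "U \<noteq> {}"
      and X: "24 * q^6 * real (card U) < (\<Sum>i\<in>U. \<Sum>j\<in>U. abs_adj X i j)" by blast
    have "finite U" using U finite_subset by blast
    then have "card U \<in> I" using U card_mono[OF _ U(1)] by (auto simp: I_def Suc_le_eq card_gt_0_iff)
    moreover have "U \<in> F (card U)" using U by (simp add: F_def)
    ultimately show "X \<in> (\<Union>u\<in>I. \<Union>U\<in>F u. ?B U)" using X by blast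
  qed
  then have "measure_pmf.prob ?P ?Bad \<le> measure_pmf.prob ?P (\<Union>u\<in>I. \<Union>U\<in>F u. ?B U)"
    by (intro measure_pmf.finite_measure_mono) auto
  also have "\<dots> \<le> (\<Sum>u\<in>I. measure_pmf.prob ?P (\<Union>U\<in>F u. ?B U))"
    using fI by (intro measure_pmf.finite_measure_subadditive_finite) auto
  also have "\<dots> \<le> (\<Sum>u\<in>I. \<Sum>U\<in>F u. measure_pmf.prob ?P (?B U))"
    using fF by (intro sum_mono measure_pmf.finite_measure_subadditive_finite) auto
  also have "\<dots> \<le> (\<Sum>u\<in>I. 1 / (real n)\<^sup>2)" by (intro sum_mono one)
  also have "\<dots> \<le> (\<Sum>u\<in>{1..n}. 1 / (real n)\<^sup>2)" by (intro sum_mono2) (auto simp: I_def)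
  also have "\<dots> = 1 / real n" using n by (simp add: power2_eq_square)
  finally show ?thesis .
qed

section \<open>Concentration\<close>

text \<open>The light pairs give 128 and the rest 31; the passage from the grid to the ball doubles
  159 to 318, which is rounded up.\<close>

lemma bil_le_of_light_grid:
  fixes G w :: "nat \<Rightarrow> nat \<Rightarrow> real"
  assumes G: "\<And>i j. 0 \<le> G i j" "\<And>i j. G i j = G j i" "\<And>i. G i i = 0"
    and q: "q \<ge> 1" and n: "n > 0"
    and deg: "\<And>i. i < n \<Longrightarrow> (\<Sum>j<n. G i j) \<le> 3/2 * q^8"
    and sparse: "\<And>U. U \<subseteq> {..<n} \<Longrightarrow> U \<noteq> {} \<Longrightarrow> real (card U) * q^6 \<le> 2 * real n \<Longrightarrow>
       (\<Sum>i\<in>U. \<Sum>j\<in>U. G i j) \<le> 24 * q^6 * real (card U)"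
    and w: "\<And>i j. \<bar>w i j\<bar> \<le> G i j + p" and p: "0 \<le> p" "real n * p \<le> 2 * q^8"
    and light: "\<And>x y. x \<in> grid n \<Longrightarrow> y \<in> grid n \<Longrightarrow> nsq n x \<le> 1 \<Longrightarrow> nsq n y \<le> 1 \<Longrightarrow>
       light_sum n (q^7) w x y \<le> 128 * q^7"
    and x: "nsq n x \<le> 1" and y: "nsq n y \<le> 1"
  shows "bil n w x y \<le> 320 * q^7"
proof -
  have "bil n w x y \<le> 2 * (159 * q^7)"
  proof (rule bil_le_of_grid[OF n _ x y])
    fix x y assume a: "x \<in> grid n" "y \<in> grid n" "nsq n x \<le> 1" "nsq n y \<le> 1"
    show "bil n w x y \<le> 159 * q^7"
      using bil_le_light[OF G q n a(3,4) deg sparse w p] light[OF a] by simp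
  qed
  also have "\<dots> \<le> 320 * q^7" using q by simp
  finally show ?thesis .
qed

text \<open>The only probabilistic input of all that follows, with \<open>q^8\<close> standing for
  the expected degree. The unsigned form serves to bound the vector of degree errors in Euclidean
  norm, far below the uniform \<open>q^8 / 2\<close>.\<close>

definition concentrated :: "nat \<Rightarrow> (nat \<Rightarrow> nat) \<Rightarrow> real \<Rightarrow> real \<Rightarrow> real \<Rightarrow> (nat \<times> nat \<Rightarrow> real) \<Rightarrow> bool" where
  "concentrated n cl p \<eta> q X \<longleftrightarrow>
     (\<forall>i<n. \<bar>(\<Sum>j<n. abs_adj X i j) - q^8\<bar> \<le> q^8 / 2) \<and>
     (\<forall>x y. nsq n x \<le> 1 \<longrightarrow> nsq n y \<le> 1 \<longrightarrow>
        bil n (symm (\<lambda>e. X e - emean p \<eta> (cl (fst e) = cl (snd e)))) x y \<le> 320 * q^7 \<and>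
        bil n (symm (\<lambda>e. \<bar>X e\<bar> - p)) x y \<le> 320 * q^7)"

lemma prob_concentrated:
  assumes n: "n \<ge> 10" and p: "0 < p" "p \<le> 1" and \<eta>: "0 \<le> \<eta>" "\<eta> \<le> 1"
    and q: "q \<ge> 4" and d: "q^8 = p * (real n - 1)"
  shows "measure_pmf.prob (Pi_pmf (pairs n) 0 (\<lambda>(j, j'). entry_pmf p \<eta> (cl j = cl j')))
      {X. concentrated n cl p \<eta> q X} \<ge> 1 - 2 / real n - real n * exp (- real n * p / 32)"
proof -
  let ?E = "\<lambda>(j, j'). entry_pmf p \<eta> (cl j = cl j')"
  let ?P = "Pi_pmf (pairs n) 0 ?E"
  let ?s = "\<lambda>e. cl (fst e) = cl (snd e)"
  let ?\<xi> = "\<lambda>e v. v - emean p \<eta> (?s e)" and ?\<zeta> = "\<lambda>(e::nat\<times>nat) v. \<bar>v\<bar> - p"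
  have E: "?E e = entry_pmf p \<eta> (?s e)" for e by (simp add: case_prod_unfold)
  have p0: "0 \<le> p" using p by simp
  have fin: "finite (set_pmf (?E e))" for e unfolding E by (rule finite_set_entry_pmf)
  have m1: "measure_pmf.expectation (?E e) (\<lambda>v. exp (a * ?\<xi> e v)) \<le> exp (a\<^sup>2 * p)" if "\<bar>a\<bar> \<le> 1/2" for e a
    unfolding E by (rule mgf_entry_signed[OF p0 p(2) \<eta> that])
  have m2: "measure_pmf.expectation (?E e) (\<lambda>v. exp (a * ?\<zeta> e v)) \<le> exp (a\<^sup>2 * p)" if "\<bar>a\<bar> \<le> 1/2" for e a
    unfolding E by (rule mgf_entry_unsigned[OF p0 p(2) \<eta> that])
  have m3: "measure_pmf.expectation (?E e) (\<lambda>v. exp (a * \<bar>v\<bar>)) \<le> exp (p * exp a)" for e a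
    unfolding E by (rule mgf_entry_count[OF p0 p(2) \<eta>])
  have np: "real n * p \<le> 10/9 * q^8"
  proof -
    have "real n \<le> 10/9 * (real n - 1)" using n by simp
    then have "p * real n \<le> p * (10/9 * (real n - 1))" using p0 by (rule mult_left_mono)
    then show ?thesis using d by (simp add: mult_ac)
  qed
  have q1: "1 \<le> q^6" "1 \<le> q^8" "0 < q^7" using q by simp_all
  have np8: "real n * p \<le> 8 * (q^7)\<^sup>2"
  proof -
    have "q^8 * 1 \<le> q^8 * q^6" using q1 by (intro mult_left_mono) auto
    also have "\<dots> = (q^7)\<^sup>2" by (simp add: power_add[symmetric] power_mult[symmetric])
    finally show ?thesis using np q1 by linarith
  qed
  define B1 where "B1 = {X. \<exists>i<n. q^8 / 2 \<le> \<bar>(\<Sum>j<n. abs_adj X i j) - q^8\<bar>}"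
  define B2 where "B2 = {X. \<exists>x\<in>grid n. \<exists>y\<in>grid n. nsq n x \<le> 1 \<and> nsq n y \<le> 1 \<and>
         128 * q^7 \<le> light_sum n (q^7) (symm (\<lambda>e. ?\<xi> e (X e))) x y}"
  define B3 where "B3 = {X. \<exists>x\<in>grid n. \<exists>y\<in>grid n. nsq n x \<le> 1 \<and> nsq n y \<le> 1 \<and>
         128 * q^7 \<le> light_sum n (q^7) (symm (\<lambda>e. ?\<zeta> e (X e))) x y}"
  define B4 where "B4 = {X. \<exists>U. U \<subseteq> {..<n} \<and> U \<noteq> {} \<and> real (card U) * q^6 \<le> 2 * real n \<and>
         24 * q^6 * real (card U) < (\<Sum>i\<in>U. \<Sum>j\<in>U. abs_adj X i j)}"
  have n0: "n > 0" using n by simp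
  have "measure_pmf.prob ?P B1 \<le> 2 * real n * exp (- (q^8) / 16)"
    unfolding B1_def by (rule prob_degree_deviation[OF fin m2 d])
  \<comment> \<open>By \<open>n * p \<le> 10/9 * q^8\<close> the exponent \<open>q^8 / 16\<close>
    exceeds \<open>n * p / 32\<close> by at least 1. This surplus absorbs the factor 2, and is the
    origin of the constant 32.\<close>
  also have "\<dots> \<le> real n * exp (- real n * p / 32)"
  proof -
    have "64 \<le> q^8" using power_mono[OF q, of 8] by simp
    then have "1 \<le> q^8 / 16 - real n * p / 32" using np by linarith
    then have "2 \<le> exp (q^8 / 16 - real n * p / 32)"
      using exp_ge_add_one_self[of "q^8 / 16 - real n * p / 32"] by linarith
    then have "2 * exp (- (q^8) / 16) \<le> exp (q^8 / 16 - real n * p / 32) * exp (- (q^8) / 16)"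
      by (rule mult_right_mono) simp
    also have "\<dots> = exp (- real n * p / 32)" by (simp add: exp_add[symmetric])
    finally have "real n * (2 * exp (- (q^8) / 16)) \<le> real n * exp (- real n * p / 32)"
      by (rule mult_left_mono) simp
    then show ?thesis by (simp only: mult_ac)
  qed
  finally have b1: "measure_pmf.prob ?P B1 \<le> real n * exp (- real n * p / 32)" .
  have b2: "measure_pmf.prob ?P B2 \<le> exp (- 3 * real n)"
    unfolding B2_def by (rule prob_light_sum_grid[OF fin m1 n0 q1(3) p0 np8])
  have b3: "measure_pmf.prob ?P B3 \<le> exp (- 3 * real n)"
    unfolding B3_def by (rule prob_light_sum_grid[OF fin m2 n0 q1(3) p0 np8])
  have b4: "measure_pmf.prob ?P B4 \<le> 1 / real n"
    unfolding B4_def using q by (intro prob_exists_dense_subset[OF fin m3 _ p0 np n0]) auto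
  \<comment> \<open>The two grid events together cost \<open>1 / n\<close>, and the dense sets cost
    another \<open>1 / n\<close>.\<close>
  have e3: "exp (- 3 * real n) \<le> 1 / (2 * real n)"
  proof -
    have "2 * real n \<le> exp (3 * real n)" using exp_ge_add_one_self[of "3 * real n"] by linarith
    then show ?thesis using n0 by (simp add: exp_minus field_simps)
  qed
  have good: "- (B1 \<union> (B2 \<union> (B3 \<union> B4))) \<subseteq> {X. concentrated n cl p \<eta> q X}"
  proof safe
    fix X :: "nat \<times> nat \<Rightarrow> real"
    assume X: "X \<notin> B1" "X \<notin> B2" "X \<notin> B3" "X \<notin> B4"
    let ?G = "abs_adj X"
    have deg: "\<bar>(\<Sum>j<n. ?G i j) - q^8\<bar> \<le> q^8 / 2" if "i < n" for i
      using X(1) that by (auto simp: B1_def not_le intro: less_imp_le)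
    have deg': "(\<Sum>j<n. ?G i j) \<le> 3/2 * q^8" if "i < n" for i using deg[OF that] by linarith
    have G: "\<And>i j. 0 \<le> ?G i j" "\<And>i j. ?G i j = ?G j i" "\<And>i. ?G i i = 0"
      by (auto simp: symm_def)
    have sparse: "(\<Sum>i\<in>U. \<Sum>j\<in>U. ?G i j) \<le> 24 * q^6 * real (card U)"
      if "U \<subseteq> {..<n}" "U \<noteq> {}" "real (card U) * q^6 \<le> 2 * real n" for U
      using X(4) that unfolding B4_def by (metis (mono_tags, lifting) mem_Collect_eq not_less)
    have em: "\<bar>emean p \<eta> b\<bar> \<le> p" for b
    proof -
      have "\<bar>emean p \<eta> b\<bar> = p * \<bar>1 - 2 * \<eta>\<bar>" using p by (simp add: emean_def abs_mult)
      also have "\<dots> \<le> p * 1" using p \<eta> by (intro mult_left_mono) auto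
      finally show ?thesis by simp
    qed
    have w1: "\<bar>symm (\<lambda>e. ?\<xi> e (X e)) i j\<bar> \<le> ?G i j + p" for i j
    proof -
      have "\<bar>X e - emean p \<eta> (?s e)\<bar> \<le> \<bar>X e\<bar> + p" for e using em[of "?s e"] by linarith
      from this[of "(i, j)"] this[of "(j, i)"] show ?thesis using p0 by (simp add: symm_def)
    qed
    have w2: "\<bar>symm (\<lambda>e. ?\<zeta> e (X e)) i j\<bar> \<le> ?G i j + p" for i j
      using p0 by (auto simp: symm_def)
    have qq: "1 \<le> q" using q by simp
    have np2: "real n * p \<le> 2 * q^8" using np q1 by linarith
    have "bil n (symm (\<lambda>e. ?\<xi> e (X e))) x y \<le> 320 * q^7" if xy: "nsq n x \<le> 1" "nsq n y \<le> 1" for x y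
    proof (rule bil_le_of_light_grid[OF G qq n0 deg' sparse w1 p0 np2 _ xy])
      fix x y assume "x \<in> grid n" "y \<in> grid n" "nsq n x \<le> 1" "nsq n y \<le> 1"
      then show "light_sum n (q^7) (symm (\<lambda>e. ?\<xi> e (X e))) x y \<le> 128 * q^7"
        using X(2) by (force simp: B2_def not_le)
    qed
    moreover have "bil n (symm (\<lambda>e. ?\<zeta> e (X e))) x y \<le> 320 * q^7" if xy: "nsq n x \<le> 1" "nsq n y \<le> 1" for x y
    proof (rule bil_le_of_light_grid[OF G qq n0 deg' sparse w2 p0 np2 _ xy])
      fix x y assume "x \<in> grid n" "y \<in> grid n" "nsq n x \<le> 1" "nsq n y \<le> 1"
      then show "light_sum n (q^7) (symm (\<lambda>e. ?\<zeta> e (X e))) x y \<le> 128 * q^7"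
        using X(3) by (force simp: B3_def not_le)
    qed
    ultimately show "concentrated n cl p \<eta> q X" using deg unfolding concentrated_def by blast
  qed
  have un: "measure_pmf.prob ?P (A \<union> B) \<le> measure_pmf.prob ?P A + measure_pmf.prob ?P B" for A B
    by (rule measure_Un_le) auto
  have "measure_pmf.prob ?P (B1 \<union> (B2 \<union> (B3 \<union> B4)))
      \<le> measure_pmf.prob ?P B1 + (measure_pmf.prob ?P B2 + (measure_pmf.prob ?P B3 + measure_pmf.prob ?P B4))"
    using un[of B1 "B2 \<union> (B3 \<union> B4)"] un[of B2 "B3 \<union> B4"] un[of B3 B4] by linarith
  also have "\<dots> \<le> real n * exp (- real n * p / 32) + 2 * (1 / (2 * real n)) + 1 / real n"
    using b1 b2 b3 b4 e3 by linarith
  finally have "measure_pmf.prob ?P (B1 \<union> (B2 \<union> (B3 \<union> B4))) \<le> real n * exp (- real n * p / 32) + 2 / real n"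
    by simp
  then have "1 - 2 / real n - real n * exp (- real n * p / 32) \<le> measure_pmf.prob ?P (- (B1 \<union> (B2 \<union> (B3 \<union> B4))))"
    using measure_pmf.prob_compl[of "B1 \<union> (B2 \<union> (B3 \<union> B4))" ?P] by (simp add: Compl_eq_Diff_UNIV)
  also have "\<dots> \<le> measure_pmf.prob ?P {X. concentrated n cl p \<eta> q X}"
    using good by (intro measure_pmf.finite_measure_mono) auto
  finally show ?thesis .
qed

section \<open>Rayleigh quotients and the spectral theorem\<close>

text \<open>Tychonoff's theorem, used to find minimisers on a unit sphere sitting inside a function
  space.\<close>

lemma compact_coordinatewise:
  fixes S :: "'a \<Rightarrow> 'b::topological_space set"
  assumes "\<And>i. compact (S i)"
  shows "compact {f. \<forall>i. f i \<in> S i}"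
proof -
  have "compactin (product_topology (\<lambda>i::'a. euclidean :: 'b topology) UNIV) (PiE UNIV S)"
    using assms by (subst compactin_PiE) auto
  moreover have "PiE UNIV S = {f. \<forall>i. f i \<in> S i}" by (auto simp: PiE_def Pi_def extensional_def)
  ultimately show ?thesis by (simp add: euclidean_product_topology)
qed

lemma scalar_prod_mult_mat_vec_sum:
  fixes A :: "real mat"
  assumes "A \<in> carrier_mat n m" "x \<in> carrier_vec n" "y \<in> carrier_vec m"
  shows "x \<bullet> (A *\<^sub>v y) = (\<Sum>i<n. \<Sum>j<m. A $$ (i, j) * x $ i * y $ j)"
  using assms by (auto simp: scalar_prod_def atLeast0LessThan sum_distrib_left mult_ac intro!: sum.cong)

lemma scalar_prod_mult_mat_vec_symmetric:
  fixes S :: "real mat"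
  assumes S: "S \<in> carrier_mat n n" "S\<^sup>T = S" and x: "x \<in> carrier_vec n" and y: "y \<in> carrier_vec n"
  shows "x \<bullet> (S *\<^sub>v y) = y \<bullet> (S *\<^sub>v x)"
proof -
  have "x \<bullet> (S *\<^sub>v y) = (S\<^sup>T *\<^sub>v x) \<bullet> y" by (rule transpose_vec_mult_scalar[symmetric, OF S(1) y x])
  also have "\<dots> = y \<bullet> (S *\<^sub>v x)" unfolding S(2) using S(1) x y by (intro comm_scalar_prod[of _ n]) auto
  finally show ?thesis .
qed

lemma scalar_prod_self_sum: "(x :: real vec) \<in> carrier_vec n \<Longrightarrow> x \<bullet> x = (\<Sum>i<n. (x $ i)\<^sup>2)"
  by (auto simp: scalar_prod_def atLeast0LessThan power2_eq_square)

lemma scalar_prod_self_nonneg: "(x :: real vec) \<bullet> x \<ge> 0"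
  by (auto simp: scalar_prod_def intro: sum_nonneg)

lemma scalar_prod_self_pos:
  assumes "(x :: real vec) \<in> carrier_vec n" "x \<noteq> 0\<^sub>v n"
  shows "x \<bullet> x > 0"
proof -
  from assms obtain i where i: "i < n" "x $ i \<noteq> 0" by (auto simp: vec_eq_iff)
  then have "0 < (x $ i)\<^sup>2" by simp
  also have "\<dots> \<le> (\<Sum>i<n. (x $ i)\<^sup>2)" using i by (intro member_le_sum) auto
  finally show ?thesis using scalar_prod_self_sum[OF assms(1)] by simp
qed

text \<open>A quadratic in \<open>t\<close> that vanishes at 0 and is nonnegative everywhere has
  derivative 0 there. The denominator \<open>\<bar>b\<bar> + 1\<close> of the test value avoids a
  case split on \<open>b\<close>.\<close>

lemma linear_coeff_eq_0:
  fixes a b :: real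
  assumes "\<And>t. 0 \<le> 2 * t * a + t\<^sup>2 * b"
  shows "a = 0"
proof (rule ccontr)
  assume a: "a \<noteq> 0"
  define t where "t = - a / (\<bar>b\<bar> + 1)"
  have "2 * t * a + t\<^sup>2 * b \<le> 2 * t * a + t\<^sup>2 * (\<bar>b\<bar> + 1)"
    by (intro add_left_mono mult_left_mono) auto
  also have "t\<^sup>2 * (\<bar>b\<bar> + 1) = - t * a"
  proof -
    have "t * (\<bar>b\<bar> + 1) = - a" by (simp add: t_def)
    then show ?thesis by (simp add: power2_eq_square mult.assoc)
  qed
  also have "2 * t * a + - t * a = - (a\<^sup>2 / (\<bar>b\<bar> + 1))" by (simp add: t_def power2_eq_square)
  also have "\<dots> < 0" using a by simp
  finally show False using assms[of t] by linarith
qed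

text \<open>Compactness gives a minimiser of the Rayleigh quotient; its first variation vanishes, so it
  is an eigenvector.\<close>

lemma rayleigh_min_eigenvector:
  fixes S :: "real mat" and v :: "nat \<Rightarrow> real vec"
  assumes S: "S \<in> carrier_mat n n" "S\<^sup>T = S"
    and v: "\<And>c. c < j \<Longrightarrow> v c \<in> carrier_vec n" "\<And>c. c < j \<Longrightarrow> S *\<^sub>v v c = lam c \<cdot>\<^sub>v v c"
    and y0: "y0 \<in> carrier_vec n" "y0 \<noteq> 0\<^sub>v n" "\<And>c. c < j \<Longrightarrow> v c \<bullet> y0 = 0"
  shows "\<exists>x \<mu>. x \<in> carrier_vec n \<and> x \<bullet> x = 1 \<and> (\<forall>c<j. v c \<bullet> x = 0) \<and> S *\<^sub>v x = \<mu> \<cdot>\<^sub>v x \<and>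
    (\<forall>y\<in>carrier_vec n. (\<forall>c<j. v c \<bullet> y = 0) \<longrightarrow> \<mu> * (y \<bullet> y) \<le> y \<bullet> (S *\<^sub>v y))"
proof -
  \<comment> \<open>Vectors become functions that vanish from \<open>n\<close> on, so that this box
    is compact in the product topology; it contains the unit sphere.\<close>
  define K where "K = {f :: nat \<Rightarrow> real. \<forall>i. f i \<in> (if i < n then {-1..1} else {0})}"
  define q where "q = (\<lambda>f :: nat \<Rightarrow> real. \<Sum>i<n. \<Sum>k<n. S $$ (i, k) * f i * f k)"
  define K' where "K' = K \<inter> ({f. (\<Sum>i<n. (f i)\<^sup>2) = 1} \<inter> (\<Inter>c<j. {f. (\<Sum>i<n. v c $ i * f i) = 0}))"
  have cont: "continuous_on A (\<lambda>f :: nat \<Rightarrow> real. f i)" for A i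
    by (rule continuous_on_subset[OF continuous_on_product_coordinates]) simp
  have "closed {f :: nat \<Rightarrow> real. (\<Sum>i<n. (f i)\<^sup>2) = 1}"
    by (intro closed_Collect_eq continuous_intros cont)
  moreover have "closed {f :: nat \<Rightarrow> real. (\<Sum>i<n. v c $ i * f i) = 0}" for c
    by (intro closed_Collect_eq continuous_intros cont)
  moreover have "compact K" unfolding K_def by (intro compact_coordinatewise) auto
  ultimately have "compact K'" unfolding K'_def by (intro compact_Int_closed closed_Int closed_INT) auto
  moreover have "continuous_on K' q" unfolding q_def by (intro continuous_intros cont)
  moreover have norm: "\<exists>f\<in>K'. q f = (y \<bullet> (S *\<^sub>v y)) / (y \<bullet> y)"
    if y: "y \<in> carrier_vec n" "y \<noteq> 0\<^sub>v n" "\<And>c. c < j \<Longrightarrow> v c \<bullet> y = 0" for y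
  proof -
    define s where "s = sqrt (y \<bullet> y)"
    have s: "s > 0" "s\<^sup>2 = y \<bullet> y" using scalar_prod_self_pos[OF y(1,2)] by (auto simp: s_def)
    define f where "f = (\<lambda>i. if i < n then y $ i / s else 0)"
    have f1: "(\<Sum>i<n. (f i)\<^sup>2) = 1"
    proof -
      have "(\<Sum>i<n. (f i)\<^sup>2) = (\<Sum>i<n. (y $ i)\<^sup>2) / s\<^sup>2"
        by (simp add: f_def power_divide sum_divide_distrib)
      also have "\<dots> = s\<^sup>2 / s\<^sup>2" by (simp add: s(2) scalar_prod_self_sum[OF y(1)])
      finally show ?thesis using s(1) by simp
    qed
    have fb: "\<bar>f i\<bar> \<le> 1" if "i < n" for i
    proof -
      have "(f i)\<^sup>2 \<le> (\<Sum>i<n. (f i)\<^sup>2)" using that by (intro member_le_sum) auto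
      then show ?thesis by (simp add: f1 abs_square_le_1)
    qed
    have "f \<in> K" unfolding K_def
    proof (intro CollectI allI)
      fix i
      show "f i \<in> (if i < n then {-1..1} else {0})"
        using fb[of i] by (cases "i < n") (simp_all add: abs_le_iff, simp add: f_def)
    qed
    moreover have "(\<Sum>i<n. v c $ i * f i) = 0" if "c < j" for c
    proof -
      have "(\<Sum>i<n. v c $ i * f i) = (v c \<bullet> y) / s"
        using v(1)[OF that] y(1) by (auto simp: f_def scalar_prod_def atLeast0LessThan sum_divide_distrib intro!: sum.cong)
      then show ?thesis using y(3)[OF that] by simp
    qed
    ultimately have "f \<in> K'" using f1 by (simp add: K'_def)
    moreover have "q f = (y \<bullet> (S *\<^sub>v y)) / (y \<bullet> y)"
      unfolding q_def scalar_prod_mult_mat_vec_sum[OF S(1) y(1) y(1)] s(2)[symmetric]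
      by (simp add: f_def sum_divide_distrib power2_eq_square)
    ultimately show ?thesis by blast
  qed
  moreover have "K' \<noteq> {}" using norm[OF y0] by blast
  ultimately obtain f where f: "f \<in> K'" "\<And>g. g \<in> K' \<Longrightarrow> q f \<le> q g"
    using continuous_attains_inf[of K' q] by blast
  define x where "x = vec n f"
  have x: "x \<in> carrier_vec n" by (simp add: x_def)
  have xx: "x \<bullet> x = 1" using f(1) by (simp add: scalar_prod_self_sum[OF x] K'_def) (simp add: x_def)
  have vx: "v c \<bullet> x = 0" if "c < j" for c
  proof -
    have "v c \<bullet> x = (\<Sum>i<n. v c $ i * f i)" using x by (auto simp: scalar_prod_def atLeast0LessThan x_def)
    then show ?thesis using f(1) that by (auto simp: K'_def)
  qed
  define \<mu> where "\<mu> = q f"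
  have qx: "x \<bullet> (S *\<^sub>v x) = \<mu>" unfolding scalar_prod_mult_mat_vec_sum[OF S(1) x x] \<mu>_def q_def by (simp add: x_def)
  have min: "\<mu> * (y \<bullet> y) \<le> y \<bullet> (S *\<^sub>v y)"
    if y: "y \<in> carrier_vec n" "\<And>c. c < j \<Longrightarrow> v c \<bullet> y = 0" for y
  proof (cases "y = 0\<^sub>v n")
    case True
    then show ?thesis using S by simp
  next
    case False
    have "\<mu> \<le> (y \<bullet> (S *\<^sub>v y)) / (y \<bullet> y)" using norm[OF y(1) False y(2)] f(2) unfolding \<mu>_def by metis
    then show ?thesis using scalar_prod_self_pos[OF y(1) False] by (simp add: field_simps)
  qed
  \<comment> \<open>The residual of the eigenvalue equation. It is orthogonal to all
    \<open>v c\<close>, because \<open>S\<close> is symmetric and each \<open>v c\<close> is an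
    eigenvector, so it is an admissible direction itself. The first variation along it is twice its
    squared norm, which forces it to vanish.\<close>
  define z where "z = S *\<^sub>v x - \<mu> \<cdot>\<^sub>v x"
  have z: "z \<in> carrier_vec n" using S x by (simp add: z_def)
  have Sx: "S *\<^sub>v x \<in> carrier_vec n" "S *\<^sub>v z \<in> carrier_vec n" using S x z by simp_all
  have vz: "v c \<bullet> z = 0" if c: "c < j" for c
  proof -
    have "v c \<bullet> (S *\<^sub>v x) = x \<bullet> (S *\<^sub>v v c)" by (rule scalar_prod_mult_mat_vec_symmetric[OF S v(1)[OF c] x])
    also have "\<dots> = lam c * (v c \<bullet> x)" using v[OF c] x comm_scalar_prod[OF x v(1)[OF c]] by simp
    finally show ?thesis using v(1)[OF c] x Sx vx[OF c] by (simp add: z_def scalar_prod_minus_distrib[of _ n])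
  qed
  have zz: "z \<bullet> z = z \<bullet> (S *\<^sub>v x) - \<mu> * (z \<bullet> x)"
  proof -
    have "z \<bullet> (S *\<^sub>v x - \<mu> \<cdot>\<^sub>v x) = z \<bullet> (S *\<^sub>v x) - \<mu> * (z \<bullet> x)"
      using z x Sx by (simp add: scalar_prod_minus_distrib[of _ n])
    then show ?thesis by (simp only: z_def[symmetric])
  qed
  have "z \<bullet> z = 0"
  proof (rule linear_coeff_eq_0)
    fix t
    have xz: "x + t \<cdot>\<^sub>v z \<in> carrier_vec n" using x z by simp
    have "\<mu> * ((x + t \<cdot>\<^sub>v z) \<bullet> (x + t \<cdot>\<^sub>v z)) \<le> (x + t \<cdot>\<^sub>v z) \<bullet> (S *\<^sub>v (x + t \<cdot>\<^sub>v z))"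
      using v(1) x z vx vz by (intro min xz) (simp add: scalar_prod_add_distrib[of _ n])
    also have "S *\<^sub>v (x + t \<cdot>\<^sub>v z) = S *\<^sub>v x + t \<cdot>\<^sub>v (S *\<^sub>v z)"
      using S x z by (simp add: mult_add_distrib_mat_vec[OF S(1)] mult_mat_vec[OF S(1)])
    also have "(x + t \<cdot>\<^sub>v z) \<bullet> (S *\<^sub>v x + t \<cdot>\<^sub>v (S *\<^sub>v z))
        = x \<bullet> (S *\<^sub>v x) + t * (x \<bullet> (S *\<^sub>v z)) + t * (z \<bullet> (S *\<^sub>v x)) + t * t * (z \<bullet> (S *\<^sub>v z))"
      using x z Sx by (simp add: scalar_prod_add_distrib[of _ n] add_scalar_prod_distrib[of _ n] algebra_simps)
    also have "x \<bullet> (S *\<^sub>v z) = z \<bullet> (S *\<^sub>v x)" by (rule scalar_prod_mult_mat_vec_symmetric[OF S x z])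
    also have "(x + t \<cdot>\<^sub>v z) \<bullet> (x + t \<cdot>\<^sub>v z) = x \<bullet> x + 2 * t * (z \<bullet> x) + t * t * (z \<bullet> z)"
      using x z comm_scalar_prod[OF x z] by (simp add: scalar_prod_add_distrib[of _ n] add_scalar_prod_distrib[of _ n] algebra_simps)
    finally show "0 \<le> 2 * t * (z \<bullet> z) + t\<^sup>2 * (z \<bullet> (S *\<^sub>v z) - \<mu> * (z \<bullet> z))"
      by (subst zz) (simp add: qx xx power2_eq_square algebra_simps)
  qed
  then have "z = 0\<^sub>v n" using scalar_prod_self_pos[OF z] by fastforce
  then have "S *\<^sub>v x = \<mu> \<cdot>\<^sub>v x" using S(1) x by (auto simp: z_def vec_eq_iff)
  then show ?thesis using x xx vx min by blast
qed

text \<open>With row \<open>i\<close> replaced by zero the matrix of the \<open>w c\<close> is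
  singular, and a kernel vector satisfies the other \<open>n - 1\<close> conditions.\<close>

lemma exists_orthogonal_vec:
  fixes w :: "nat \<Rightarrow> real vec"
  assumes i: "i < n" and w: "\<And>c. c < n \<Longrightarrow> w c \<in> carrier_vec n"
  shows "\<exists>y. y \<in> carrier_vec n \<and> y \<noteq> 0\<^sub>v n \<and> (\<forall>c<n. c \<noteq> i \<longrightarrow> w c \<bullet> y = 0)"
proof -
  let ?A = "mat\<^sub>r n n (\<lambda>c. if c = i then 0\<^sub>v n else w c)"
  have A: "?A \<in> carrier_mat n n" by simp
  have "det ?A = 0" using i w by (intro det_row_0) auto
  then obtain y where y: "y \<in> carrier_vec n" "y \<noteq> 0\<^sub>v n" "?A *\<^sub>v y = 0\<^sub>v n"
    using det_0_iff_vec_prod_zero[OF A] by blast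
  have "w c \<bullet> y = 0" if c: "c < n" "c \<noteq> i" for c
  proof -
    have "(?A *\<^sub>v y) $ c = row ?A c \<bullet> y" using c A by simp
    moreover have "row ?A c = w c" using c w[OF c(1)] by (intro eq_vecI) auto
    ultimately show ?thesis using y(3) c by simp
  qed
  then show ?thesis using y by blast
qed

text \<open>The minimiser of the Rayleigh quotient on the orthogonal complement of the eigenvectors
  found so far is the next eigenvector.\<close>

lemma orthonormal_eigenbasis:
  fixes S :: "real mat"
  assumes S: "S \<in> carrier_mat n n" "S\<^sup>T = S" and "j \<le> n"
  shows "\<exists>v lam. (\<forall>a<j. v a \<in> carrier_vec n \<and> S *\<^sub>v v a = lam a \<cdot>\<^sub>v v a) \<and>
     (\<forall>a<j. \<forall>b<j. v a \<bullet> v b = (if a = b then 1 else 0))"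
  using \<open>j \<le> n\<close>
proof (induction j)
  case (Suc j)
  then obtain v lam where v: "\<And>a. a < j \<Longrightarrow> v a \<in> carrier_vec n" "\<And>a. a < j \<Longrightarrow> S *\<^sub>v v a = lam a \<cdot>\<^sub>v v a"
     "\<And>a b. a < j \<Longrightarrow> b < j \<Longrightarrow> v a \<bullet> v b = (if a = b then 1 else 0)" by (metis Suc_leD)
  have "j < n" using Suc.prems by simp
  \<comment> \<open>Zero vectors pad the list to length \<open>n\<close>, and index \<open>j\<close>
    is the slot left free.\<close>
  have w: "(if c < j then v c else 0\<^sub>v n) \<in> carrier_vec n" if "c < n" for c using v(1) by simp
  from exists_orthogonal_vec[OF \<open>j < n\<close>, of "\<lambda>c. if c < j then v c else 0\<^sub>v n", OF w] obtain y where y: "y \<in> carrier_vec n" "y \<noteq> 0\<^sub>v n"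
     "\<And>c. c < n \<Longrightarrow> c \<noteq> j \<Longrightarrow> (if c < j then v c else 0\<^sub>v n) \<bullet> y = 0"
    by blast
  have y': "v c \<bullet> y = 0" if "c < j" for c using y(3)[of c] that Suc.prems by simp
  obtain x \<mu> where x: "x \<in> carrier_vec n" "x \<bullet> x = 1" "\<And>c. c < j \<Longrightarrow> v c \<bullet> x = 0" "S *\<^sub>v x = \<mu> \<cdot>\<^sub>v x"
    using rayleigh_min_eigenvector[of S n j v lam y, OF S v(1,2) y(1,2) y'] by blast
  have x': "x \<bullet> v c = 0" if "c < j" for c using x(3)[OF that] comm_scalar_prod[OF x(1) v(1)[OF that]] by simp
  show ?case
    by (rule exI[of _ "v(j := x)"], rule exI[of _ "lam(j := \<mu>)"])
       (use v x x' in \<open>auto simp: less_Suc_eq\<close>)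
qed auto

lemma eigen_col:
  fixes M V :: "real mat"
  assumes "M \<in> carrier_mat n n" "V \<in> carrier_mat n m" "M * V = V * mat_diag m lam" "c < m"
  shows "M *\<^sub>v col V c = lam c \<cdot>\<^sub>v col V c"
proof -
  have "M *\<^sub>v col V c = col (M * V) c" by (rule col_mult2[OF assms(1,2,4), symmetric])
  also have "\<dots> = lam c \<cdot>\<^sub>v col V c"
    unfolding assms(3) using assms(2,4) by (intro eq_vecI) (auto simp: mat_diag_mult_right[of _ n m])
  finally show ?thesis .
qed

lemma orthonormal_cols:
  fixes V :: "real mat"
  assumes "V \<in> carrier_mat n m" "V\<^sup>T * V = 1\<^sub>m m" "a < m" "b < m"
  shows "col V a \<bullet> col V b = (if a = b then 1 else 0)"
proof -
  have "(V\<^sup>T * V) $$ (a, b) = col V a \<bullet> col V b" using assms(1,3,4) by simp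
  then show ?thesis using assms by simp
qed

lemma spectral_theorem:
  fixes S :: "real mat"
  assumes S: "S \<in> carrier_mat n n" "S\<^sup>T = S"
  obtains F lam where "F \<in> carrier_mat n n" "F\<^sup>T * F = 1\<^sub>m n" "F * F\<^sup>T = 1\<^sub>m n"
    "S * F = F * mat_diag n lam"
proof -
  obtain v lam where v: "\<And>a. a < n \<Longrightarrow> v a \<in> carrier_vec n" "\<And>a. a < n \<Longrightarrow> S *\<^sub>v v a = lam a \<cdot>\<^sub>v v a"
     "\<And>a b. a < n \<Longrightarrow> b < n \<Longrightarrow> v a \<bullet> v b = (if a = b then 1 else 0)"
    using orthonormal_eigenbasis[OF S order_refl] by metis
  define F where "F = mat n n (\<lambda>(i, c). v c $ i)"
  have F: "F \<in> carrier_mat n n" by (simp add: F_def)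
  have cF: "col F c = v c" if "c < n" for c using v(1)[OF that] that by (intro eq_vecI) (auto simp: F_def)
  have "F\<^sup>T * F = 1\<^sub>m n"
    using F by (intro eq_matI) (auto simp: cF v(3))
  moreover have "F * F\<^sup>T = 1\<^sub>m n"
    by (rule mat_mult_left_right_inverse[OF _ F calculation]) (use F in simp)
  moreover have "S * F = F * mat_diag n lam"
  proof (rule eq_matI)
    fix i c assume "i < dim_row (F * mat_diag n lam)" "c < dim_col (F * mat_diag n lam)"
    then have ic: "i < n" "c < n" using F by (auto simp: mat_diag_def)
    have "(S * F) $$ (i, c) = (S *\<^sub>v v c) $ i" using ic S F by (simp add: cF)
    also have "\<dots> = (F * mat_diag n lam) $$ (i, c)"
      using ic F v(1)[OF ic(2)] by (simp add: v(2) mat_diag_mult_right[of _ n n]) (simp add: F_def)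
    finally show "(S * F) $$ (i, c) = (F * mat_diag n lam) $$ (i, c)" .
  qed (use S F in \<open>auto simp: mat_diag_def\<close>)
  ultimately show ?thesis using that F by blast
qed

text \<open>Turns the definition, which only compares eigenvalues, into a variational inequality.
  Since \<open>x\<close> may have a component along \<open>col V i\<close>, only
  \<open>m - 1\<close> conditions are imposed on it, so every \<open>m\<close>-dimensional subspace
  contains a nonzero test vector for \<open>lam i\<close>. Thus the eigenvalues can be bounded one
  by one without being sorted.\<close>

lemma bottom_eigvecs_rayleigh:
  assumes b: "bottom_eigvecs M m V" and M: "M \<in> carrier_mat n n" "M\<^sup>T = M"
  obtains lam where "M * V = V * mat_diag m lam"
    "\<forall>i<m. \<forall>x\<in>carrier_vec n. (\<forall>c<m. c \<noteq> i \<longrightarrow> col V c \<bullet> x = 0) \<longrightarrow>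
       lam i * (x \<bullet> x) \<le> x \<bullet> (M *\<^sub>v x)"
proof -
  obtain lam where V: "V \<in> carrier_mat n m" "V\<^sup>T * V = 1\<^sub>m m" "M * V = V * mat_diag m lam"
    and opt: "\<And>\<mu> v i. eigenvector M v \<mu> \<Longrightarrow> (\<And>i. i < m \<Longrightarrow> col V i \<bullet> v = 0) \<Longrightarrow> i < m \<Longrightarrow> lam i \<le> \<mu>"
    using b M unfolding bottom_eigvecs_def by auto
  note ev = eigen_col[OF M(1) V(1,3)]
  have cV: "col V c \<in> carrier_vec n" for c using V(1) by auto
  have "lam i * (x \<bullet> x) \<le> x \<bullet> (M *\<^sub>v x)"
    if i: "i < m" and x: "x \<in> carrier_vec n" and orth: "\<And>c. c < m \<Longrightarrow> c \<noteq> i \<Longrightarrow> col V c \<bullet> x = 0" for i x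
  proof -
    let ?v = "col V i"
    define a where "a = ?v \<bullet> x"
    define y where "y = x - a \<cdot>\<^sub>v ?v"
    have y: "y \<in> carrier_vec n" using x cV by (simp add: y_def)
    have vy: "col V c \<bullet> y = 0" if "c < m" for c
      using orth[OF that] orthonormal_cols[OF V(1,2) that i] x cV
      by (cases "c = i") (auto simp: y_def a_def scalar_prod_minus_distrib[of _ n])
    \<comment> \<open>The cross terms of this splitting vanish on both sides of the claim, which
      reduces it to \<open>y\<close>, a vector orthogonal to all columns of
      \<open>V\<close>.\<close>
    have xy: "x = y + a \<cdot>\<^sub>v ?v" using x V(1) by (intro eq_vecI) (auto simp: y_def)
    have yv: "y \<bullet> ?v = 0" using vy[OF i] comm_scalar_prod[OF y cV[of i]] by simp
    have vv: "?v \<bullet> ?v = 1" using orthonormal_cols[OF V(1,2) i i] by simp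
    have xx: "x \<bullet> x = y \<bullet> y + a\<^sup>2" unfolding xy
      using y cV[of i] by (simp add: scalar_prod_add_distrib[of _ n] add_scalar_prod_distrib[of _ n] yv vy[OF i] vv power2_eq_square)
    have My: "M *\<^sub>v y \<in> carrier_vec n" using M y by simp
    have vMy: "?v \<bullet> (M *\<^sub>v y) = 0"
      using scalar_prod_mult_mat_vec_symmetric[OF M cV[of i] y] y cV[of i] by (simp add: ev[OF i] yv)
    have "M *\<^sub>v x = M *\<^sub>v y + (a * lam i) \<cdot>\<^sub>v ?v" unfolding xy
      using y cV[of i] by (simp add: mult_add_distrib_mat_vec[OF M(1)] mult_mat_vec[OF M(1)] ev[OF i] smult_smult_assoc)
    then have xM: "x \<bullet> (M *\<^sub>v x) = y \<bullet> (M *\<^sub>v y) + a\<^sup>2 * lam i" unfolding xy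
      using y cV[of i] My by (simp add: scalar_prod_add_distrib[of _ n] add_scalar_prod_distrib[of _ n] yv vy[OF i] vv vMy power2_eq_square)
    have "lam i * (y \<bullet> y) \<le> y \<bullet> (M *\<^sub>v y)"
    proof (cases "y = 0\<^sub>v n")
      case True
      then show ?thesis using M by simp
    next
      case False
      \<comment> \<open>The minimum of the Rayleigh quotient on the complement of \<open>V\<close>
        is an eigenvalue with an eigenvector in that complement, so the definition of
        \<open>bottom_eigvecs\<close> applies to it.\<close>
      obtain w \<mu> where w: "w \<in> carrier_vec n" "w \<bullet> w = 1" "\<forall>c<m. col V c \<bullet> w = 0" "M *\<^sub>v w = \<mu> \<cdot>\<^sub>v w"
          "\<forall>y\<in>carrier_vec n. (\<forall>c<m. col V c \<bullet> y = 0) \<longrightarrow> \<mu> * (y \<bullet> y) \<le> y \<bullet> (M *\<^sub>v y)"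
        using rayleigh_min_eigenvector[of M n m "col V" lam y, OF M cV ev y False vy] by blast
      have "w \<noteq> 0\<^sub>v n" using w(2) by auto
      then have "eigenvector M w \<mu>" using w M by (simp add: eigenvector_def)
      then have "lam i \<le> \<mu>" using opt w(3) i by blast
      then have "lam i * (y \<bullet> y) \<le> \<mu> * (y \<bullet> y)" using scalar_prod_self_nonneg by (rule mult_right_mono)
      also have "\<dots> \<le> y \<bullet> (M *\<^sub>v y)" using w(5) y vy by blast
      finally show ?thesis .
    qed
    then show ?thesis by (simp add: xM xx algebra_simps)
  qed
  with V(3) show ?thesis using that by blast
qed


section \<open>Diagonal quadratic forms and the polar decomposition\<close>

lemma scalar_prod_mat_diag:
  fixes a b :: "real vec"
  assumes "a \<in> carrier_vec m" "b \<in> carrier_vec m"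
  shows "a \<bullet> (mat_diag m f *\<^sub>v b) = (\<Sum>i<m. f i * a $ i * b $ i)"
  unfolding scalar_prod_mult_mat_vec_sum[OF mat_diag_dim assms]
  by (intro sum.cong refl) (simp add: mat_diag_def if_distrib[of "\<lambda>z. z * _ * _"] if_distrib[of "\<lambda>z. z * _"] cong: if_cong)

lemma mat_diag_mult_vec_index:
  fixes b :: "real vec"
  assumes "b \<in> carrier_vec m" "i < m"
  shows "(mat_diag m f *\<^sub>v b) $ i = f i * b $ i"
  using assms by (simp add: mat_diag_def scalar_prod_def if_distrib[of "\<lambda>z. z * _"] cong: if_cong)

lemma mult_mat_vec_scalar_prod:
  fixes A :: "real mat"
  assumes "A \<in> carrier_mat n m" "B \<in> carrier_mat n l" "x \<in> carrier_vec m" "y \<in> carrier_vec l"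
  shows "(A *\<^sub>v x) \<bullet> (B *\<^sub>v y) = x \<bullet> ((A\<^sup>T * B) *\<^sub>v y)"
proof -
  have "(A *\<^sub>v x) \<bullet> (B *\<^sub>v y) = ((A\<^sup>T)\<^sup>T *\<^sub>v x) \<bullet> (B *\<^sub>v y)" by simp
  also have "\<dots> = x \<bullet> (A\<^sup>T *\<^sub>v (B *\<^sub>v y))"
    using assms by (intro transpose_vec_mult_scalar[of _ m n]) auto
  also have "\<dots> = x \<bullet> ((A\<^sup>T * B) *\<^sub>v y)"
    using assms by (simp add: assoc_mult_mat_vec[of _ m n _ l])
  finally show ?thesis .
qed

lemma isometry_scalar_prod:
  fixes A :: "real mat"
  assumes "A \<in> carrier_mat n m" "A\<^sup>T * A = 1\<^sub>m m" "x \<in> carrier_vec m" "y \<in> carrier_vec m"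
  shows "(A *\<^sub>v x) \<bullet> (A *\<^sub>v y) = x \<bullet> y"
  using mult_mat_vec_scalar_prod[OF assms(1,1,3,4)] assms by simp

text \<open>The orthogonal factor \<open>Q\<close> is the polar factor of \<open>K\<close>, diagonalised through
  \<open>K\<^sup>T K = 1 - G\<close>.\<close>

lemma polar_factor:
  fixes K G :: "real mat"
  assumes K: "K \<in> carrier_mat m m" and G: "G \<in> carrier_mat m m" "G\<^sup>T = G"
    and KG: "\<And>x y. x \<in> carrier_vec m \<Longrightarrow> y \<in> carrier_vec m \<Longrightarrow> (K *\<^sub>v x) \<bullet> (K *\<^sub>v y) = x \<bullet> y - x \<bullet> (G *\<^sub>v y)"
    and Gs: "\<And>x. x \<in> carrier_vec m \<Longrightarrow> 0 \<le> x \<bullet> (G *\<^sub>v x) \<and> x \<bullet> (G *\<^sub>v x) \<le> s * (x \<bullet> x)"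
    and s: "s < 1"
  obtains Q where "orth_mat m Q"
    "\<forall>x\<in>carrier_vec m. (K *\<^sub>v x - Q *\<^sub>v x) \<bullet> (K *\<^sub>v x - Q *\<^sub>v x) \<le> s\<^sup>2 * (x \<bullet> x)"
proof -
  obtain F g where F: "F \<in> carrier_mat m m" "F\<^sup>T * F = 1\<^sub>m m" "F * F\<^sup>T = 1\<^sub>m m"
      "G * F = F * mat_diag m g"
    by (rule spectral_theorem[OF G])
  have g: "0 \<le> g i" "g i \<le> s" if i: "i < m" for i
  proof -
    have c: "col F i \<in> carrier_vec m" using F(1) by auto
    have n1: "col F i \<bullet> col F i = 1" using orthonormal_cols[OF F(1,2) i i] by simp
    have "col F i \<bullet> (G *\<^sub>v col F i) = g i"
      unfolding eigen_col[OF G(1) F(1,4) i] using c n1 by simp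
    then show "0 \<le> g i" "g i \<le> s" using Gs[OF c] n1 by auto
  qed
  \<comment> \<open>Functional calculus: \<open>T c\<close> is \<open>K\<close> times the function
    of \<open>G\<close> with eigenvalues \<open>c i\<close>. The constant 1 would give back
    \<open>K\<close>.\<close>
  define T where "T = (\<lambda>c::nat \<Rightarrow> real. K * (F * (mat_diag m c * F\<^sup>T)))"
  have Tc: "T c \<in> carrier_mat m m" for c using K F(1) by (auto simp: T_def intro!: mult_carrier_mat mat_diag_dim)
  have Fx: "F\<^sup>T *\<^sub>v x \<in> carrier_vec m" if "x \<in> carrier_vec m" for x using F(1) that by simp
  have Dx: "mat_diag m c *\<^sub>v b \<in> carrier_vec m" for c :: "nat \<Rightarrow> real" and b
    by (rule carrier_vecI) (simp add: mat_diag_def)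
  have Tx: "T c *\<^sub>v x = K *\<^sub>v (F *\<^sub>v (mat_diag m c *\<^sub>v (F\<^sup>T *\<^sub>v x)))" if x: "x \<in> carrier_vec m" for c x
  proof -
    have D: "mat_diag m c \<in> carrier_mat m m" by (rule mat_diag_dim)
    have Ft: "F\<^sup>T \<in> carrier_mat m m" using F(1) by simp
    have DF: "mat_diag m c * F\<^sup>T \<in> carrier_mat m m" by (rule mult_carrier_mat[OF D Ft])
    have FDF: "F * (mat_diag m c * F\<^sup>T) \<in> carrier_mat m m" by (rule mult_carrier_mat[OF F(1) DF])
    show ?thesis unfolding T_def
      by (simp only: assoc_mult_mat_vec[OF K FDF x] assoc_mult_mat_vec[OF F(1) DF x] assoc_mult_mat_vec[OF D Ft x])
  qed
  have KF: "(K *\<^sub>v (F *\<^sub>v u)) \<bullet> (K *\<^sub>v (F *\<^sub>v w)) = (\<Sum>i<m. (1 - g i) * u $ i * w $ i)"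
    if u: "u \<in> carrier_vec m" and w: "w \<in> carrier_vec m" for u w
  proof -
    have Fu: "F *\<^sub>v u \<in> carrier_vec m" "F *\<^sub>v w \<in> carrier_vec m" using F(1) u w by auto
    have "G *\<^sub>v (F *\<^sub>v w) = (G * F) *\<^sub>v w" by (rule assoc_mult_mat_vec[OF G(1) F(1) w, symmetric])
    also have "\<dots> = F *\<^sub>v (mat_diag m g *\<^sub>v w)" unfolding F(4) by (rule assoc_mult_mat_vec[OF F(1) mat_diag_dim w])
    finally have "(F *\<^sub>v u) \<bullet> (G *\<^sub>v (F *\<^sub>v w)) = u \<bullet> (mat_diag m g *\<^sub>v w)"
      using isometry_scalar_prod[OF F(1,2) u Dx] by simp
    then have "(K *\<^sub>v (F *\<^sub>v u)) \<bullet> (K *\<^sub>v (F *\<^sub>v w)) = u \<bullet> w - u \<bullet> (mat_diag m g *\<^sub>v w)"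
      using KG[OF Fu] isometry_scalar_prod[OF F(1,2) u w] by simp
    also have "\<dots> = (\<Sum>i<m. (1 - g i) * u $ i * w $ i)"
      unfolding scalar_prod_mat_diag[OF u w]
      using w by (simp add: scalar_prod_def atLeast0LessThan sum_subtractf[symmetric] algebra_simps)
    finally show ?thesis .
  qed
  have FF: "F *\<^sub>v (F\<^sup>T *\<^sub>v x) = x" if x: "x \<in> carrier_vec m" for x
    using assoc_mult_mat_vec[of F m m "F\<^sup>T" m x] F x by simp
  let ?b = "\<lambda>x. F\<^sup>T *\<^sub>v x"
  have FFs: "(\<Sum>i<m. ?b x $ i * ?b y $ i) = x \<bullet> y"
    if x: "x \<in> carrier_vec m" and y: "y \<in> carrier_vec m" for x y
  proof -
    have "x \<bullet> y = (F *\<^sub>v ?b x) \<bullet> (F *\<^sub>v ?b y)" by (simp only: FF[OF x] FF[OF y])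
    also have "\<dots> = ?b x \<bullet> ?b y"
      by (rule isometry_scalar_prod[OF F(1,2) Fx[OF x] Fx[OF y]])
    also have "\<dots> = (\<Sum>i<m. ?b x $ i * ?b y $ i)"
      using F(1) unfolding scalar_prod_def by (simp add: atLeast0LessThan)
    finally show ?thesis ..
  qed
  \<comment> \<open>The eigenvalues of the inverse square root of \<open>K\<^sup>T * K\<close>;
    \<open>g i \<le> s < 1\<close> makes them well defined.\<close>
  define c where "c = (\<lambda>i. 1 / sqrt (1 - g i))"
  have c1: "(1 - g i) * (c i * c i) = 1" if "i < m" for i
  proof -
    have "0 < 1 - g i" using g(2)[OF that] s by linarith
    then show ?thesis by (simp add: c_def)
  qed
  define Q where "Q = T c"
  have Qc: "Q \<in> carrier_mat m m" using Tc by (simp add: Q_def)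
  have QQ: "(Q *\<^sub>v x) \<bullet> (Q *\<^sub>v y) = x \<bullet> y" if x: "x \<in> carrier_vec m" and y: "y \<in> carrier_vec m" for x y
  proof -
    have "(Q *\<^sub>v x) \<bullet> (Q *\<^sub>v y) = (\<Sum>i<m. (1 - g i) * (c i * ?b x $ i) * (c i * ?b y $ i))"
      unfolding Q_def Tx[OF x] Tx[OF y] KF[OF Dx Dx]
      by (intro sum.cong refl) (simp add: mat_diag_mult_vec_index[OF Fx[OF x]] mat_diag_mult_vec_index[OF Fx[OF y]] del: index_mult_mat_vec)
    also have "\<dots> = (\<Sum>i<m. ((1 - g i) * (c i * c i)) * (?b x $ i * ?b y $ i))"
      by (intro sum.cong refl) (simp only: mult_ac)
    also have "\<dots> = (\<Sum>i<m. ?b x $ i * ?b y $ i)"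
      by (intro sum.cong refl) (simp add: c1 del: index_mult_mat_vec)
    also have "\<dots> = x \<bullet> y" by (rule FFs[OF x y])
    finally show ?thesis .
  qed
  have "orth_mat m Q" unfolding orth_mat_def
  proof (intro conjI Qc eq_matI)
    fix i j assume "i < dim_row (1\<^sub>m m)" "j < dim_col (1\<^sub>m m)"
    then have ij: "i < m" "j < m" by auto
    have "Q *\<^sub>v unit_vec m j = col Q j" if "j < m" for j using Qc that by (intro eq_vecI) auto
    then have "(Q\<^sup>T * Q) $$ (i, j) = (Q *\<^sub>v unit_vec m i) \<bullet> (Q *\<^sub>v unit_vec m j)"
      using Qc ij by simp
    also have "\<dots> = unit_vec m i \<bullet> unit_vec m j" by (rule QQ) auto
    also have "\<dots> = 1\<^sub>m m $$ (i, j)" using ij by simp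
    finally show "(Q\<^sup>T * Q) $$ (i, j) = 1\<^sub>m m $$ (i, j)" .
  qed (use Qc in auto)
  moreover have "(K *\<^sub>v x - Q *\<^sub>v x) \<bullet> (K *\<^sub>v x - Q *\<^sub>v x) \<le> s\<^sup>2 * (x \<bullet> x)" if x: "x \<in> carrier_vec m" for x
  proof -
    let ?e = "\<lambda>i. 1 - c i"
    have "K *\<^sub>v x - Q *\<^sub>v x = K *\<^sub>v (F *\<^sub>v ?b x) - K *\<^sub>v (F *\<^sub>v (mat_diag m c *\<^sub>v ?b x))"
      unfolding Q_def Tx[OF x] FF[OF x] ..
    also have "\<dots> = K *\<^sub>v (F *\<^sub>v ?b x - F *\<^sub>v (mat_diag m c *\<^sub>v ?b x))"
      by (rule mult_minus_distrib_mat_vec[OF K, symmetric]) (use F(1) Fx[OF x] Dx in auto)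
    also have "F *\<^sub>v ?b x - F *\<^sub>v (mat_diag m c *\<^sub>v ?b x) = F *\<^sub>v (?b x - mat_diag m c *\<^sub>v ?b x)"
      by (rule mult_minus_distrib_mat_vec[OF F(1) Fx[OF x] Dx, symmetric])
    also have "?b x - mat_diag m c *\<^sub>v ?b x = mat_diag m ?e *\<^sub>v ?b x"
    proof (rule eq_vecI)
      fix i assume "i < dim_vec (mat_diag m ?e *\<^sub>v ?b x)"
      then have i: "i < m" by (simp add: mat_diag_def)
      have "(?b x - mat_diag m c *\<^sub>v ?b x) $ i = ?b x $ i - (mat_diag m c *\<^sub>v ?b x) $ i"
        using i by (intro index_minus_vec) (simp add: mat_diag_def)
      then show "(?b x - mat_diag m c *\<^sub>v ?b x) $ i = (mat_diag m ?e *\<^sub>v ?b x) $ i"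
        unfolding mat_diag_mult_vec_index[OF Fx[OF x] i] by (simp add: algebra_simps del: index_mult_mat_vec)
    qed (simp add: mat_diag_def)
    finally have "(K *\<^sub>v x - Q *\<^sub>v x) \<bullet> (K *\<^sub>v x - Q *\<^sub>v x)
        = (\<Sum>i<m. (1 - g i) * (mat_diag m ?e *\<^sub>v ?b x) $ i * (mat_diag m ?e *\<^sub>v ?b x) $ i)"
      using KF[OF Dx Dx] by simp
    also have "\<dots> \<le> (\<Sum>i<m. s\<^sup>2 * (?b x $ i * ?b x $ i))"
    proof (rule sum_mono)
      fix i assume "i \<in> {..<m}"
      then have i: "i < m" by simp
      \<comment> \<open>A singular value of \<open>K\<close>. The distance from \<open>K\<close> to
        \<open>Q\<close> in this direction is \<open>1 - r\<close>, which is at most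
        \<open>1 - r^2 = g i \<le> s\<close>.\<close>
      define r where "r = sqrt (1 - g i)"
      have r: "0 < r" "r\<^sup>2 = 1 - g i" using g[OF i] s by (auto simp: r_def)
      have r1: "r \<le> 1" using g[OF i] by (simp add: r_def)
      have "(1 - g i) * (?e i * ?e i) = (1 - r)\<^sup>2"
        unfolding r(2)[symmetric] c_def r_def[symmetric] using r(1) by (simp add: power2_eq_square field_simps)
      also have "\<dots> \<le> s\<^sup>2"
      proof (rule power_mono)
        have "r * r \<le> r * 1" using r r1 by (intro mult_left_mono) auto
        then show "1 - r \<le> s" using r(2) g(2)[OF i] by (simp add: power2_eq_square)
      qed (use r1 in simp)
      finally have "(1 - g i) * (?e i * ?e i) * (?b x $ i * ?b x $ i) \<le> s\<^sup>2 * (?b x $ i * ?b x $ i)"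
        by (rule mult_right_mono) simp
      then show "(1 - g i) * (mat_diag m ?e *\<^sub>v ?b x) $ i * (mat_diag m ?e *\<^sub>v ?b x) $ i \<le> s\<^sup>2 * (?b x $ i * ?b x $ i)"
        unfolding mat_diag_mult_vec_index[OF Fx[OF x] i] by (simp only: mult_ac)
    qed
    also have "\<dots> = s\<^sup>2 * (x \<bullet> x)" unfolding sum_distrib_left[symmetric] FFs[OF x x] ..
    finally show ?thesis .
  qed
  ultimately show ?thesis using that by blast
qed

section \<open>The Davis-Kahan theorem\<close>

lemma op_norm_le:
  assumes M: "M \<in> carrier_mat n m" and b: "0 \<le> b"
    and le: "\<And>a. a \<in> carrier_vec m \<Longrightarrow> (M *\<^sub>v a) \<bullet> (M *\<^sub>v a) \<le> b\<^sup>2 * (a \<bullet> a)"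
  shows "op_norm M \<le> b"
  unfolding op_norm_def
proof (rule cSup_least)
  have "0\<^sub>v m \<in> carrier_vec (dim_col M)" "0\<^sub>v m \<bullet> (0\<^sub>v m :: real vec) \<le> 1" using M by auto
  then show "{sqrt ((M *\<^sub>v v) \<bullet> (M *\<^sub>v v)) |v. v \<in> carrier_vec (dim_col M) \<and> v \<bullet> v \<le> 1} \<noteq> {}" by blast
next
  fix t assume "t \<in> {sqrt ((M *\<^sub>v v) \<bullet> (M *\<^sub>v v)) |v. v \<in> carrier_vec (dim_col M) \<and> v \<bullet> v \<le> 1}"
  then obtain v where t: "t = sqrt ((M *\<^sub>v v) \<bullet> (M *\<^sub>v v))" and v: "v \<in> carrier_vec m" "v \<bullet> v \<le> 1"
    using M by auto
  have "(M *\<^sub>v v) \<bullet> (M *\<^sub>v v) \<le> b\<^sup>2 * (v \<bullet> v)" by (rule le[OF v(1)])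
  also have "\<dots> \<le> b\<^sup>2" using v(2) by (simp add: mult_left_le)
  finally show "t \<le> b" unfolding t using b by (intro real_le_lsqrt) auto
qed

text \<open>Let \<open>s\<close> be the squared sine of the largest principal angle between the
  ranges of \<open>U\<close> and \<open>V\<close>. Test vectors in the range of \<open>U\<close> put
  each \<open>lam i\<close> below \<open>\<tau>1 + \<epsilon>\<close>, and comparing
  \<open>L\<close> with \<open>L0\<close> on the worst direction gives \<open>s * (\<tau>2 - \<tau>1
  - \<epsilon>) \<le> \<epsilon> * sqrt s\<close>, hence \<open>sqrt s \<le> \<sigma>\<close>. The
  factor \<open>sqrt 2\<close> comes from adding the sine part \<open>s\<close> and the polar part
  \<open>s^2 \<le> s\<close>.\<close>

lemma davis_kahan:
  fixes L L0 U V N :: "real mat"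
  assumes L: "L \<in> carrier_mat n n" "L\<^sup>T = L" and L0: "L0 \<in> carrier_mat n n"
    and U: "U \<in> carrier_mat n m" "U\<^sup>T * U = 1\<^sub>m m"
    and N: "N \<in> carrier_mat m m" "L0 * U = U * N" and m: "0 < m"
    and bot: "bottom_eigvecs L m V"
    and low: "\<And>a. a \<in> carrier_vec m \<Longrightarrow> (U *\<^sub>v a) \<bullet> (L0 *\<^sub>v (U *\<^sub>v a)) \<le> \<tau>1 * (a \<bullet> a)"
    and high: "\<And>y. y \<in> carrier_vec n \<Longrightarrow> U\<^sup>T *\<^sub>v y = 0\<^sub>v m \<Longrightarrow> \<tau>2 * (y \<bullet> y) \<le> y \<bullet> (L0 *\<^sub>v y)"
    and err: "\<And>x y. x \<in> carrier_vec n \<Longrightarrow> y \<in> carrier_vec n \<Longrightarrow>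
        \<bar>x \<bullet> (L *\<^sub>v y) - x \<bullet> (L0 *\<^sub>v y)\<bar> \<le> \<epsilon> * sqrt (x \<bullet> x) * sqrt (y \<bullet> y)"
    and gap: "0 < \<tau>2 - \<tau>1 - \<epsilon>" "\<epsilon> \<le> \<sigma> * (\<tau>2 - \<tau>1 - \<epsilon>)" and \<sigma>: "0 \<le> \<sigma>" "\<sigma> < 1"
  shows "\<exists>Q. orth_mat m Q \<and> op_norm (V - U * Q) \<le> sqrt 2 * \<sigma>"
proof -
  obtain lam where LV: "L * V = V * mat_diag m lam"
    and lam: "\<forall>i<m. \<forall>x\<in>carrier_vec n. (\<forall>c<m. c \<noteq> i \<longrightarrow> col V c \<bullet> x = 0) \<longrightarrow>
       lam i * (x \<bullet> x) \<le> x \<bullet> (L *\<^sub>v x)"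
    by (rule bottom_eigvecs_rayleigh[OF bot L])
  have V: "V \<in> carrier_mat n m" "V\<^sup>T * V = 1\<^sub>m m"
    using bot L(1) by (auto simp: bottom_eigvecs_def)
  have Ut: "U\<^sup>T \<in> carrier_mat m n" using U by simp
  have Ua: "U *\<^sub>v a \<in> carrier_vec n" if "a \<in> carrier_vec m" for a using U that by simp
  have Uiso: "(U *\<^sub>v a) \<bullet> (U *\<^sub>v b) = a \<bullet> b" if "a \<in> carrier_vec m" "b \<in> carrier_vec m" for a b
    using isometry_scalar_prod[OF U that] .
  have lam_le: "lam i \<le> \<tau>1 + \<epsilon>" if i: "i < m" for i
  proof -
    have w: "U\<^sup>T *\<^sub>v col V c \<in> carrier_vec m" if "c < m" for c
      using V(1) by (intro mult_mat_vec_carrier[OF Ut]) auto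
    obtain a where a: "a \<in> carrier_vec m" "a \<noteq> 0\<^sub>v m" "\<forall>c<m. c \<noteq> i \<longrightarrow> (U\<^sup>T *\<^sub>v col V c) \<bullet> a = 0"
      using exists_orthogonal_vec[of i m "\<lambda>c. U\<^sup>T *\<^sub>v col V c", OF i w] by blast
    let ?x = "U *\<^sub>v a"
    have x: "?x \<in> carrier_vec n" by (rule Ua[OF a(1)])
    have "col V c \<bullet> ?x = 0" if "c < m" "c \<noteq> i" for c
    proof -
      have "col V c \<bullet> ?x = (U\<^sup>T *\<^sub>v col V c) \<bullet> a"
        using V(1) by (intro transpose_vec_mult_scalar[symmetric, OF U(1) a(1)]) auto
      then show ?thesis using a(3) that by simp
    qed
    then have "lam i * (?x \<bullet> ?x) \<le> ?x \<bullet> (L *\<^sub>v ?x)" using lam i x by blast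
    also have "\<dots> \<le> ?x \<bullet> (L0 *\<^sub>v ?x) + \<epsilon> * sqrt (?x \<bullet> ?x) * sqrt (?x \<bullet> ?x)"
      using err[OF x x] by linarith
    also have "\<dots> \<le> (\<tau>1 + \<epsilon>) * (a \<bullet> a)"
      using low[OF a(1)] scalar_prod_self_nonneg[of a] by (simp add: Uiso[OF a(1) a(1)] algebra_simps)
    finally have "lam i * (a \<bullet> a) \<le> (\<tau>1 + \<epsilon>) * (a \<bullet> a)" by (simp add: Uiso[OF a(1) a(1)])
    then show ?thesis using scalar_prod_self_pos[OF a(1,2)] by simp
  qed
  define K where "K = U\<^sup>T * V"
  have K: "K \<in> carrier_mat m m" using U V by (simp add: K_def)
  \<comment> \<open>The singular values of \<open>K\<close> are the cosines, those of
    \<open>Z\<close> the sines of the principal angles.\<close>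
  define Z where "Z = V - U * K"
  have UK: "U * K \<in> carrier_mat n m" using U K by simp
  have Z: "Z \<in> carrier_mat n m" unfolding Z_def by (rule minus_carrier_mat[OF UK])
  have Za: "Z *\<^sub>v a \<in> carrier_vec n" if "a \<in> carrier_vec m" for a using Z that by simp
  have Ka: "K *\<^sub>v a \<in> carrier_vec m" if "a \<in> carrier_vec m" for a using K that by simp
  have Zv: "Z *\<^sub>v a = V *\<^sub>v a - U *\<^sub>v (K *\<^sub>v a)" if a: "a \<in> carrier_vec m" for a
    unfolding Z_def using minus_mult_distrib_mat_vec[OF V(1) UK a] assoc_mult_mat_vec[OF U(1) K a] by simp
  have Vv: "V *\<^sub>v a = Z *\<^sub>v a + U *\<^sub>v (K *\<^sub>v a)" if a: "a \<in> carrier_vec m" for a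
    unfolding Zv[OF a] using V(1) U(1) by (intro eq_vecI) auto
  have UZ: "U\<^sup>T *\<^sub>v (Z *\<^sub>v a) = 0\<^sub>v m" if a: "a \<in> carrier_vec m" for a
  proof -
    have Va: "V *\<^sub>v a \<in> carrier_vec n" using V a by simp
    have "U\<^sup>T *\<^sub>v (Z *\<^sub>v a) = U\<^sup>T *\<^sub>v (V *\<^sub>v a) - U\<^sup>T *\<^sub>v (U *\<^sub>v (K *\<^sub>v a))"
      unfolding Zv[OF a] by (rule mult_minus_distrib_mat_vec[OF Ut Va Ua[OF Ka[OF a]]])
    also have "U\<^sup>T *\<^sub>v (V *\<^sub>v a) = K *\<^sub>v a"
      unfolding K_def by (rule assoc_mult_mat_vec[OF Ut V(1) a, symmetric])
    also have "U\<^sup>T *\<^sub>v (U *\<^sub>v (K *\<^sub>v a)) = K *\<^sub>v a"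
      using assoc_mult_mat_vec[OF Ut U(1) Ka[OF a]] U(2) Ka[OF a] by simp
    finally show ?thesis using Ka[OF a] by simp
  qed
  have ZU: "(Z *\<^sub>v a) \<bullet> (U *\<^sub>v b) = 0" if a: "a \<in> carrier_vec m" and b: "b \<in> carrier_vec m" for a b
    using transpose_vec_mult_scalar[OF U(1) b Za[OF a]] UZ[OF a] b by simp
  define G where "G = Z\<^sup>T * Z"
  have Zt: "Z\<^sup>T \<in> carrier_mat m n" using Z by simp
  have G: "G \<in> carrier_mat m m" "G\<^sup>T = G"
    using Z transpose_mult[OF Zt Z] by (auto simp: G_def)
  have ZG: "(Z *\<^sub>v a) \<bullet> (Z *\<^sub>v b) = a \<bullet> (G *\<^sub>v b)" if "a \<in> carrier_vec m" "b \<in> carrier_vec m" for a b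
    unfolding G_def by (rule mult_mat_vec_scalar_prod[OF Z Z that])
  have "(- G)\<^sup>T = - G" "- G \<in> carrier_mat m m" using G by (simp_all add: transpose_uminus)
  moreover have "unit_vec m 0 \<noteq> (0\<^sub>v m :: real vec)"
    using m by (metis index_unit_vec(2) index_zero_vec(1) zero_neq_one)
  \<comment> \<open>Minimising the form of \<open>- G\<close> without any orthogonality constraint
    (\<open>j = 0\<close>) yields a top eigenvector of \<open>G\<close>.\<close>
  ultimately obtain a \<mu> where a: "a \<in> carrier_vec m" "a \<bullet> a = 1" "(- G) *\<^sub>v a = \<mu> \<cdot>\<^sub>v a"
      "\<forall>y\<in>carrier_vec m. \<mu> * (y \<bullet> y) \<le> y \<bullet> ((- G) *\<^sub>v y)"
    using rayleigh_min_eigenvector[of "- G" m 0 "\<lambda>_. 0\<^sub>v m" "\<lambda>_. 0" "unit_vec m 0"] by auto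
  define s where "s = - \<mu>"
  have Gv: "G *\<^sub>v y \<in> carrier_vec m" if "y \<in> carrier_vec m" for y using G that by simp
  have nG: "(- G) *\<^sub>v y = - (G *\<^sub>v y)" if "y \<in> carrier_vec m" for y using G that by (intro uminus_mult_mat_vec) auto
  have Ga: "G *\<^sub>v a = s \<cdot>\<^sub>v a"
  proof (rule eq_vecI)
    fix i assume "i < dim_vec (s \<cdot>\<^sub>v a)"
    then have i: "i < m" using a by simp
    have "- ((G *\<^sub>v a) $ i) = (- (G *\<^sub>v a)) $ i" using i G by (intro index_uminus_vec(1)[symmetric]) auto
    also have "\<dots> = \<mu> * a $ i" using a(3) nG[OF a(1)] i a(1) by simp
    finally show "(G *\<^sub>v a) $ i = (s \<cdot>\<^sub>v a) $ i" using i a(1) by (simp add: s_def del: index_mult_mat_vec)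
  qed (use G a in auto)
  have Gle: "y \<bullet> (G *\<^sub>v y) \<le> s * (y \<bullet> y)" if y: "y \<in> carrier_vec m" for y
  proof -
    have "\<mu> * (y \<bullet> y) \<le> y \<bullet> (- (G *\<^sub>v y))" using a(4) y nG[OF y] by metis
    also have "\<dots> = - (y \<bullet> (G *\<^sub>v y))" using y G by (intro scalar_prod_uminus_right) auto
    finally show ?thesis by (simp add: s_def)
  qed
  let ?y = "Z *\<^sub>v a"
  have y: "?y \<in> carrier_vec n" by (rule Za[OF a(1)])
  have yy: "?y \<bullet> ?y = s" unfolding ZG[OF a(1) a(1)] Ga using a by simp
  have s0: "0 \<le> s" using scalar_prod_self_nonneg[of ?y] yy by simp
  have Vac: "V *\<^sub>v a \<in> carrier_vec n" using V a by simp
  have Va1: "(V *\<^sub>v a) \<bullet> (V *\<^sub>v a) = 1" using isometry_scalar_prod[OF V a(1) a(1)] a(2) by simp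
  \<comment> \<open>Both bounds concern the pairing of \<open>Z *\<^sub>v a\<close> with the image
    of \<open>V *\<^sub>v a\<close>. For \<open>L\<close>, the relation
    \<open>G *\<^sub>v a = s \<cdot>\<^sub>v a\<close> reduces it to \<open>s\<close> times an
    average of the \<open>lam i\<close>. For \<open>L0\<close>, the invariant range of
    \<open>U\<close> drops out and the form of \<open>L0\<close> at \<open>Z *\<^sub>v a\<close>
    remains.\<close>
  have "s * \<tau>2 - \<epsilon> * sqrt s \<le> s * (\<tau>1 + \<epsilon>)"
  proof -
    let ?D = "mat_diag m lam *\<^sub>v a"
    have D: "?D \<in> carrier_vec m" by (rule carrier_vecI) (simp add: mat_diag_def)
    have "L *\<^sub>v (V *\<^sub>v a) = V *\<^sub>v ?D"
      using assoc_mult_mat_vec[OF L(1) V(1) a(1)] assoc_mult_mat_vec[OF V(1) mat_diag_dim a(1), of lam] LV by simp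
    then have "?y \<bullet> (L *\<^sub>v (V *\<^sub>v a)) = ?y \<bullet> (Z *\<^sub>v ?D) + ?y \<bullet> (U *\<^sub>v (K *\<^sub>v ?D))"
      using scalar_prod_add_distrib[OF y Za[OF D] Ua[OF Ka[OF D]]] Vv[OF D] by simp
    also have "?y \<bullet> (U *\<^sub>v (K *\<^sub>v ?D)) = 0" by (rule ZU[OF a(1) Ka[OF D]])
    also have "?y \<bullet> (Z *\<^sub>v ?D) = s * (a \<bullet> ?D)"
      unfolding ZG[OF a(1) D] scalar_prod_mult_mat_vec_symmetric[OF G a(1) D] Ga
      using a(1) D comm_scalar_prod[OF D a(1)] by simp
    also have "a \<bullet> ?D \<le> \<tau>1 + \<epsilon>"
    proof -
      have "a \<bullet> ?D = (\<Sum>i<m. lam i * (a $ i)\<^sup>2)"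
        unfolding scalar_prod_mat_diag[OF a(1) a(1)] by (simp add: power2_eq_square mult.assoc)
      also have "\<dots> \<le> (\<Sum>i<m. (\<tau>1 + \<epsilon>) * (a $ i)\<^sup>2)" by (intro sum_mono mult_right_mono lam_le) auto
      also have "\<dots> = (\<tau>1 + \<epsilon>) * (a \<bullet> a)" by (simp only: scalar_prod_self_sum[OF a(1)] sum_distrib_left)
      finally show ?thesis using a(2) by simp
    qed
    finally have up: "?y \<bullet> (L *\<^sub>v (V *\<^sub>v a)) \<le> s * (\<tau>1 + \<epsilon>)" using s0 by (simp add: mult_left_mono)
    have "L0 *\<^sub>v (U *\<^sub>v (K *\<^sub>v a)) = U *\<^sub>v (N *\<^sub>v (K *\<^sub>v a))"
      using assoc_mult_mat_vec[OF L0 U(1) Ka[OF a(1)]] assoc_mult_mat_vec[OF U(1) N(1) Ka[OF a(1)]] N(2) by simp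
    moreover have "N *\<^sub>v (K *\<^sub>v a) \<in> carrier_vec m" using N Ka[OF a(1)] by simp
    ultimately have z: "?y \<bullet> (L0 *\<^sub>v (U *\<^sub>v (K *\<^sub>v a))) = 0" using ZU[OF a(1)] by simp
    have "L0 *\<^sub>v (V *\<^sub>v a) = L0 *\<^sub>v ?y + L0 *\<^sub>v (U *\<^sub>v (K *\<^sub>v a))"
      unfolding Vv[OF a(1)] by (rule mult_add_distrib_mat_vec[OF L0 y Ua[OF Ka[OF a(1)]]])
    then have "?y \<bullet> (L0 *\<^sub>v (V *\<^sub>v a)) = ?y \<bullet> (L0 *\<^sub>v ?y) + ?y \<bullet> (L0 *\<^sub>v (U *\<^sub>v (K *\<^sub>v a)))"
      using scalar_prod_add_distrib[OF y mult_mat_vec_carrier[OF L0 y]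
        mult_mat_vec_carrier[OF L0 Ua[OF Ka[OF a(1)]]]] by simp
    then have "\<tau>2 * s \<le> ?y \<bullet> (L0 *\<^sub>v (V *\<^sub>v a))" using z high[OF y UZ[OF a(1)]] yy by simp
    moreover have "?y \<bullet> (L0 *\<^sub>v (V *\<^sub>v a)) - \<epsilon> * sqrt s \<le> ?y \<bullet> (L *\<^sub>v (V *\<^sub>v a))"
      using err[OF y Vac] unfolding yy Va1 by (simp add: abs_le_iff)
    ultimately show ?thesis using up by (simp add: mult.commute)
  qed
  then have "sqrt s * sqrt s * (\<tau>2 - \<tau>1 - \<epsilon>) \<le> sqrt s * \<epsilon>" using s0 by (simp add: algebra_simps)
  also have "\<dots> \<le> sqrt s * (\<sigma> * (\<tau>2 - \<tau>1 - \<epsilon>))" using gap s0 by (intro mult_left_mono) auto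
  finally have "sqrt s * (\<tau>2 - \<tau>1 - \<epsilon>) * sqrt s \<le> sqrt s * (\<tau>2 - \<tau>1 - \<epsilon>) * \<sigma>" by (simp only: mult_ac)
  then have ss: "sqrt s \<le> \<sigma>"
    using gap(1) s0 \<sigma>(1) by (cases "s = 0") auto
  then have "(sqrt s)\<^sup>2 \<le> \<sigma>\<^sup>2" using s0 by (intro power_mono) auto
  then have s\<sigma>: "s \<le> \<sigma>\<^sup>2" using s0 by simp
  have "\<sigma>\<^sup>2 < 1" using \<sigma> by (simp add: power_less_one_iff)
  then have s1: "s < 1" using s\<sigma> by linarith
  have KG: "(K *\<^sub>v x) \<bullet> (K *\<^sub>v z) = x \<bullet> z - x \<bullet> (G *\<^sub>v z)" if x: "x \<in> carrier_vec m" and z: "z \<in> carrier_vec m" for x z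
  proof -
    have "x \<bullet> z = (V *\<^sub>v x) \<bullet> (V *\<^sub>v z)" by (rule isometry_scalar_prod[OF V x z, symmetric])
    also have "\<dots> = (Z *\<^sub>v x) \<bullet> (Z *\<^sub>v z) + (Z *\<^sub>v x) \<bullet> (U *\<^sub>v (K *\<^sub>v z)) + ((U *\<^sub>v (K *\<^sub>v x)) \<bullet> (Z *\<^sub>v z) + (U *\<^sub>v (K *\<^sub>v x)) \<bullet> (U *\<^sub>v (K *\<^sub>v z)))"
      unfolding Vv[OF x] Vv[OF z]
      using Za[OF x] Za[OF z] Ua[OF Ka[OF x]] Ua[OF Ka[OF z]]
      by (simp add: scalar_prod_add_distrib[of _ n] add_scalar_prod_distrib[of _ n])
    also have "(U *\<^sub>v (K *\<^sub>v x)) \<bullet> (Z *\<^sub>v z) = (Z *\<^sub>v z) \<bullet> (U *\<^sub>v (K *\<^sub>v x))"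
      by (rule comm_scalar_prod[OF Ua[OF Ka[OF x]] Za[OF z]])
    finally show ?thesis using ZU[OF x Ka[OF z]] ZU[OF z Ka[OF x]] ZG[OF x z] Uiso[OF Ka[OF x] Ka[OF z]] by linarith
  qed
  have Gs: "0 \<le> x \<bullet> (G *\<^sub>v x) \<and> x \<bullet> (G *\<^sub>v x) \<le> s * (x \<bullet> x)" if x: "x \<in> carrier_vec m" for x
    using Gle[OF x] ZG[OF x x] scalar_prod_self_nonneg[of "Z *\<^sub>v x"] by simp
  obtain Q where Q: "orth_mat m Q"
    "\<forall>x\<in>carrier_vec m. (K *\<^sub>v x - Q *\<^sub>v x) \<bullet> (K *\<^sub>v x - Q *\<^sub>v x) \<le> s\<^sup>2 * (x \<bullet> x)"
    by (rule polar_factor[OF K G KG Gs s1])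
  have Qc: "Q \<in> carrier_mat m m" using Q(1) by (simp add: orth_mat_def)
  have UQ: "U * Q \<in> carrier_mat n m" using U Qc by simp
  have VUQ: "V - U * Q \<in> carrier_mat n m" by (rule minus_carrier_mat[OF UQ])
  have "op_norm (V - U * Q) \<le> sqrt 2 * \<sigma>"
  proof (rule op_norm_le[OF VUQ])
    fix x :: "real vec" assume x: "x \<in> carrier_vec m"
    let ?d = "K *\<^sub>v x - Q *\<^sub>v x"
    have Qx: "Q *\<^sub>v x \<in> carrier_vec m" using Qc x by simp
    have d: "?d \<in> carrier_vec m" using Ka[OF x] Qx by simp
    have "(V - U * Q) *\<^sub>v x = V *\<^sub>v x - U *\<^sub>v (Q *\<^sub>v x)"
      using minus_mult_distrib_mat_vec[OF V(1) UQ x] assoc_mult_mat_vec[OF U(1) Qc x] by simp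
    also have "\<dots> = Z *\<^sub>v x + (U *\<^sub>v (K *\<^sub>v x) - U *\<^sub>v (Q *\<^sub>v x))"
      unfolding Vv[OF x] using Za[OF x] Ua[OF Ka[OF x]] Ua[OF Qx] by (intro eq_vecI) auto
    also have "U *\<^sub>v (K *\<^sub>v x) - U *\<^sub>v (Q *\<^sub>v x) = U *\<^sub>v ?d"
      by (rule mult_minus_distrib_mat_vec[OF U(1) Ka[OF x] Qx, symmetric])
    finally have e: "(V - U * Q) *\<^sub>v x = Z *\<^sub>v x + U *\<^sub>v ?d" .
    have "((V - U * Q) *\<^sub>v x) \<bullet> ((V - U * Q) *\<^sub>v x)
        = (Z *\<^sub>v x) \<bullet> (Z *\<^sub>v x) + (Z *\<^sub>v x) \<bullet> (U *\<^sub>v ?d) + ((U *\<^sub>v ?d) \<bullet> (Z *\<^sub>v x) + (U *\<^sub>v ?d) \<bullet> (U *\<^sub>v ?d))"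
      unfolding e using Za[OF x] Ua[OF d]
      by (simp add: scalar_prod_add_distrib[of _ n] add_scalar_prod_distrib[of _ n])
    also have "(U *\<^sub>v ?d) \<bullet> (Z *\<^sub>v x) = (Z *\<^sub>v x) \<bullet> (U *\<^sub>v ?d)" by (rule comm_scalar_prod[OF Ua[OF d] Za[OF x]])
    finally have "((V - U * Q) *\<^sub>v x) \<bullet> ((V - U * Q) *\<^sub>v x) = x \<bullet> (G *\<^sub>v x) + ?d \<bullet> ?d"
      using ZU[OF x d] ZG[OF x x] Uiso[OF d d] by linarith
    also have "\<dots> \<le> s * (x \<bullet> x) + s\<^sup>2 * (x \<bullet> x)" using Gle[OF x] Q(2) x by (intro add_mono) auto
    also have "\<dots> = (s + s\<^sup>2) * (x \<bullet> x)" by (simp add: algebra_simps)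
    also have "\<dots> \<le> (sqrt 2 * \<sigma>)\<^sup>2 * (x \<bullet> x)"
    proof (rule mult_right_mono[OF _ scalar_prod_self_nonneg])
      have "s\<^sup>2 \<le> s" using s0 s1 by (simp add: power2_eq_square mult_left_le)
      then show "s + s\<^sup>2 \<le> (sqrt 2 * \<sigma>)\<^sup>2" using s\<sigma> by (simp add: power_mult_distrib)
    qed
    finally show "((V - U * Q) *\<^sub>v x) \<bullet> ((V - U * Q) *\<^sub>v x) \<le> (sqrt 2 * \<sigma>)\<^sup>2 * (x \<bullet> x)" .
  qed (use \<sigma> in simp)
  then show ?thesis using Q(1) by blast
qed

section \<open>Perturbation of the Laplacian\<close>

abbreviation nrm :: "nat \<Rightarrow> (nat \<Rightarrow> real) \<Rightarrow> real" where
  "nrm n x \<equiv> sqrt (nsq n x)"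

lemma nrm_eq_L2_set: "nrm n x = L2_set x {..<n}"
  by (simp add: nsq_def L2_set_def)

lemma sum_abs_mult_le_nrm: "(\<Sum>i<n. \<bar>x i\<bar> * \<bar>y i\<bar>) \<le> nrm n x * nrm n y"
  unfolding nrm_eq_L2_set by (rule L2_set_mult_ineq)

lemma sum_abs_le_nrm: "(\<Sum>i<n. \<bar>x i\<bar>) \<le> nrm n x * sqrt (real n)"
  using sum_abs_mult_le_nrm[where y = "\<lambda>_. 1"] by (simp add: nsq_def)

lemma nrm_mult_le:
  assumes "\<And>i. i < n \<Longrightarrow> \<bar>h i\<bar> \<le> c" "0 \<le> c"
  shows "nrm n (\<lambda>i. h i * x i) \<le> c * nrm n x"
proof -
  have "nsq n (\<lambda>i. h i * x i) \<le> c\<^sup>2 * nsq n x"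
    unfolding nsq_def sum_distrib_left
  proof (rule sum_mono)
    fix i assume "i \<in> {..<n}"
    then have "\<bar>h i\<bar> \<le> \<bar>c\<bar>" using assms by simp
    then have "(h i)\<^sup>2 \<le> c\<^sup>2" by (simp add: abs_le_square_iff)
    then show "(h i * x i)\<^sup>2 \<le> c\<^sup>2 * (x i)\<^sup>2" by (simp add: power_mult_distrib mult_right_mono)
  qed
  then have "nrm n (\<lambda>i. h i * x i) \<le> sqrt (c\<^sup>2 * nsq n x)" by simp
  then show ?thesis using assms(2) by (simp add: real_sqrt_mult)
qed

text \<open>Homogeneity, with the sign for the modulus absorbed into \<open>x\<close>. Vectors of
  norm 0 are treated apart, since normalising divides by the norm.\<close>

lemma abs_bil_le_nrm:
  assumes B: "\<And>x y. nsq n x \<le> 1 \<Longrightarrow> nsq n y \<le> 1 \<Longrightarrow> bil n w x y \<le> B"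
  shows "\<bar>bil n w x y\<bar> \<le> B * nrm n x * nrm n y"
proof -
  have zero: "x i = 0" if "nsq n x = 0" "i < n" for x i
    using that by (simp add: nsq_def sum_nonneg_eq_0_iff)
  show ?thesis
  proof (cases "nsq n x = 0 \<or> nsq n y = 0")
    case True
    then have "bil n w x y = 0" 
      unfolding bil_def by (intro sum.neutral ballI) (auto dest: zero)
    then show ?thesis using True by auto
  next
    case False
    then have pos: "0 < nrm n x" "0 < nrm n y" using nsq_nonneg[of n x] nsq_nonneg[of n y] by auto
    have le: "s * bil n w x y \<le> B * nrm n x * nrm n y" if s: "s\<^sup>2 = 1" for s
    proof -
      have "bil n w (\<lambda>i. (s / nrm n x) * x i) (\<lambda>i. (1 / nrm n y) * y i) \<le> B"
        using pos s nsq_nonneg[of n x] nsq_nonneg[of n y] by (intro B) (simp_all only: nsq_scale power_divide, auto)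
      then have "(s / nrm n x) * ((1 / nrm n y) * bil n w x y) \<le> B"
        unfolding bil_scale_left bil_scale_right .
      then show ?thesis using pos by (simp add: field_simps)
    qed
    show ?thesis using le[of 1] le[of "-1"] by (simp add: abs_le_iff)
  qed
qed

definition sgn_cl :: "(nat \<Rightarrow> nat) \<Rightarrow> nat \<Rightarrow> nat \<Rightarrow> real" where
  "sgn_cl cl i j = (if cl i = cl j then 1 else - 1)"

text \<open>The error has four parts, each a multiple of \<open>1 / q\<close>: the centred noise
  (640), the regularising constant \<open>g\<close> (2), the zero diagonal of a loop-free graph
  against the nonzero diagonal of the population matrix (2), and the errors of the normalising
  factors (1500).\<close>

lemma laplacian_perturbation_bound:
  fixes X :: "nat \<times> nat \<Rightarrow> real"
  assumes con: "concentrated n cl p \<eta> q X" and n: "n \<ge> 10" and p: "0 < p" "p \<le> 1" and \<eta>: "0 \<le> \<eta>" "\<eta> \<le> 1/2"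
    and q: "1 \<le> q" and d: "q^8 = p * (real n - 1)" and g: "\<bar>g\<bar> \<le> q^7 / real n"
  defines "D \<equiv> \<lambda>i. \<Sum>j<n. abs_adj X i j"
  defines "h \<equiv> \<lambda>i. 1 / sqrt (D i + q^7)"
  shows "\<bar>bil n (\<lambda>i j. h i * (symm X i j + g) * h j - p * (1 - 2 * \<eta>) / q^8 * sgn_cl cl i j) x y\<bar>
    \<le> 2500 / q * nrm n x * nrm n y"
proof -
  have q0: "q > 0" using q by simp
  have n0: "0 < real n" using n by simp
  define \<mu> where "\<mu> = (\<lambda>e. emean p \<eta> (cl (fst e) = cl (snd e)))"
  define W where "W = symm (\<lambda>e. X e - \<mu> e)"
  define W' where "W' = symm (\<lambda>e. \<bar>X e\<bar> - p)"
  \<comment> \<open>The ratio of the actual normalising factor to the population one,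
    \<open>1 / q^4\<close>. It is bounded uniformly, but shown close to 1 only in mean
    square.\<close>
  define t where "t = (\<lambda>i. q^4 * h i)"
  define P where "P = nrm n x * nrm n y"
  have P0: "0 \<le> P" by (simp add: P_def nsq_nonneg)
  have D: "\<bar>D i - q^8\<bar> \<le> q^8 / 2" if "i < n" for i
    using con that unfolding concentrated_def D_def by blast
  have W: "\<bar>bil n W a b\<bar> \<le> 320 * q^7 * nrm n a * nrm n b" for a b
    by (rule abs_bil_le_nrm) (use con in \<open>auto simp: concentrated_def W_def \<mu>_def\<close>)
  have W': "\<bar>bil n W' a b\<bar> \<le> 320 * q^7 * nrm n a * nrm n b" for a b
    by (rule abs_bil_le_nrm) (use con in \<open>auto simp: concentrated_def W'_def\<close>)
  have Dg: "q^8 / 2 \<le> D i + q^7" if "i < n" for i 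
    using D[OF that] zero_less_power[OF q0, of 7] by linarith
  have q8: "0 < q^8" using q0 by simp
  have Dpos: "0 < D i + q^7" if "i < n" for i using Dg[OF that] q8 by linarith
  have h0: "0 < h i" if "i < n" for i using Dpos[OF that] by (simp add: h_def)
  have q44: "q^4 * q^4 = q^8" by (simp add: power_add[symmetric])
  have h: "h i \<le> sqrt 2 / q^4" if i: "i < n" for i
  proof -
    have "q^4 / sqrt 2 = sqrt (q^8 / 2)" 
      using real_sqrt_unique[of "q^4" "q^8"] q0 by (simp add: real_sqrt_divide)
    also have "\<dots> \<le> sqrt (D i + q^7)" using Dg[OF i] by simp
    finally have "1 / sqrt (D i + q^7) \<le> 1 / (q^4 / sqrt 2)" 
      using q0 Dpos[OF i] by (intro divide_left_mono) auto
    then show ?thesis by (simp add: h_def)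
  qed
  have habs: "\<bar>h i\<bar> \<le> sqrt 2 / q^4" if "i < n" for i using h[OF that] h0[OF that] by simp
  have c0: "0 \<le> sqrt 2 / q^4" using q0 by simp
  have nh: "nrm n (\<lambda>i. h i * z i) \<le> sqrt 2 / q^4 * nrm n z" for z
    by (rule nrm_mult_le[OF habs c0])
  have hh: "nrm n (\<lambda>i. h i * x i) * nrm n (\<lambda>i. h i * y i) \<le> 2 / q^8 * P"
  proof -
    have "nrm n (\<lambda>i. h i * x i) * nrm n (\<lambda>i. h i * y i) \<le> (sqrt 2 / q^4 * nrm n x) * (sqrt 2 / q^4 * nrm n y)"
      using c0 by (intro mult_mono nh) (auto simp: nsq_nonneg)
    also have "\<dots> = 2 / q^8 * P" by (simp add: P_def)
    finally show ?thesis .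
  qed
  have q78: "q^7 / q^8 = 1 / q" using q0 by (simp add: power_eq_if)

  have T2: "\<bar>bil n W (\<lambda>i. h i * x i) (\<lambda>i. h i * y i)\<bar> \<le> 640 / q * P"
  proof -
    have "\<bar>bil n W (\<lambda>i. h i * x i) (\<lambda>i. h i * y i)\<bar> \<le> 320 * q^7 * (nrm n (\<lambda>i. h i * x i) * nrm n (\<lambda>i. h i * y i))"
      using W[of "\<lambda>i. h i * x i" "\<lambda>i. h i * y i"] by (simp add: mult.assoc)
    also have "\<dots> \<le> 320 * q^7 * (2 / q^8 * P)" using q0 by (intro mult_left_mono hh) auto
    also have "\<dots> = 640 * (q^7 / q^8) * P" by simp
    finally show ?thesis unfolding q78 by simp
  qed
  have T1: "\<bar>g * ((\<Sum>i<n. h i * x i) * (\<Sum>j<n. h j * y j))\<bar> \<le> 2 / q * P"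
  proof -
    have s: "\<bar>\<Sum>i<n. h i * z i\<bar> \<le> nrm n (\<lambda>i. h i * z i) * sqrt (real n)" for z
      by (rule order_trans[OF sum_abs sum_abs_le_nrm])
    have "\<bar>(\<Sum>i<n. h i * x i) * (\<Sum>j<n. h j * y j)\<bar>
       \<le> (nrm n (\<lambda>i. h i * x i) * sqrt (real n)) * (nrm n (\<lambda>i. h i * y i) * sqrt (real n))"
      unfolding abs_mult by (intro mult_mono s) (auto simp: nsq_nonneg)
    also have "\<dots> = real n * (nrm n (\<lambda>i. h i * x i) * nrm n (\<lambda>i. h i * y i))" by simp
    also have "\<dots> \<le> real n * (2 / q^8 * P)" by (intro mult_left_mono hh) auto
    finally have "\<bar>g\<bar> * \<bar>(\<Sum>i<n. h i * x i) * (\<Sum>j<n. h j * y j)\<bar> \<le> q^7 / real n * (real n * (2 / q^8 * P))"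
      using g q0 by (intro mult_mono) auto
    also have "\<dots> = 2 * (q^7 / q^8) * P" using n0 by simp
    finally show ?thesis unfolding q78 by (simp add: abs_mult)
  qed
  have p\<eta>: "0 \<le> p * (1 - 2 * \<eta>)" "p * (1 - 2 * \<eta>) \<le> p" using p \<eta> by (auto simp: mult_left_le)
  have T3: "\<bar>p * (1 - 2 * \<eta>) * (\<Sum>i<n. (h i * x i) * (h i * y i))\<bar> \<le> 2 / q * P"
  proof -
    have "\<bar>\<Sum>i<n. (h i * x i) * (h i * y i)\<bar> \<le> (\<Sum>i<n. \<bar>h i * x i\<bar> * \<bar>h i * y i\<bar>)"
      by (rule order_trans[OF sum_abs]) (simp add: abs_mult)
    also have "\<dots> \<le> 2 / q^8 * P" by (rule order_trans[OF sum_abs_mult_le_nrm hh])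
    also have "\<dots> \<le> 2 / q * P"
    proof (rule mult_right_mono[OF _ P0])
      have "q \<le> q^8" using q self_le_power[of q 8] by simp
      then show "2 / q^8 \<le> 2 / q" using q0 by (simp add: frac_le)
    qed
    finally have S: "\<bar>\<Sum>i<n. (h i * x i) * (h i * y i)\<bar> \<le> 2 / q * P" .
    have "p * (1 - 2 * \<eta>) \<le> 1" using p\<eta>(2) p(2) by linarith
    from mult_mono[OF this S]
    have "p * (1 - 2 * \<eta>) * \<bar>\<Sum>i<n. (h i * x i) * (h i * y i)\<bar> \<le> 1 * (2 / q * P)"
      by simp
    then show ?thesis unfolding abs_mult[of "p * (1 - 2 * \<eta>)"] abs_of_nonneg[OF p\<eta>(1)] by simp
  qed

  have dD: "D i - q^8 = (\<Sum>j<n. W' i j)" if "i < n" for i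
  proof -
    have "(\<Sum>j<n. W' i j) = (\<Sum>e\<in>pairs n. (if fst e = i \<or> snd e = i then \<bar>X e\<bar> else 0) - (if fst e = i \<or> snd e = i then p else 0))"
      unfolding W'_def row_sum_symm[OF that] by (intro sum.cong) auto
    then show ?thesis unfolding D_def row_sum_symm[OF that] sum_subtractf card_incident_pairs[OF that] d by simp
  qed
  \<comment> \<open>The degree errors are the row sums of \<open>W'\<close>, so
    \<open>nsq n \<Delta>\<close> is the form of \<open>W'\<close> at \<open>\<Delta>\<close> and
    the all-ones vector. Dividing by \<open>nrm n \<Delta>\<close> gives the mean-square bound that
    the uniform degree bound cannot give.\<close>
  define \<Delta> where "\<Delta> = (\<lambda>i. D i - q^8)"
  have "nsq n \<Delta> \<le> 320 * q^7 * nrm n \<Delta> * sqrt (real n)"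
  proof -
    have "nsq n \<Delta> = bil n W' \<Delta> (\<lambda>_. 1)"
      unfolding nsq_def bil_def power2_eq_square
      by (intro sum.cong refl) (simp add: \<Delta>_def dD sum_distrib_right[symmetric])
    also have "\<dots> \<le> 320 * q^7 * nrm n \<Delta> * nrm n (\<lambda>_. 1)" using W'[of \<Delta> "\<lambda>_. 1"] by linarith
    finally show ?thesis by (simp add: nsq_def)
  qed
  then have "nrm n \<Delta> * nrm n \<Delta> \<le> nrm n \<Delta> * (320 * q^7 * sqrt (real n))"
    using nsq_nonneg[of n \<Delta>] by (simp add: mult_ac)
  then have n\<Delta>: "nrm n \<Delta> \<le> 320 * q^7 * sqrt (real n)"
  proof (cases "nrm n \<Delta> = 0")
    case True
    then show ?thesis unfolding True using q0 by simp
  next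
    case False
    then have "0 < nrm n \<Delta>" using nsq_nonneg[of n \<Delta>] by auto
    then show ?thesis using \<open>nrm n \<Delta> * nrm n \<Delta> \<le> _\<close> by (rule_tac mult_left_le_imp_le)
  qed

  have t1: "\<bar>t i - 1\<bar> \<le> sqrt 2 / q^8 * \<bar>\<Delta> i + q^7\<bar>" if i: "i < n" for i
  proof -
    define r where "r = sqrt (D i + q^7)"
    have r: "0 < r" "r\<^sup>2 = D i + q^7" using Dpos[OF i] by (auto simp: r_def)
    have hr: "h i = 1 / r" by (simp add: h_def r_def)
    have "t i - 1 = (q^4 - r) * h i" using r by (simp add: t_def hr field_simps)
    \<comment> \<open>The conjugate factor turns a difference of square roots into the degree error
      itself.\<close>
    moreover have "(q^4 - r) * (q^4 + r) = - (\<Delta> i + q^7)"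
      using r(2) by (simp add: \<Delta>_def algebra_simps power2_eq_square q44)
    ultimately have "(t i - 1) * (q^4 + r) = - (\<Delta> i + q^7) * h i" by (simp add: mult_ac)
    then have "\<bar>t i - 1\<bar> * (q^4 + r) = \<bar>\<Delta> i + q^7\<bar> * h i"
    proof -
      assume eq: "(t i - 1) * (q^4 + r) = - (\<Delta> i + q^7) * h i"
      have pr: "0 < q^4 + r" using r q0 by (simp add: add_pos_pos)
      have "\<bar>t i - 1\<bar> * (q^4 + r) = \<bar>(t i - 1) * (q^4 + r)\<bar>" by (simp add: abs_mult abs_of_pos[OF pr])
      also have "\<dots> = \<bar>\<Delta> i + q^7\<bar> * \<bar>h i\<bar>" unfolding eq abs_mult abs_minus_cancel ..
      finally show ?thesis using h0[OF i] by simp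
    qed
    moreover have "\<bar>t i - 1\<bar> * q^4 \<le> \<bar>t i - 1\<bar> * (q^4 + r)" using r by (intro mult_left_mono) auto
    moreover have "\<bar>\<Delta> i + q^7\<bar> * h i \<le> \<bar>\<Delta> i + q^7\<bar> * (sqrt 2 / q^4)" by (intro mult_left_mono h i) auto
    ultimately have "\<bar>t i - 1\<bar> * q^4 \<le> \<bar>\<Delta> i + q^7\<bar> * (sqrt 2 / q^4)" by linarith
    moreover have "0 < q^4" using q0 by simp
    ultimately have "\<bar>t i - 1\<bar> \<le> \<bar>\<Delta> i + q^7\<bar> * (sqrt 2 / q^4) / q^4" by (simp only: pos_le_divide_eq)
    also have "\<dots> = sqrt 2 / (q^4 * q^4) * \<bar>\<Delta> i + q^7\<bar>" by (simp only: divide_divide_eq_left times_divide_eq_right times_divide_eq_left mult.commute)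
    finally show ?thesis unfolding q44 .
  qed
  define \<tau> where "\<tau> = nrm n (\<lambda>i. t i - 1)"
  have \<tau>0: "0 \<le> \<tau>" by (simp add: \<tau>_def nsq_nonneg)
  have \<tau>: "\<tau> \<le> 500 / q * sqrt (real n)"
  proof -
    have "nsq n (\<lambda>i. t i - 1) \<le> nsq n (\<lambda>i. sqrt 2 / q^8 * \<bar>\<Delta> i + q^7\<bar>)"
      unfolding nsq_def
    proof (rule sum_mono)
      fix i assume "i \<in> {..<n}"
      then have "\<bar>t i - 1\<bar> \<le> \<bar>sqrt 2 / q^8 * \<bar>\<Delta> i + q^7\<bar>\<bar>" using t1[of i] q0 by (simp add: abs_mult)
      then show "(t i - 1)\<^sup>2 \<le> (sqrt 2 / q^8 * \<bar>\<Delta> i + q^7\<bar>)\<^sup>2" by (subst abs_le_square_iff[symmetric])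
    qed
    then have "\<tau> \<le> sqrt ((sqrt 2 / q^8)\<^sup>2 * nsq n (\<lambda>i. \<Delta> i + q^7))"
      unfolding \<tau>_def real_sqrt_le_iff nsq_scale by (simp only: nsq_def power2_abs)
    also have "\<dots> = sqrt 2 / q^8 * nrm n (\<lambda>i. \<Delta> i + q^7)" using q0 by (simp add: real_sqrt_mult)
    finally have \<tau>1: "\<tau> \<le> sqrt 2 / q^8 * nrm n (\<lambda>i. \<Delta> i + q^7)" .
    have "nrm n (\<lambda>i. \<Delta> i + q^7) \<le> nrm n \<Delta> + nrm n (\<lambda>_. q^7)"
      unfolding nrm_eq_L2_set by (rule L2_set_triangle_ineq)
    also have "nrm n (\<lambda>_. q^7) = q^7 * sqrt (real n)"
      using real_sqrt_unique[of "q^7" "q^14"] q0 by (simp add: nsq_def real_sqrt_mult)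
    finally have nr: "nrm n (\<lambda>i. \<Delta> i + q^7) \<le> 321 * q^7 * sqrt (real n)" using n\<Delta> by simp
    have "sqrt 2 \<le> 1.5" by (rule real_le_lsqrt) (auto simp: power2_eq_square)
    then have "sqrt 2 / q^8 \<le> 1.5 / q^8" using q0 by (intro divide_right_mono) auto
    from mult_mono[OF this nr] \<tau>1 have "\<tau> \<le> 1.5 / q^8 * (321 * q^7 * sqrt (real n))"
      using q0 by (simp add: nsq_nonneg)
    also have "\<dots> = 481.5 * (q^7 / q^8) * sqrt (real n)" by simp
    also have "\<dots> \<le> 500 / q * sqrt (real n)" unfolding q78 using q0 by (simp add: field_simps)
    finally show ?thesis .
  qed
  have tle: "\<bar>t i\<bar> \<le> 3/2" if "i < n" for i
  proof -
    have "sqrt 2 \<le> 3/2" by (rule real_le_lsqrt) (auto simp: power2_eq_square)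
    moreover have "t i \<le> sqrt 2" using h[OF that] q0 by (simp add: t_def field_simps)
    ultimately show ?thesis using h0[OF that] q0 by (simp add: t_def)
  qed
  \<comment> \<open>All entries of \<open>sgn_cl\<close> have modulus 1, so Cauchy-Schwarz bounds
    the form by a multiple of \<open>\<tau> * sqrt n = O(n / q)\<close>; the prefactor is at most
    \<open>10 / (9 * n)\<close>.\<close>
  have T4: "\<bar>p * (1 - 2 * \<eta>) / q^8 * bil n (\<lambda>i j. sgn_cl cl i j * (t i * t j - 1)) x y\<bar> \<le> 1500 / q * P"
  proof -
    let ?z = "bil n (\<lambda>i j. sgn_cl cl i j * (t i * t j - 1)) x y"
    have "\<bar>?z\<bar>
        \<le> (\<Sum>i<n. \<Sum>j<n. (\<bar>t i - 1\<bar> * \<bar>x i\<bar>) * (\<bar>t j * y j\<bar>) + \<bar>x i\<bar> * (\<bar>t j - 1\<bar> * \<bar>y j\<bar>))"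
      unfolding bil_def
    proof (rule order_trans[OF sum_abs], rule sum_mono, rule order_trans[OF sum_abs], rule sum_mono)
      fix i j
      have "t i * t j - 1 = (t i - 1) * t j + (t j - 1)" by (simp add: algebra_simps)
      then have "\<bar>t i * t j - 1\<bar> \<le> \<bar>t i - 1\<bar> * \<bar>t j\<bar> + \<bar>t j - 1\<bar>"
        by (metis abs_mult abs_triangle_ineq)
      then have "\<bar>t i * t j - 1\<bar> * (\<bar>x i\<bar> * \<bar>y j\<bar>) \<le> (\<bar>t i - 1\<bar> * \<bar>t j\<bar> + \<bar>t j - 1\<bar>) * (\<bar>x i\<bar> * \<bar>y j\<bar>)"
        by (rule mult_right_mono) simp
      moreover have "\<bar>sgn_cl cl i j * (t i * t j - 1) * x i * y j\<bar> = \<bar>t i * t j - 1\<bar> * (\<bar>x i\<bar> * \<bar>y j\<bar>)"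
        by (simp add: abs_mult sgn_cl_def)
      ultimately show "\<bar>sgn_cl cl i j * (t i * t j - 1) * x i * y j\<bar>
          \<le> (\<bar>t i - 1\<bar> * \<bar>x i\<bar>) * (\<bar>t j * y j\<bar>) + \<bar>x i\<bar> * (\<bar>t j - 1\<bar> * \<bar>y j\<bar>)"
        by (simp add: algebra_simps abs_mult)
    qed
    also have "\<dots> = (\<Sum>i<n. \<bar>t i - 1\<bar> * \<bar>x i\<bar>) * (\<Sum>j<n. \<bar>t j * y j\<bar>) + (\<Sum>i<n. \<bar>x i\<bar>) * (\<Sum>j<n. \<bar>t j - 1\<bar> * \<bar>y j\<bar>)"
      by (simp only: sum.distrib sum_product)
    also have "\<dots> \<le> (\<tau> * nrm n x) * (3/2 * nrm n y * sqrt (real n)) + (nrm n x * sqrt (real n)) * (\<tau> * nrm n y)"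
    proof (intro add_mono mult_mono)
      have "(\<Sum>j<n. \<bar>t j * y j\<bar>) \<le> nrm n (\<lambda>j. t j * y j) * sqrt (real n)" by (rule sum_abs_le_nrm)
      also have "\<dots> \<le> 3/2 * nrm n y * sqrt (real n)" by (intro mult_right_mono nrm_mult_le tle) auto
      finally show "(\<Sum>j<n. \<bar>t j * y j\<bar>) \<le> 3/2 * nrm n y * sqrt (real n)" .
    qed (auto simp: \<tau>_def nsq_nonneg intro: sum_abs_mult_le_nrm sum_abs_le_nrm sum_nonneg)
    also have "\<dots> = 5/2 * (\<tau> * sqrt (real n)) * P" by (simp add: P_def algebra_simps)
    also have "\<dots> \<le> 5/2 * (500 / q * real n) * P"
    proof (intro mult_right_mono mult_left_mono P0)
      have "\<tau> * sqrt (real n) \<le> (500 / q * sqrt (real n)) * sqrt (real n)" by (rule mult_right_mono[OF \<tau>]) simp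
      then show "\<tau> * sqrt (real n) \<le> 500 / q * real n"
        by (simp only: mult.assoc real_sqrt_mult_self abs_of_nat)
    qed simp
    finally have "p / q^8 * \<bar>?z\<bar> \<le> p / q^8 * (1250 / q * real n * P)"
      using p q0 by (intro mult_left_mono) auto
    also have "\<dots> = (p * real n / q^8) * (1250 / q * P)" by (simp add: field_simps)
    also have "\<dots> \<le> (10/9) * (1250 / q * P)"
    proof (rule mult_right_mono)
      have "real n \<le> 10/9 * (real n - 1)" using n by simp
      then have "p * real n \<le> p * (10/9 * (real n - 1))" using p by (intro mult_left_mono) auto
      then have "p * real n \<le> 10/9 * q^8" unfolding d by (simp only: mult_ac)
      then show "p * real n / q^8 \<le> 10/9" by (simp only: pos_divide_le_eq[OF q8])
    qed (use q0 P0 in auto)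
    also have "\<dots> \<le> 1500 / q * P" using q0 P0 by (simp add: field_simps)
    finally have "p / q^8 * \<bar>?z\<bar> \<le> 1500 / q * P" .
    moreover have "p * (1 - 2 * \<eta>) / q^8 * \<bar>?z\<bar>
        \<le> p / q^8 * \<bar>?z\<bar>"
      using p\<eta> q0 by (intro mult_right_mono divide_right_mono) auto
    moreover have c: "0 \<le> p * (1 - 2 * \<eta>) / q^8" using p\<eta>(1) q0 by simp
    ultimately show ?thesis unfolding abs_mult[of "p * (1 - 2 * \<eta>) / q^8"] abs_of_nonneg[OF c] by linarith
  qed

  have "bil n (\<lambda>i j. h i * (symm X i j + g) * h j - p * (1 - 2 * \<eta>) / q^8 * sgn_cl cl i j) x y
      = bil n W (\<lambda>i. h i * x i) (\<lambda>i. h i * y i) + g * ((\<Sum>i<n. h i * x i) * (\<Sum>j<n. h j * y j))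
        - p * (1 - 2 * \<eta>) * (\<Sum>i<n. (h i * x i) * (h i * y i))
        + p * (1 - 2 * \<eta>) / q^8 * bil n (\<lambda>i j. sgn_cl cl i j * (t i * t j - 1)) x y"
  proof -
    have diag: "(\<Sum>i<n. (h i * x i) * (h i * y i)) = (\<Sum>i<n. \<Sum>j<n. if i = j then (h i * x i) * (h j * y j) else 0)"
      by simp
    have ent: "symm X i j = W i j + p * (1 - 2 * \<eta>) * (sgn_cl cl i j - (if i = j then 1 else 0))" for i j
      by (auto simp: W_def symm_def \<mu>_def emean_def sgn_cl_def)
    have tt: "t i * t j = q^8 * (h i * h j)" for i j by (simp add: t_def)
    show ?thesis unfolding diag bil_def sum_product
      unfolding sum_distrib_left unfolding sum.distrib[symmetric] sum_subtractf[symmetric]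
    proof (intro sum.cong refl)
      fix i j
      define \<kappa> where "\<kappa> = p * (1 - 2 * \<eta>)"
      have e: "\<kappa> / q^8 * (sgn_cl cl i j * (t i * t j - 1) * x i * y j)
          = \<kappa> * sgn_cl cl i j * (h i * h j) * x i * y j - \<kappa> / q^8 * sgn_cl cl i j * x i * y j"
        unfolding tt using q8 by (simp add: field_simps)
      show "(h i * (symm X i j + g) * h j - p * (1 - 2 * \<eta>) / q^8 * sgn_cl cl i j) * x i * y j
         = W i j * (h i * x i) * (h j * y j) + g * (h i * x i * (h j * y j))
           - p * (1 - 2 * \<eta>) * (if i = j then (h i * x i) * (h j * y j) else 0)
           + p * (1 - 2 * \<eta>) / q^8 * (sgn_cl cl i j * (t i * t j - 1) * x i * y j)"
        unfolding ent \<kappa>_def[symmetric] unfolding e by (cases "i = j") (simp_all add: algebra_simps)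
    qed
  qed
  then have "\<bar>bil n (\<lambda>i j. h i * (symm X i j + g) * h j - p * (1 - 2 * \<eta>) / q^8 * sgn_cl cl i j) x y\<bar>
      \<le> 640 / q * P + 2 / q * P + 2 / q * P + 1500 / q * P"
    using T1 T2 T3 T4 by linarith
  also have "\<dots> \<le> 2500 / q * P" using q0 P0 by (simp add: field_simps)
  finally show ?thesis by (simp add: P_def mult.assoc)
qed

section \<open>The population matrix\<close>

text \<open>Equal to \<open>\<kappa>\<close> times twice the diagonal matrix of cluster sizes minus
  the rank-one matrix \<open>v v\<^sup>T\<close>, where \<open>v\<close> has entries
  \<open>sqrt (csize n cl i)\<close>. The parameter \<open>\<kappa>\<close> collects the common
  factor \<open>p / d * (1 - 2 * \<eta>)\<close>.\<close>

definition Bbar :: "nat \<Rightarrow> (nat \<Rightarrow> nat) \<Rightarrow> nat \<Rightarrow> real \<Rightarrow> real mat" where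
  "Bbar n cl k \<kappa> = mat k k (\<lambda>(i, i'). if i = i' then \<kappa> * real (csize n cl i)
     else - (\<kappa> * sqrt (real (csize n cl i) * real (csize n cl i'))))"

lemma Cbar_eq:
  "Cbar n k cl p \<eta> = (1 + p / (p * (real n - 1)) * (1 - 2 * \<eta>)) \<cdot>\<^sub>m 1\<^sub>m k
     - Bbar n cl k (p / (p * (real n - 1)) * (1 - 2 * \<eta>))"
  unfolding Cbar_def Bbar_def Let_def by (intro eq_matI) auto

lemma csize_pos: "is_partition n k cl \<Longrightarrow> i < k \<Longrightarrow> 0 < csize n cl i"
  unfolding is_partition_def csize_def by (auto simp: card_gt_0_iff)

lemma sum_indicator_csize: "(\<Sum>j<n. if cl j = i then c else 0) = real (csize n cl i) * c"
proof -
  have "(\<Sum>j<n. if cl j = i then c else 0) = (\<Sum>j\<in>{j \<in> {..<n}. cl j = i}. c)"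
    by (rule sum.inter_filter[symmetric]) simp
  then show ?thesis by (simp add: csize_def)
qed

lemma sum_csize:
  assumes "is_partition n k cl"
  shows "(\<Sum>i<k. real (csize n cl i)) = real n"
proof -
  have "(\<Sum>i<k. real (csize n cl i)) = (\<Sum>i<k. \<Sum>j<n. if cl j = i then 1 else 0)"
    unfolding sum_indicator_csize by simp
  also have "\<dots> = (\<Sum>j<n. \<Sum>i<k. if cl j = i then 1 else 0)" by (rule sum.swap)
  also have "\<dots> = (\<Sum>j<n. 1)" using assms by (intro sum.cong) (auto simp: is_partition_def)
  finally show ?thesis by simp
qed

lemma Theta_isometry:
  assumes part: "is_partition n k cl"
  shows "(Theta n k cl)\<^sup>T * Theta n k cl = 1\<^sub>m k"
proof (rule eq_matI)
  fix a b assume "a < dim_row (1\<^sub>m k)" "b < dim_col (1\<^sub>m k)"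
  then have ab: "a < k" "b < k" by auto
  have "((Theta n k cl)\<^sup>T * Theta n k cl) $$ (a, b)
      = (\<Sum>j<n. (if cl j = a then 1 / sqrt (real (csize n cl a)) else 0) * (if cl j = b then 1 / sqrt (real (csize n cl b)) else 0))"
    using ab by (simp add: Theta_def scalar_prod_def atLeast0LessThan)
  also have "\<dots> = (\<Sum>j<n. if cl j = a then (if a = b then 1 / real (csize n cl a) else 0) else 0)"
    by (intro sum.cong) auto
  also have "\<dots> = 1\<^sub>m k $$ (a, b)"
    unfolding sum_indicator_csize using ab csize_pos[OF part ab(1)] by (cases "a = b") auto
  finally show "((Theta n k cl)\<^sup>T * Theta n k cl) $$ (a, b) = 1\<^sub>m k $$ (a, b)" .
qed (auto simp: Theta_def)

lemma Theta_carrier: "Theta n k cl \<in> carrier_mat n k"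
  by (simp add: Theta_def)

lemma Bbar_carrier: "Bbar n cl k \<kappa> \<in> carrier_mat k k"
  by (simp add: Bbar_def)

text \<open>Lifting by \<open>Theta\<close> cancels the square roots of the sizes. So the normalised
  population matrix, with its diagonal filled in, is governed by the \<open>k\<close> by
  \<open>k\<close> matrix \<open>Bbar\<close>.\<close>

lemma Theta_Bbar_Theta_index:
  assumes part: "is_partition n k cl" and ij: "i < n" "j < n"
  shows "(Theta n k cl * (Bbar n cl k \<kappa> * (Theta n k cl)\<^sup>T)) $$ (i, j) = \<kappa> * (if cl i = cl j then 1 else - 1)"
proof -
  let ?T = "Theta n k cl" and ?B = "Bbar n cl k \<kappa>"
  have cl: "cl i < k" "cl j < k" using part ij by (auto simp: is_partition_def)
  have pos: "0 < real (csize n cl (cl i))" "0 < real (csize n cl (cl j))" using csize_pos[OF part] cl by auto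
  have T: "?T $$ (a, b) = (if cl a = b then 1 / sqrt (real (csize n cl b)) else 0)" if "a < n" "b < k" for a b
    using that by (simp add: Theta_def)
  have BT: "(?B * ?T\<^sup>T) $$ (a, j) = ?B $$ (a, cl j) / sqrt (real (csize n cl (cl j)))" if "a < k" for a
  proof -
    have "(?B * ?T\<^sup>T) $$ (a, j) = (\<Sum>b<k. ?B $$ (a, b) * ?T $$ (j, b))"
      using that ij Bbar_carrier[of n cl k \<kappa>] Theta_carrier[of n k cl] by (simp add: scalar_prod_def atLeast0LessThan)
    also have "\<dots> = (\<Sum>b<k. if cl j = b then ?B $$ (a, b) / sqrt (real (csize n cl b)) else 0)"
      using ij by (intro sum.cong) (auto simp: T)
    also have "\<dots> = ?B $$ (a, cl j) / sqrt (real (csize n cl (cl j)))" using cl by simp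
    finally show ?thesis .
  qed
  have BTc: "?B * ?T\<^sup>T \<in> carrier_mat k n"
    using mult_carrier_mat[OF Bbar_carrier[of n cl k \<kappa>], of "?T\<^sup>T" n] Theta_carrier[of n k cl] by simp
  have prod: "(?T * N) $$ (i, j) = (\<Sum>a<k. ?T $$ (i, a) * N $$ (a, j))" if "N \<in> carrier_mat k n" for N
    using ij that Theta_carrier[of n k cl] by (simp add: scalar_prod_def atLeast0LessThan)
  have "(?T * (?B * ?T\<^sup>T)) $$ (i, j) = (\<Sum>a<k. ?T $$ (i, a) * (?B * ?T\<^sup>T) $$ (a, j))"
    by (rule prod[OF BTc])
  also have "\<dots> = (\<Sum>a<k. if cl i = a then ?B $$ (a, cl j) / sqrt (real (csize n cl (cl j))) / sqrt (real (csize n cl a)) else 0)"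
    using ij by (intro sum.cong) (auto simp: T BT simp del: index_mult_mat(1))
  also have "\<dots> = ?B $$ (cl i, cl j) / sqrt (real (csize n cl (cl j))) / sqrt (real (csize n cl (cl i)))" using cl by simp
  also have "\<dots> = \<kappa> * (if cl i = cl j then 1 else - 1)"
    using cl pos by (simp add: Bbar_def real_sqrt_mult)
  finally show ?thesis .
qed

lemma scalar_prod_Bbar:
  assumes "x \<in> carrier_vec k"
  shows "x \<bullet> (Bbar n cl k \<kappa> *\<^sub>v x) = \<kappa> * (2 * (\<Sum>i<k. real (csize n cl i) * (x $ i)\<^sup>2) - (\<Sum>i<k. sqrt (real (csize n cl i)) * x $ i)\<^sup>2)"
proof -
  have "x \<bullet> (Bbar n cl k \<kappa> *\<^sub>v x) = (\<Sum>i<k. \<Sum>j<k. Bbar n cl k \<kappa> $$ (i, j) * x $ i * x $ j)"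
    by (rule scalar_prod_mult_mat_vec_sum[OF Bbar_carrier assms assms])
  also have "\<dots> = (\<Sum>i<k. \<Sum>j<k. (if i = j then \<kappa> * (2 * (real (csize n cl j) * (x $ j)\<^sup>2)) else 0)
       - \<kappa> * ((sqrt (real (csize n cl i)) * x $ i) * (sqrt (real (csize n cl j)) * x $ j)))"
    by (intro sum.cong refl) (auto simp: Bbar_def real_sqrt_mult power2_eq_square algebra_simps)
  also have "\<dots> = (\<Sum>i<k. \<kappa> * (2 * (real (csize n cl i) * (x $ i)\<^sup>2))) - \<kappa> * ((\<Sum>i<k. sqrt (real (csize n cl i)) * x $ i) * (\<Sum>i<k. sqrt (real (csize n cl i)) * x $ i))"
  proof -
    have "(\<Sum>i<k. \<Sum>j<k. \<kappa> * ((sqrt (real (csize n cl i)) * x $ i) * (sqrt (real (csize n cl j)) * x $ j)))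
        = \<kappa> * ((\<Sum>i<k. sqrt (real (csize n cl i)) * x $ i) * (\<Sum>i<k. sqrt (real (csize n cl i)) * x $ i))"
      unfolding sum_product by (simp only: sum_distrib_left)
    then show ?thesis by (simp add: sum_subtractf)
  qed
  also have "\<dots> = \<kappa> * (2 * (\<Sum>i<k. real (csize n cl i) * (x $ i)\<^sup>2) - (\<Sum>i<k. sqrt (real (csize n cl i)) * x $ i)\<^sup>2)"
    by (simp add: sum_distrib_left power2_eq_square algebra_simps)
  finally show ?thesis .
qed

lemma smult_one_minus_mult_vec:
  fixes B :: "real mat"
  assumes B: "B \<in> carrier_mat k k" and x: "x \<in> carrier_vec k"
  shows "(\<alpha> \<cdot>\<^sub>m 1\<^sub>m k - B) *\<^sub>v x = \<alpha> \<cdot>\<^sub>v x - B *\<^sub>v x"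
proof -
  have "(\<alpha> \<cdot>\<^sub>m 1\<^sub>m k) *\<^sub>v x = \<alpha> \<cdot>\<^sub>v x"
  proof (rule eq_vecI)
    fix i assume "i < dim_vec (\<alpha> \<cdot>\<^sub>v x)"
    then have i: "i < k" using x by simp
    have "row (\<alpha> \<cdot>\<^sub>m 1\<^sub>m k) i = \<alpha> \<cdot>\<^sub>v unit_vec k i" using i by (intro eq_vecI) auto
    then show "((\<alpha> \<cdot>\<^sub>m 1\<^sub>m k) *\<^sub>v x) $ i = (\<alpha> \<cdot>\<^sub>v x) $ i" using i x by simp
  qed (use x in simp)
  then show ?thesis using minus_mult_distrib_mat_vec[OF _ B x, of "\<alpha> \<cdot>\<^sub>m 1\<^sub>m k"] by simp
qed

text \<open>The bound on the complement of \<open>R\<close> comes from the test vector with entries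
  \<open>sqrt (csize n cl i)\<close>, the bound on its span from test vectors orthogonal to that one.\<close>

lemma population_gap:
  fixes a b :: real
  assumes part: "is_partition n k cl" and k: "k \<ge> 2" and n: "n > 0" and \<kappa>: "\<kappa> > 0"
    and size: "\<And>i. i < k \<Longrightarrow> a \<le> real (csize n cl i) \<and> real (csize n cl i) \<le> b" and ab: "11 * b \<le> 12 * a"
    and M: "M = \<alpha> \<cdot>\<^sub>m 1\<^sub>m k - Bbar n cl k \<kappa>"
    and R: "bottom_eigvecs M (k - 1) R"
  obtains lam where "M * R = R * mat_diag (k - 1) lam"
    "\<forall>i<k - 1. lam i \<le> \<alpha> - 11/6 * \<kappa> * real n / real k"
    "\<forall>z\<in>carrier_vec k. R\<^sup>T *\<^sub>v z = 0\<^sub>v (k - 1) \<longrightarrow> z \<bullet> (Bbar n cl k \<kappa> *\<^sub>v z) \<le> \<kappa> * real n / real k * (z \<bullet> z)"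
proof -
  let ?B = "Bbar n cl k \<kappa>" and ?m = "k - 1"
  define v where "v = vec k (\<lambda>i. sqrt (real (csize n cl i)))"
  have v: "v \<in> carrier_vec k" by (simp add: v_def)
  have k0: "0 < real k" using k by simp
  have sum: "(\<Sum>i<k. real (csize n cl i)) = real n" by (rule sum_csize[OF part])
  have "real n \<le> (\<Sum>i<k. b)" unfolding sum[symmetric] by (intro sum_mono) (use size in auto)
  then have nb: "real n \<le> real k * b" by simp
  have "(\<Sum>i<k. a) \<le> real n" unfolding sum[symmetric] by (intro sum_mono) (use size in auto)
  then have na: "real k * a \<le> real n" by simp
  \<comment> \<open>The mean cluster size \<open>n / k\<close> lies between \<open>a\<close> and
    \<open>b\<close>, so both are within the factor \<open>12/11\<close> of it.\<close>
  have a_ge: "11/12 * (real n / real k) \<le> a"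
  proof -
    have "11 * real n \<le> 11 * (real k * b)" using nb by simp
    also have "\<dots> = real k * (11 * b)" by simp
    also have "\<dots> \<le> real k * (12 * a)" using ab by (intro mult_left_mono) auto
    finally show ?thesis using k0 by (simp add: field_simps)
  qed
  have b_le: "b \<le> 12/11 * (real n / real k)"
  proof -
    have "real k * (11 * b) \<le> real k * (12 * a)" using ab by (intro mult_left_mono) auto
    also have "\<dots> \<le> 12 * real n" using na by simp
    finally show ?thesis using k0 by (simp add: field_simps)
  qed
  have Mc: "M \<in> carrier_mat k k" unfolding M by (rule minus_carrier_mat[OF Bbar_carrier])
  have Mt: "M\<^sup>T = M" unfolding M by (intro eq_matI) (auto simp: Bbar_def mult.commute)
  have Mv: "M *\<^sub>v x = \<alpha> \<cdot>\<^sub>v x - ?B *\<^sub>v x" if x: "x \<in> carrier_vec k" for x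
    unfolding M by (rule smult_one_minus_mult_vec[OF Bbar_carrier x])
  have Bx: "?B *\<^sub>v x \<in> carrier_vec k" if "x \<in> carrier_vec k" for x
    by (rule mult_mat_vec_carrier[OF Bbar_carrier that])
  have Mq: "x \<bullet> (M *\<^sub>v x) = \<alpha> * (x \<bullet> x) - x \<bullet> (?B *\<^sub>v x)" if x: "x \<in> carrier_vec k" for x
    unfolding Mv[OF x] using x Bx[OF x] by (simp add: scalar_prod_minus_distrib[of _ k])
  obtain lam where MR: "M * R = R * mat_diag ?m lam"
    and lam: "\<forall>i<?m. \<forall>x\<in>carrier_vec k. (\<forall>c<?m. c \<noteq> i \<longrightarrow> col R c \<bullet> x = 0) \<longrightarrow> lam i * (x \<bullet> x) \<le> x \<bullet> (M *\<^sub>v x)"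
    by (rule bottom_eigvecs_rayleigh[OF R Mc Mt])
  have Rc: "R \<in> carrier_mat k ?m" "R\<^sup>T * R = 1\<^sub>m ?m"
    using R Mc by (auto simp: bottom_eigvecs_def)
  have cR: "col R c \<in> carrier_vec k" for c using Rc(1) by auto
  have lam_le: "lam i \<le> \<alpha> - 11/6 * \<kappa> * real n / real k" if i: "i < ?m" for i
  proof -
    \<comment> \<open>The \<open>k - 2\<close> other columns of \<open>R\<close> together with
      \<open>v\<close> are \<open>k - 1\<close> conditions in dimension \<open>k\<close>: slot
      \<open>i\<close> is given to \<open>v\<close>, and slot \<open>k - 1\<close> stays free.
      Orthogonally to \<open>v\<close> only the diagonal part of \<open>Bbar\<close>
      survives.\<close>
    have w: "(if c = i then v else if c < ?m then col R c else 0\<^sub>v k) \<in> carrier_vec k" if "c < k" for c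
      using v cR by simp
    have "?m < k" using k by simp
    then obtain x where x: "x \<in> carrier_vec k" "x \<noteq> 0\<^sub>v k"
       "\<forall>c<k. c \<noteq> ?m \<longrightarrow> (if c = i then v else if c < ?m then col R c else 0\<^sub>v k) \<bullet> x = 0"
      using exists_orthogonal_vec[of ?m k "\<lambda>c. if c = i then v else if c < ?m then col R c else 0\<^sub>v k", OF _ w] by blast
    have vx: "v \<bullet> x = 0" using x(3)[rule_format, of i] i by simp
    have "col R c \<bullet> x = 0" if "c < ?m" "c \<noteq> i" for c using x(3)[rule_format, of c] that by simp
    then have l: "lam i * (x \<bullet> x) \<le> \<alpha> * (x \<bullet> x) - x \<bullet> (?B *\<^sub>v x)" using lam i x(1) Mq[OF x(1)] by fastforce
    have "(\<Sum>i<k. sqrt (real (csize n cl i)) * x $ i) = v \<bullet> x"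
      using x(1) by (auto simp: scalar_prod_def v_def atLeast0LessThan)
    then have "x \<bullet> (?B *\<^sub>v x) = \<kappa> * (2 * (\<Sum>i<k. real (csize n cl i) * (x $ i)\<^sup>2))"
      using scalar_prod_Bbar[OF x(1)] vx by simp
    moreover have "a * (x \<bullet> x) \<le> (\<Sum>i<k. real (csize n cl i) * (x $ i)\<^sup>2)"
      unfolding scalar_prod_self_sum[OF x(1)] sum_distrib_left by (intro sum_mono mult_right_mono) (use size in auto)
    ultimately have "\<kappa> * (2 * (a * (x \<bullet> x))) \<le> x \<bullet> (?B *\<^sub>v x)" using \<kappa> by simp
    then have "lam i * (x \<bullet> x) \<le> (\<alpha> - 2 * \<kappa> * a) * (x \<bullet> x)" using l by (simp add: algebra_simps)
    then have "lam i \<le> \<alpha> - 2 * \<kappa> * a" using scalar_prod_self_pos[OF x(1,2)] by simp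
    moreover have "2 * \<kappa> * (11/12 * (real n / real k)) \<le> 2 * \<kappa> * a" using a_ge \<kappa> by (intro mult_left_mono) auto
    ultimately show ?thesis by simp
  qed
  have high: "z \<bullet> (?B *\<^sub>v z) \<le> \<kappa> * real n / real k * (z \<bullet> z)"
    if z: "z \<in> carrier_vec k" and Rz: "R\<^sup>T *\<^sub>v z = 0\<^sub>v ?m" for z
  proof (rule ccontr)
    assume neg: "\<not> ?thesis"
    then have z0: "z \<noteq> 0\<^sub>v k" using Bbar_carrier[of n cl k \<kappa>] by auto
    have Rz': "col R c \<bullet> z = 0" if "c < ?m" for c
    proof -
      have "(R\<^sup>T *\<^sub>v z) $ c = col R c \<bullet> z" using Rc(1) that by simp
      then show ?thesis using Rz that by simp
    qed
    define s where "s = sqrt (z \<bullet> z)"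
    have s: "s > 0" "s * s = z \<bullet> z" using scalar_prod_self_pos[OF z z0] by (auto simp: s_def)
    define w where "w = (1 / s) \<cdot>\<^sub>v z"
    have w: "w \<in> carrier_vec k" using z by (simp add: w_def)
    have ww: "w \<bullet> w = 1" using z s by (simp add: w_def s(2)[symmetric])
    have Rw: "col R c \<bullet> w = 0" if "c < ?m" for c using Rz'[OF that] z cR[of c] by (simp add: w_def)
    have wR: "w \<bullet> col R c = 0" if "c < ?m" for c using Rw[OF that] comm_scalar_prod[OF w cR[of c]] by simp
    define \<theta> where "\<theta> = \<alpha> - \<kappa> * real n / real k"
    define \<mu> where "\<mu> = w \<bullet> (M *\<^sub>v w)"
    have \<mu>: "\<mu> < \<theta>"
    proof -
      have "?B *\<^sub>v w = (1 / s) \<cdot>\<^sub>v (?B *\<^sub>v z)" unfolding w_def by (rule mult_mat_vec[OF Bbar_carrier z])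
      then have "w \<bullet> (?B *\<^sub>v w) = (z \<bullet> (?B *\<^sub>v z)) / (z \<bullet> z)"
        using z Bx[OF z] by (simp add: w_def s(2)[symmetric])
      moreover have "\<kappa> * real n / real k < (z \<bullet> (?B *\<^sub>v z)) / (z \<bullet> z)"
        using neg scalar_prod_self_pos[OF z z0] by (simp add: not_le pos_less_divide_eq)
      ultimately show ?thesis unfolding \<mu>_def Mq[OF w] ww \<theta>_def by simp
    qed
    \<comment> \<open>\<open>R\<close> completed by \<open>w\<close> is an orthonormal basis in
      which \<open>M\<close> is diagonal, as the columns of \<open>R\<close> are eigenvectors. By
      the assumption to be refuted all diagonal entries are below \<open>\<theta>\<close>, hence so
      is the Rayleigh quotient of \<open>v\<close>, contrary to its direct evaluation.\<close>
    define f where "f = (\<lambda>c. if c < ?m then col R c else w)"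
    define \<nu> where "\<nu> = (\<lambda>c. if c < ?m then lam c else \<mu>)"
    have fc: "f c \<in> carrier_vec k" for c using cR w by (simp add: f_def)
    have ff: "f c \<bullet> f c' = (if c = c' then 1 else 0)" if "c < k" "c' < k" for c c'
    proof -
      have "c = c'" if "\<not> c < ?m" "\<not> c' < ?m" using that \<open>c < k\<close> \<open>c' < k\<close> by linarith
      then show ?thesis using orthonormal_cols[OF Rc] Rw wR ww that by (auto simp: f_def)
    qed
    have fMf: "f c \<bullet> (M *\<^sub>v f c') = (if c = c' then \<nu> c else 0)" if "c < k" "c' < k" for c c'
    proof -
      have cc: "c = c'" if "\<not> c < ?m" "\<not> c' < ?m" using that \<open>c < k\<close> \<open>c' < k\<close> by linarith
      show ?thesis
      proof (cases "c' < ?m")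
        case True
        then have "M *\<^sub>v f c' = lam c' \<cdot>\<^sub>v f c'" using eigen_col[OF Mc Rc(1) MR True] by (simp add: f_def)
        then show ?thesis using ff[OF that] fc[of c] fc[of c'] True by (simp add: \<nu>_def)
      next
        case c': False
        show ?thesis
        proof (cases "c < ?m")
          case True
          have "f c \<bullet> (M *\<^sub>v f c') = f c' \<bullet> (M *\<^sub>v f c)" by (rule scalar_prod_mult_mat_vec_symmetric[OF Mc Mt fc fc])
          also have "M *\<^sub>v f c = lam c \<cdot>\<^sub>v f c" using eigen_col[OF Mc Rc(1) MR True] True by (simp add: f_def)
          finally show ?thesis using ff[OF that(2,1)] fc[of c] fc[of c'] True c' by auto
        next
          case False
          then show ?thesis using cc c' by (simp add: f_def \<nu>_def \<mu>_def)
        qed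
      qed
    qed
    define F where "F = mat k k (\<lambda>(i, c). f c $ i)"
    have F: "F \<in> carrier_mat k k" by (simp add: F_def)
    have cF: "col F c = f c" if "c < k" for c using fc[of c] that by (intro eq_vecI) (auto simp: F_def)
    have FtF: "F\<^sup>T * F = 1\<^sub>m k" using F by (intro eq_matI) (auto simp: cF ff)
    have FFt: "F * F\<^sup>T = 1\<^sub>m k"
      by (rule mat_mult_left_right_inverse[OF _ F FtF]) (use F in simp)
    have FMF: "F\<^sup>T * (M * F) = mat_diag k \<nu>"
    proof (rule eq_matI)
      fix c c' assume "c < dim_row (mat_diag k \<nu>)" "c' < dim_col (mat_diag k \<nu>)"
      then have c: "c < k" "c' < k" by (auto simp: mat_diag_def)
      have MF: "M * F \<in> carrier_mat k k" using Mc F by simp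
      have "(F\<^sup>T * (M * F)) $$ (c, c') = col F c \<bullet> col (M * F) c'" using c F MF by simp
      also have "col (M * F) c' = M *\<^sub>v f c'" using col_mult2[OF Mc F c(2)] cF[OF c(2)] by simp
      finally show "(F\<^sup>T * (M * F)) $$ (c, c') = mat_diag k \<nu> $$ (c, c')"
        using c by (simp add: cF fMf mat_diag_def)
    qed (use F Mc in \<open>auto simp: mat_diag_def\<close>)
    let ?max = "max (\<alpha> - 11/6 * \<kappa> * real n / real k) \<mu>"
    define u where "u = F\<^sup>T *\<^sub>v v"
    have Ft: "F\<^sup>T \<in> carrier_mat k k" using F by simp
    have u: "u \<in> carrier_vec k" unfolding u_def by (rule mult_mat_vec_carrier[OF Ft v])
    have vu: "v = F *\<^sub>v u" unfolding u_def using assoc_mult_mat_vec[OF F Ft v] FFt v by simp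
    have MF: "M * F \<in> carrier_mat k k" using Mc F by simp
    have "v \<bullet> (M *\<^sub>v v) = (F *\<^sub>v u) \<bullet> ((M * F) *\<^sub>v u)" using vu assoc_mult_mat_vec[OF Mc F u] by simp
    also have "\<dots> = u \<bullet> ((F\<^sup>T * (M * F)) *\<^sub>v u)" by (rule mult_mat_vec_scalar_prod[OF F MF u u])
    also have "\<dots> = (\<Sum>c<k. \<nu> c * (u $ c)\<^sup>2)" unfolding FMF scalar_prod_mat_diag[OF u u] by (simp add: power2_eq_square mult.assoc)
    also have "\<dots> \<le> (\<Sum>c<k. ?max * (u $ c)\<^sup>2)"
    proof (intro sum_mono mult_right_mono)
      fix c show "\<nu> c \<le> ?max"
        using lam_le[of c] by (auto simp: \<nu>_def le_max_iff_disj)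
    qed simp
    also have "\<dots> = ?max * (v \<bullet> v)"
      using isometry_scalar_prod[OF F FtF u u] by (simp add: vu[symmetric] scalar_prod_self_sum[OF u] sum_distrib_left)
    also have vv: "v \<bullet> v = real n"
      unfolding scalar_prod_self_sum[OF v] by (simp add: v_def sum)
    also have "?max * real n < \<theta> * real n"
    proof (rule mult_strict_right_mono)
      have "0 < \<kappa> * real n / real k" using \<kappa> n k0 by simp
      then have "\<alpha> - 11/6 * \<kappa> * real n / real k < \<theta>" by (simp add: \<theta>_def)
      then show "?max < \<theta>" using \<mu> by simp
    qed (use n in simp)
    finally have "v \<bullet> (M *\<^sub>v v) < \<theta> * real n" .
    moreover have "\<theta> * real n \<le> v \<bullet> (M *\<^sub>v v)"
    proof -
      have "v \<bullet> (?B *\<^sub>v v) = \<kappa> * (2 * (\<Sum>i<k. real (csize n cl i) * real (csize n cl i)) - (real n)\<^sup>2)"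
        unfolding scalar_prod_Bbar[OF v] using sum by (simp add: v_def)
      also have "\<dots> \<le> \<kappa> * (2 * (b * real n) - (real n)\<^sup>2)"
      proof -
        have "(\<Sum>i<k. real (csize n cl i) * real (csize n cl i)) \<le> (\<Sum>i<k. b * real (csize n cl i))"
          by (intro sum_mono mult_right_mono) (use size in auto)
        also have "\<dots> = b * real n" by (simp add: sum_distrib_left[symmetric] sum)
        finally show ?thesis using \<kappa> by simp
      qed
      also have "\<dots> = \<kappa> * (2 * b - real n) * real n" by (simp add: power2_eq_square algebra_simps)
      also have "\<dots> \<le> \<kappa> * (real n / real k) * real n"
      proof (intro mult_right_mono mult_left_mono)
        \<comment> \<open>Here \<open>k \<ge> 2\<close> enters: \<open>n\<close> is at least twice
          \<open>n / k\<close>, while \<open>2 * b\<close> exceeds twice \<open>n / k\<close> by at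
          most \<open>2/11\<close> of \<open>n / k\<close>.\<close>
        have "2 * (real n / real k) \<le> real n" using k n k0 by (simp add: field_simps)
        then show "2 * b - real n \<le> real n / real k" using b_le by linarith
      qed (use \<kappa> in auto)
      finally show ?thesis unfolding Mq[OF v] vv by (simp add: \<theta>_def algebra_simps)
    qed
    ultimately show False by linarith
  qed
  show ?thesis using that MR lam_le high by blast
qed

section \<open>Closeness of the spectral embeddings\<close>

lemma reg_laplacian_index:
  fixes X :: "nat \<times> nat \<Rightarrow> real" and n :: nat and gp gm :: real
  defines "h \<equiv> \<lambda>i. 1 / sqrt ((\<Sum>j<n. abs_adj X i j) + (gp + gm))"
  shows "reg_laplacian (sym_adj n X) gp gm =
    mat n n (\<lambda>(i, j). (if i = j then 1 else 0) - h i * (symm X i j + (gp - gm) / real n) * h j)"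
proof -
  have A: "sym_adj n X \<in> carrier_mat n n" by (simp add: sym_adj_def)
  have Aij: "sym_adj n X $$ (i, j) = symm X i j" if "i < n" "j < n" for i j
    using that by (simp add: sym_adj_def symm_def)
  have deg: "degree (sym_adj n X) i = (\<Sum>j<n. abs_adj X i j)" if "i < n" for i
    unfolding degree_def using that A by (intro sum.cong) (auto simp: Aij symm_def)
  let ?Ag = "sym_adj n X + ((gp - gm) / real n) \<cdot>\<^sub>m mat n n (\<lambda>_. 1)"
  have Ag: "?Ag \<in> carrier_mat n n" using A by simp
  let ?D = "mat_diag n (\<lambda>i. 1 / sqrt (degree (sym_adj n X) i + (gp + gm)))"
  have D: "?D * ?Ag * ?D = mat n n (\<lambda>(i, j). h i * (symm X i j + (gp - gm) / real n) * h j)"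
    unfolding mat_diag_mult_left[OF Ag]
    by (subst mat_diag_mult_right[of _ n]) (auto simp: h_def deg Aij A intro!: eq_matI)
  show ?thesis
    unfolding reg_laplacian_def Let_def carrier_matD(1)[OF A] D by (intro eq_matI) auto
qed

text \<open>Davis-Kahan with \<open>U = Theta * R\<close> and
  \<open>L0 = 1 - Theta * Bbar * Theta\<^sup>T\<close>. The two population levels differ by
  \<open>5/6 * \<kappa> * n / k\<close>, and of this at least \<open>3/4 * E\<close>, with
  \<open>E = (1 - 2 * \<eta>) / k\<close>, survives the loss of
  \<open>\<epsilon> \<le> \<delta> * E / 10\<close>.\<close>

lemma embedding_close_of_concentrated:
  fixes a b :: real
  assumes con: "concentrated n cl p \<eta> q X" and n: "n \<ge> 10" and k: "k \<ge> 2" and part: "is_partition n k cl"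
    and p: "0 < p" "p \<le> 1" and \<eta>: "0 \<le> \<eta>" "\<eta> < 1/2"
    and size: "\<And>i. i < k \<Longrightarrow> a \<le> real (csize n cl i) \<and> real (csize n cl i) \<le> b" and ab: "11 * b \<le> 12 * a"
    and q: "1 \<le> q" and d: "q^8 = p * (real n - 1)"
    and \<delta>: "0 < \<delta>" "\<delta> < 1/2" and q\<delta>: "2500 / q \<le> \<delta> * (1 - 2 * \<eta>) / (10 * real k)"
    and g: "gp \<ge> 0" "gm \<ge> 0" "gp + gm = q^7"
    and V: "bottom_eigvecs (reg_laplacian (sym_adj n X) gp gm) (k - 1) V"
    and R: "bottom_eigvecs (Cbar n k cl p \<eta>) (k - 1) R"
  shows "\<exists>Q. orth_mat (k - 1) Q \<and> op_norm (V - Theta n k cl * R * Q) \<le> 2 * \<delta>"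
proof -
  define \<kappa> where "\<kappa> = p / (p * (real n - 1)) * (1 - 2 * \<eta>)"
  define \<alpha> where "\<alpha> = 1 + \<kappa>"
  let ?m = "k - 1" and ?B = "Bbar n cl k \<kappa>" and ?T = "Theta n k cl"
  let ?M = "\<alpha> \<cdot>\<^sub>m 1\<^sub>m k - ?B"
  have M: "Cbar n k cl p \<eta> = ?M" unfolding Cbar_eq \<alpha>_def \<kappa>_def ..
  have \<kappa>eq: "\<kappa> = p * (1 - 2 * \<eta>) / q^8" unfolding \<kappa>_def d by simp
  have \<kappa>0: "0 < \<kappa>" unfolding \<kappa>eq using p \<eta> q by simp
  have R': "bottom_eigvecs ?M ?m R" using R unfolding M .
  have n0: "n > 0" using n by simp
  obtain lam where MR: "?M * R = R * mat_diag ?m lam"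
    and lam: "\<forall>i<?m. lam i \<le> \<alpha> - 11/6 * \<kappa> * real n / real k"
    and high: "\<forall>z\<in>carrier_vec k. R\<^sup>T *\<^sub>v z = 0\<^sub>v ?m \<longrightarrow> z \<bullet> (?B *\<^sub>v z) \<le> \<kappa> * real n / real k * (z \<bullet> z)"
    by (rule population_gap[OF part k n0 \<kappa>0 size ab refl R'])
  note T = Theta_carrier[of n k cl] and B = Bbar_carrier[of n cl k \<kappa>]
  have Tt: "?T\<^sup>T \<in> carrier_mat k n" using T by simp
  have Mc: "?M \<in> carrier_mat k k" by (rule minus_carrier_mat[OF B])
  have Rc: "R \<in> carrier_mat k ?m" "R\<^sup>T * R = 1\<^sub>m ?m"
    using R' Mc by (auto simp: bottom_eigvecs_def)
  have Rt: "R\<^sup>T \<in> carrier_mat ?m k" using Rc by simp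
  define U where "U = ?T * R"
  have U: "U \<in> carrier_mat n ?m" unfolding U_def by (rule mult_carrier_mat[OF T Rc(1)])
  have Utr: "U\<^sup>T = R\<^sup>T * ?T\<^sup>T" unfolding U_def by (rule transpose_mult[OF T Rc(1)])
  have UtU: "U\<^sup>T * U = 1\<^sub>m ?m"
  proof -
    have "U\<^sup>T * U = R\<^sup>T * (?T\<^sup>T * U)"
      unfolding Utr by (rule assoc_mult_mat[OF Rt Tt U])
    also have "?T\<^sup>T * U = (?T\<^sup>T * ?T) * R"
      unfolding U_def by (rule assoc_mult_mat[OF Tt T Rc(1), symmetric])
    also have "\<dots> = R" using Theta_isometry[OF part] Rc(1) by simp
    finally show ?thesis using Rc(2) by simp
  qed
  define S where "S = ?T * (?B * ?T\<^sup>T)"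
  have BT: "?B * ?T\<^sup>T \<in> carrier_mat k n" by (rule mult_carrier_mat[OF B Tt])
  have S: "S \<in> carrier_mat n n" unfolding S_def by (rule mult_carrier_mat[OF T BT])
  define L0 where "L0 = 1\<^sub>m n - S"
  have L0: "L0 \<in> carrier_mat n n" unfolding L0_def by (rule minus_carrier_mat[OF S])
  have Tv: "?T *\<^sub>v z \<in> carrier_vec n" if "z \<in> carrier_vec k" for z by (rule mult_mat_vec_carrier[OF T that])
  have Ttv: "?T\<^sup>T *\<^sub>v y \<in> carrier_vec k" if "y \<in> carrier_vec n" for y by (rule mult_mat_vec_carrier[OF Tt that])
  have Bv: "?B *\<^sub>v z \<in> carrier_vec k" if "z \<in> carrier_vec k" for z by (rule mult_mat_vec_carrier[OF B that])
  have L0v: "L0 *\<^sub>v y = y - ?T *\<^sub>v (?B *\<^sub>v (?T\<^sup>T *\<^sub>v y))" if y: "y \<in> carrier_vec n" for y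
    unfolding L0_def S_def
    using minus_mult_distrib_mat_vec[OF one_carrier_mat S[unfolded S_def] y]
      assoc_mult_mat_vec[OF T BT y] assoc_mult_mat_vec[OF B Tt y] y by simp
  have TtT: "?T\<^sup>T *\<^sub>v (?T *\<^sub>v w) = w" if w: "w \<in> carrier_vec k" for w
    using assoc_mult_mat_vec[OF Tt T w] Theta_isometry[OF part] w by simp
  \<comment> \<open>On the range of \<open>U\<close> the eigenvalues of \<open>L0\<close> are those
    of \<open>Cbar\<close> shifted by \<open>1 - \<alpha>\<close>, because \<open>Cbar\<close> has
    \<open>\<alpha>\<close> where \<open>L0\<close> has 1.\<close>
  define N where "N = mat_diag ?m (\<lambda>i. 1 - \<alpha> + lam i)"
  have N: "N \<in> carrier_mat ?m ?m" unfolding N_def by (rule mat_diag_dim)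
  have L0U: "L0 * U = U * N"
  proof (rule mat_col_eqI)
    fix c assume "c < dim_col (U * N)"
    then have c: "c < ?m" using N by simp
    let ?w = "col R c"
    have w: "?w \<in> carrier_vec k" using Rc(1) by auto
    have cU: "col U c = ?T *\<^sub>v ?w" unfolding U_def by (rule col_mult2[OF T Rc(1) c])
    have "\<alpha> \<cdot>\<^sub>v ?w - ?B *\<^sub>v ?w = lam c \<cdot>\<^sub>v ?w"
      using eigen_col[OF Mc Rc(1) MR c] smult_one_minus_mult_vec[OF B w, of \<alpha>] by simp
    then have eq: "\<alpha> * ?w $ i - (?B *\<^sub>v ?w) $ i = lam c * ?w $ i" if "i < k" for i
      using that w Bv[OF w] by (metis carrier_vecD index_minus_vec(1) index_smult_vec(1))
    have Bw: "?B *\<^sub>v ?w = (\<alpha> - lam c) \<cdot>\<^sub>v ?w"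
    proof (rule eq_vecI)
      fix i assume "i < dim_vec ((\<alpha> - lam c) \<cdot>\<^sub>v ?w)"
      then have i: "i < k" using Rc(1) by simp
      have "((\<alpha> - lam c) \<cdot>\<^sub>v ?w) $ i = (\<alpha> - lam c) * ?w $ i" using i Rc(1) by (intro index_smult_vec) auto
      then show "(?B *\<^sub>v ?w) $ i = ((\<alpha> - lam c) \<cdot>\<^sub>v ?w) $ i" using eq[OF i] by (simp only: left_diff_distrib)
    qed (use Rc(1) B in auto)
    have "col (L0 * U) c = L0 *\<^sub>v col U c" by (rule col_mult2[OF L0 U c])
    also have "\<dots> = ?T *\<^sub>v ?w - (\<alpha> - lam c) \<cdot>\<^sub>v (?T *\<^sub>v ?w)"
      unfolding cU L0v[OF Tv[OF w]] TtT[OF w] Bw mult_mat_vec[OF T w] ..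
    also have "\<dots> = (1 - \<alpha> + lam c) \<cdot>\<^sub>v col U c"
      unfolding cU using Tv[OF w] by (intro eq_vecI) (auto simp: algebra_simps simp del: index_mult_mat_vec)
    also have "\<dots> = col (U * N) c"
      unfolding N_def mat_diag_mult_right[OF U] using U c by (intro eq_vecI) auto
    finally show "col (L0 * U) c = col (U * N) c" .
  qed (use L0 U N in auto)
  define L where "L = reg_laplacian (sym_adj n X) gp gm"
  define h where "h = (\<lambda>i. 1 / sqrt ((\<Sum>j<n. abs_adj X i j) + q^7))"
  have Lm: "L = mat n n (\<lambda>(i, j). (if i = j then 1 else 0) - h i * (symm X i j + (gp - gm) / real n) * h j)"
    unfolding L_def reg_laplacian_index g(3) h_def ..
  have L: "L \<in> carrier_mat n n" "L\<^sup>T = L"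
    unfolding Lm by (auto simp: symm_commute intro!: eq_matI)
  define \<epsilon> where "\<epsilon> = 2500 / q"
  have err: "\<bar>x \<bullet> (L *\<^sub>v y) - x \<bullet> (L0 *\<^sub>v y)\<bar> \<le> \<epsilon> * sqrt (x \<bullet> x) * sqrt (y \<bullet> y)"
    if x: "x \<in> carrier_vec n" and y: "y \<in> carrier_vec n" for x y
  proof -
    have nq: "nsq n (\<lambda>i. z $ i) = z \<bullet> z" if "z \<in> carrier_vec n" for z
      unfolding scalar_prod_self_sum[OF that] nsq_def ..
    let ?w = "\<lambda>i j. h i * (symm X i j + (gp - gm) / real n) * h j - p * (1 - 2 * \<eta>) / q^8 * sgn_cl cl i j"
    have "x \<bullet> (L *\<^sub>v y) - x \<bullet> (L0 *\<^sub>v y) = (\<Sum>i<n. \<Sum>j<n. - (?w i j * x $ i * y $ j))"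
      unfolding scalar_prod_mult_mat_vec_sum[OF L(1) x y] scalar_prod_mult_mat_vec_sum[OF L0 x y] sum_subtractf[symmetric]
    proof (intro sum.cong refl)
      fix i j assume "i \<in> {..<n}" "j \<in> {..<n}"
      then have ij: "i < n" "j < n" by auto
      have "L0 $$ (i, j) = (if i = j then 1 else 0) - p * (1 - 2 * \<eta>) / q^8 * sgn_cl cl i j"
      proof -
        have "S $$ (i, j) = p * (1 - 2 * \<eta>) / q^8 * sgn_cl cl i j"
          unfolding S_def Theta_Bbar_Theta_index[OF part ij] sgn_cl_def \<kappa>eq ..
        then show ?thesis using ij S by (simp add: L0_def)
      qed
      moreover have "L $$ (i, j) = (if i = j then 1 else 0) - h i * (symm X i j + (gp - gm) / real n) * h j"
        using ij by (simp add: Lm)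
      ultimately show "L $$ (i, j) * x $ i * y $ j - L0 $$ (i, j) * x $ i * y $ j = - (?w i j * x $ i * y $ j)"
        by (simp only: left_diff_distrib)
    qed
    also have "\<dots> = - bil n ?w (\<lambda>i. x $ i) (\<lambda>i. y $ i)" unfolding bil_def sum_negf ..
    finally have e: "\<bar>x \<bullet> (L *\<^sub>v y) - x \<bullet> (L0 *\<^sub>v y)\<bar> = \<bar>bil n ?w (\<lambda>i. x $ i) (\<lambda>i. y $ i)\<bar>" by simp
    have "\<bar>(gp - gm) / real n\<bar> \<le> q^7 / real n" using g by (simp add: abs_divide divide_right_mono)
    from laplacian_perturbation_bound[OF con n p \<eta>(1) less_imp_le[OF \<eta>(2)] q d this, of "\<lambda>i. x $ i" "\<lambda>i. y $ i"]
    show ?thesis unfolding e nq[OF x] nq[OF y] \<epsilon>_def h_def .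
  qed
  define E where "E = (1 - 2 * \<eta>) / real k"
  have E0: "0 < E" using \<eta> k by (simp add: E_def)
  have \<kappa>E: "E \<le> \<kappa> * real n / real k"
  proof -
    have "1 - 2 * \<eta> \<le> \<kappa> * real n" using p \<eta> n by (simp add: \<kappa>_def field_simps)
    then show ?thesis unfolding E_def by (rule divide_right_mono) simp
  qed
  have \<epsilon>E: "\<epsilon> \<le> \<delta> * E / 10" using q\<delta> by (simp add: \<epsilon>_def E_def)
  let ?t1 = "1 - 11/6 * \<kappa> * real n / real k" and ?t2 = "1 - \<kappa> * real n / real k"
  have \<delta>E: "\<delta> * E \<le> 1/2 * E" using \<delta> E0 by (intro mult_right_mono) auto
  have gap: "3/4 * E \<le> ?t2 - ?t1 - \<epsilon>" using \<kappa>E \<epsilon>E \<delta>E E0 by linarith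
  have "\<exists>Q. orth_mat ?m Q \<and> op_norm (V - U * Q) \<le> sqrt 2 * \<delta>"
  proof (rule davis_kahan[OF L L0 U UtU N L0U _ V[folded L_def] _ _ err])
    show "0 < ?m" using k by simp
  next
    fix c :: "real vec" assume c: "c \<in> carrier_vec ?m"
    have Nc: "N *\<^sub>v c \<in> carrier_vec ?m" by (rule mult_mat_vec_carrier[OF N c])
    have "L0 *\<^sub>v (U *\<^sub>v c) = U *\<^sub>v (N *\<^sub>v c)"
      using assoc_mult_mat_vec[OF L0 U c] assoc_mult_mat_vec[OF U N c] L0U by simp
    then have "(U *\<^sub>v c) \<bullet> (L0 *\<^sub>v (U *\<^sub>v c)) = c \<bullet> (N *\<^sub>v c)" using isometry_scalar_prod[OF U UtU c Nc] by simp
    also have "\<dots> = (\<Sum>i<?m. (1 - \<alpha> + lam i) * (c $ i)\<^sup>2)"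
      unfolding N_def scalar_prod_mat_diag[OF c c] by (simp add: power2_eq_square mult.assoc)
    also have "\<dots> \<le> (\<Sum>i<?m. ?t1 * (c $ i)\<^sup>2)" using lam by (intro sum_mono mult_right_mono) auto
    also have "\<dots> = ?t1 * (c \<bullet> c)" by (simp only: scalar_prod_self_sum[OF c] sum_distrib_left)
    finally show "(U *\<^sub>v c) \<bullet> (L0 *\<^sub>v (U *\<^sub>v c)) \<le> ?t1 * (c \<bullet> c)" .
  next
    fix y :: "real vec" assume y: "y \<in> carrier_vec n" and Uy: "U\<^sup>T *\<^sub>v y = 0\<^sub>v ?m"
    let ?z = "?T\<^sup>T *\<^sub>v y"
    note z = Ttv[OF y]
    have "R\<^sup>T *\<^sub>v ?z = 0\<^sub>v ?m" using Uy assoc_mult_mat_vec[OF Rt Tt y] unfolding Utr by simp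
    then have hz: "?z \<bullet> (?B *\<^sub>v ?z) \<le> \<kappa> * real n / real k * (?z \<bullet> ?z)" using high z by blast
    have yT: "y \<bullet> (?T *\<^sub>v w) = ?z \<bullet> w" if w: "w \<in> carrier_vec k" for w
      by (rule transpose_vec_mult_scalar[OF T w y, symmetric])
    \<comment> \<open>Bessel's inequality: \<open>Theta\<close> has orthonormal columns, so the
      coefficient vector \<open>?z\<close> is no longer than \<open>y\<close>.\<close>
    have "0 \<le> (y - ?T *\<^sub>v ?z) \<bullet> (y - ?T *\<^sub>v ?z)" by (rule scalar_prod_self_nonneg)
    also have "\<dots> = y \<bullet> y - y \<bullet> (?T *\<^sub>v ?z) - ((?T *\<^sub>v ?z) \<bullet> y - (?T *\<^sub>v ?z) \<bullet> (?T *\<^sub>v ?z))"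
      using y Tv[OF z] by (simp add: minus_scalar_prod_distrib[of _ n] scalar_prod_minus_distrib[of _ n])
    also have "(?T *\<^sub>v ?z) \<bullet> y = y \<bullet> (?T *\<^sub>v ?z)" by (rule comm_scalar_prod[OF Tv[OF z] y])
    also have "(?T *\<^sub>v ?z) \<bullet> (?T *\<^sub>v ?z) = ?z \<bullet> ?z" by (rule isometry_scalar_prod[OF T Theta_isometry[OF part] z z])
    finally have zy: "?z \<bullet> ?z \<le> y \<bullet> y" unfolding yT[OF z] by linarith
    have "y \<bullet> (L0 *\<^sub>v y) = y \<bullet> y - ?z \<bullet> (?B *\<^sub>v ?z)"
      unfolding L0v[OF y] using scalar_prod_minus_distrib[OF y y Tv[OF Bv[OF z]]] yT[OF Bv[OF z]] by simp
    moreover have "\<kappa> * real n / real k * (?z \<bullet> ?z) \<le> \<kappa> * real n / real k * (y \<bullet> y)"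
      using zy \<kappa>0 by (intro mult_left_mono) auto
    ultimately show "?t2 * (y \<bullet> y) \<le> y \<bullet> (L0 *\<^sub>v y)" using hz by (simp add: left_diff_distrib)
  next
    show "0 < ?t2 - ?t1 - \<epsilon>" using gap E0 by linarith
  next
    have "\<epsilon> \<le> 3/4 * (\<delta> * E)" using \<epsilon>E mult_pos_pos[OF \<delta>(1) E0] by linarith
    also have "\<dots> = \<delta> * (3/4 * E)" by simp
    also have "\<dots> \<le> \<delta> * (?t2 - ?t1 - \<epsilon>)" using gap \<delta> by (intro mult_left_mono) auto
    finally show "\<epsilon> \<le> \<delta> * (?t2 - ?t1 - \<epsilon>)" .
  qed (use \<delta> in auto)
  then obtain Q where Q: "orth_mat ?m Q" "op_norm (V - U * Q) \<le> sqrt 2 * \<delta>" by blast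
  have "sqrt 2 \<le> 2" by (rule real_le_lsqrt) auto
  then have "sqrt 2 * \<delta> \<le> 2 * \<delta>" using \<delta> by (intro mult_right_mono) auto
  then show ?thesis using Q unfolding U_def by (meson order_trans)
qed

text \<open>For \<open>k \<ge> 2\<close> the denominator is at least 24, so the ratio of the sizes
  is at least \<open>(23/24)^2 = 529/576\<close>, just above \<open>11/12\<close>.\<close>

lemma balanced_sizes:
  fixes a b :: real
  assumes k: "k \<ge> 2" and a: "0 \<le> a" and b: "0 < b"
    and h: "sqrt (a / b) > 1 - 1 / (4 * real k * (2 + sqrt (real k)))"
  shows "11 * b \<le> 12 * a"
proof -
  have "1 \<le> sqrt (real k)" using k by simp
  then have "4 * 2 * 3 \<le> 4 * real k * (2 + sqrt (real k))" using k by (intro mult_mono) auto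
  then have "1 / (4 * real k * (2 + sqrt (real k))) \<le> 1 / 24" by (intro divide_left_mono) auto
  then have "23/24 \<le> sqrt (a / b)" using h by linarith
  then have "(23/24)\<^sup>2 \<le> (sqrt (a / b))\<^sup>2" by (rule power_mono) simp
  also have "\<dots> = a / b" using a b by simp
  finally have "529 * b \<le> 576 * a" using b by (simp add: power2_eq_square field_simps)
  then show ?thesis using b by linarith
qed

theorem mainTheorem6:
  "\<exists>C :: real. C > 1 \<and> (\<exists>c :: real. c > 0 \<and>
    (\<forall>(n :: nat) (k :: nat) (cl :: nat \<Rightarrow> nat) (p :: real) (\<eta> :: real) (\<delta> :: real)
       (r :: real) (gp :: real) (gm :: real).
      n \<ge> 10 \<and> k \<ge> 2 \<and> is_partition n k cl \<and> 0 < p \<and> p \<le> 1 \<and> 0 \<le> \<eta> \<and> \<eta> < 1/2 \<and>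
      (let s = real (Min ((csize n cl) ` {..<k})) / real n;
           l = real (Max ((csize n cl) ` {..<k})) / real n
       in sqrt (s / l) > 1 - 1 / (4 * real k * (2 + sqrt (real k)))) \<and>
      0 < \<delta> \<and> \<delta> < 1/2 \<and> r \<ge> 1 \<and>
      p > (2 * real k * (128 * C * r\<^sup>2 + 1) / (\<delta> * (1 - 2 * \<eta>))) ^ 8 * (2 / real n) \<and>
      gp \<ge> 0 \<and> gm \<ge> 0 \<and> gp + gm = (p * (real n - 1)) powr (7/8)
      \<longrightarrow>
      measure_pmf.prob (ssbm n cl p \<eta>)
        {A. \<forall>V R. bottom_eigvecs (reg_laplacian A gp gm) (k - 1) V \<and>
                   bottom_eigvecs (Cbar n k cl p \<eta>) (k - 1) R \<longrightarrow>
              (\<exists>Q. orth_mat (k - 1) Q \<and>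
                   op_norm (V - Theta n k cl * R * Q) \<le> 2 * \<delta>)}
      \<ge> 1 - 7 * exp (- 2 * r) - 2 / real n - real n * exp (- real n * p / c)))"
\<comment> \<open>With \<open>C = 100\<close> and \<open>r \<ge> 1\<close> the numerator in the
  hypothesis on \<open>p\<close> is at least \<open>25600 * k\<close>, more than the
  \<open>2500 * 10 * k\<close> that brings \<open>2500 / q\<close> below
  \<open>\<delta> * (1 - 2 * \<eta>) / (10 * k)\<close>. The value \<open>c = 32\<close> is the
  constant of \<open>prob_concentrated\<close>.\<close>
proof (rule exI[of _ "100::real"], rule conjI, simp, rule exI[of _ "32::real"], intro conjI allI impI)
  fix n k :: nat and cl :: "nat \<Rightarrow> nat" and p \<eta> \<delta> r gp gm :: real
  let ?a = "Min (csize n cl ` {..<k})" and ?b = "Max (csize n cl ` {..<k})"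
  assume "n \<ge> 10 \<and> k \<ge> 2 \<and> is_partition n k cl \<and> 0 < p \<and> p \<le> 1 \<and> 0 \<le> \<eta> \<and> \<eta> < 1/2 \<and>
      (let s = real ?a / real n; l = real ?b / real n
       in sqrt (s / l) > 1 - 1 / (4 * real k * (2 + sqrt (real k)))) \<and>
      0 < \<delta> \<and> \<delta> < 1/2 \<and> r \<ge> 1 \<and>
      p > (2 * real k * (128 * 100 * r\<^sup>2 + 1) / (\<delta> * (1 - 2 * \<eta>))) ^ 8 * (2 / real n) \<and>
      gp \<ge> 0 \<and> gm \<ge> 0 \<and> gp + gm = (p * (real n - 1)) powr (7/8)"
  then have n: "n \<ge> 10" and k: "k \<ge> 2" and part: "is_partition n k cl" and p: "0 < p" "p \<le> 1"
    and \<eta>: "0 \<le> \<eta>" "\<eta> < 1/2"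
    and bal: "sqrt ((real ?a / real n) / (real ?b / real n)) > 1 - 1 / (4 * real k * (2 + sqrt (real k)))"
    and \<delta>: "0 < \<delta>" "\<delta> < 1/2" and r: "r \<ge> 1"
    and pbig: "p > (2 * real k * (128 * 100 * r\<^sup>2 + 1) / (\<delta> * (1 - 2 * \<eta>))) ^ 8 * (2 / real n)"
    and g: "gp \<ge> 0" "gm \<ge> 0" "gp + gm = (p * (real n - 1)) powr (7/8)"
    by (auto simp: Let_def)
  have sz: "real ?a \<le> real (csize n cl i) \<and> real (csize n cl i) \<le> real ?b" if "i < k" for i
    using that by auto
  have "0 < csize n cl 0" using csize_pos[OF part, of 0] k by simp
  then have b0: "0 < real ?b" using sz[of 0] k by linarith
  have ab: "11 * real ?b \<le> 12 * real ?a"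
    using bal n by (intro balanced_sizes[OF k _ b0]) auto
  define d where "d = p * (real n - 1)"
  have d0: "0 < d" using p n by (simp add: d_def)
  define q where "q = d powr (1/8)"
  have q0: "0 < q" using d0 by (simp add: q_def)
  have q8: "q^8 = d" using d0 by (simp add: q_def powr_realpow[symmetric] powr_powr)
  have q7: "q^7 = d powr (7/8)" using d0 by (simp add: q_def powr_realpow[symmetric] powr_powr)
  define Y where "Y = 2 * real k * (128 * 100 * r\<^sup>2 + 1) / (\<delta> * (1 - 2 * \<eta>))"
  have e0: "0 < \<delta> * (1 - 2 * \<eta>)" using \<delta> \<eta> by simp
  have "Y ^ 8 \<le> q ^ 8"
  proof -
    \<comment> \<open>The factor 2 in \<open>2 / n\<close> bridges \<open>n\<close> and the
      \<open>n - 1\<close> of the expected degree, so that \<open>q\<close> dominates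
      \<open>Y\<close> itself.\<close>
    have "Y ^ 8 < p * (real n / 2)" using pbig n unfolding Y_def[symmetric] by (simp add: field_simps)
    also have "\<dots> \<le> d" unfolding d_def using p n by (intro mult_left_mono) auto
    finally show ?thesis using q8 by simp
  qed
  then have Yq: "Y \<le> q" by (rule power_le_imp_le_base[of _ 7, simplified]) (use q0 in simp)
  have Y1: "25600 * real k / (\<delta> * (1 - 2 * \<eta>)) \<le> Y"
  proof -
    have "1 \<le> r\<^sup>2" using r by simp
    then have "2 * real k * 12800 \<le> 2 * real k * (128 * 100 * r\<^sup>2 + 1)" by (intro mult_left_mono) auto
    then show ?thesis unfolding Y_def using e0 by (intro divide_right_mono) auto
  qed
  have q\<delta>: "2500 / q \<le> \<delta> * (1 - 2 * \<eta>) / (10 * real k)"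
  proof -
    have k0: "0 < real k" using k by simp
    have "25600 * real k \<le> q * (\<delta> * (1 - 2 * \<eta>))" 
      using order_trans[OF Y1 Yq] by (simp only: pos_divide_le_eq[OF e0])
    then have "2500 * (10 * real k) \<le> q * (\<delta> * (1 - 2 * \<eta>))" using k0 by linarith
    then show ?thesis using q0 k0 by (simp add: field_simps)
  qed
  have q4: "4 \<le> q"
  proof -
    have "\<delta> * (1 - 2 * \<eta>) \<le> 1 * 1" using \<delta> \<eta> by (intro mult_mono) auto
    then have "25600 * real k / 1 \<le> 25600 * real k / (\<delta> * (1 - 2 * \<eta>))" using e0 by (intro divide_left_mono) auto
    then show ?thesis using Y1 Yq k by simp
  qed
  let ?P = "Pi_pmf (pairs n) 0 (\<lambda>(j, j'). entry_pmf p \<eta> (cl j = cl j'))"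
  let ?S = "{A. \<forall>V R. bottom_eigvecs (reg_laplacian A gp gm) (k - 1) V \<and>
                   bottom_eigvecs (Cbar n k cl p \<eta>) (k - 1) R \<longrightarrow>
              (\<exists>Q. orth_mat (k - 1) Q \<and> op_norm (V - Theta n k cl * R * Q) \<le> 2 * \<delta>)}"
  \<comment> \<open>The good event depends on the graph alone, so \<open>V\<close> and
    \<open>R\<close> may be chosen after it, and all choices are covered at once.\<close>
  have "{X. concentrated n cl p \<eta> q X} \<subseteq> sym_adj n -` ?S"
  proof
    fix X assume "X \<in> {X. concentrated n cl p \<eta> q X}"
    then have X: "concentrated n cl p \<eta> q X" by simp
    have "\<exists>Q. orth_mat (k - 1) Q \<and> op_norm (V - Theta n k cl * R * Q) \<le> 2 * \<delta>"
      if "bottom_eigvecs (reg_laplacian (sym_adj n X) gp gm) (k - 1) V" "bottom_eigvecs (Cbar n k cl p \<eta>) (k - 1) R" for V R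
      using that q4 q8 q7 g
      by (intro embedding_close_of_concentrated[OF X n k part p \<eta> sz ab _ _ \<delta> q\<delta>]) (auto simp: d_def)
    then show "X \<in> sym_adj n -` ?S" by blast
  qed
  then have "measure_pmf.prob ?P {X. concentrated n cl p \<eta> q X} \<le> measure_pmf.prob (ssbm n cl p \<eta>) ?S"
    unfolding ssbm_def measure_map_pmf by (intro measure_pmf.finite_measure_mono) auto
  moreover have "1 - 2 / real n - real n * exp (- real n * p / 32) \<le> measure_pmf.prob ?P {X. concentrated n cl p \<eta> q X}"
    using \<eta> by (intro prob_concentrated[OF n p _ _ q4]) (auto simp: q8 d_def)
  ultimately show "1 - 7 * exp (- 2 * r) - 2 / real n - real n * exp (- real n * p / 32) \<le> measure_pmf.prob (ssbm n cl p \<eta>) ?S"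
    using exp_ge_zero[of "- 2 * r"] by linarith
qed auto

end
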